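(* Let $\alpha\ge 1/2$. For $n\ge1$, let $\mathcal{F}_n$ be the fireproof forest resulting from the fire dynamics with firing rate $n^{-\alpha}$ on a uniform Cayley tree $\mathbf{t}_n$ on $[n]$, and let $U$ and $U'$ be two independent uniform random vertices in $[n]$, independent of $\mathcal{F}_n$. The probability that $U$ and $U'$ belong to the same tree-component of $\mathcal{F}_n$ converges, as $n\to\infty$, to $1$ if $\alpha>1/2$, and to $0$ if $\alpha=1/2$.
   Context: For $n\ge1$, $[n]=\{1,\dots,n\}$. A uniform Cayley tree $\mathbf{t}_n$ is a tree picked uniformly at random among the $n^{n-2}$ trees on the labeled vertex set $[n]$. Fire dynamics with firing rate $r>0$ on a finite tree: this is a continuous-time Markov process in which each edge is in one of three states: inflammable, fireproof, or burnt. Initially every edge is inflammable. The only transitions are from inflammable to fireproof or burnt. Each inflammable edge becomes fireproof at rate $1$, independently of the other edges. Each inflammable edge is also set on fire at rate $r$; when this happens, the fire propagates instantaneously through neighboring inflammable edges (edges sharing a vertex) and is stopped only at fireproof edges, so that all edges in the connected cluster of inflammable edges containing the edge set on fire become burnt. After a finite time all edges are either burnt or fireproof; this is the terminal state. Given the random tree $\mathbf{t}_n$, the dynamics are run on $\mathbf{t}_n$ with $r=n^{-\alpha}$. A vertex is called fireproof if all its adjacent edges are fireproof in the terminal state, and burnt otherwise. The fireproof forest $\mathcal{F}_n$ is the graph whose vertices are the fireproof vertices and whose edges are the fireproof edges with both end-points fireproof. Its tree-components are its connected components; two vertices belong to the same tree-component only if both are fireproof (in particular when $U=U'$ the event means that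 $U$ is fireproof). *)

theory Defs
  imports "HOL-Probability.Probability"
begin

section \<open>Simple graphs and labelled trees\<close>

text \<open>A graph is a pair of a vertex set and a set of two-element subsets of it.\<close>

type_synonym 'v graph = "'v set \<times> 'v set set"

definition same_component :: "'v graph \<Rightarrow> 'v \<Rightarrow> 'v \<Rightarrow> bool" where
  "same_component G u v \<longleftrightarrow>
     u \<in> fst G \<and> v \<in> fst G \<and> (u, v) \<in> {(a, b). {a, b} \<in> snd G}\<^sup>*"

definition is_cycle :: "'v graph \<Rightarrow> 'v list \<Rightarrow> bool" where
  "is_cycle G vs \<longleftrightarrow> 3 \<le> length vs \<and> distinct vs \<and>
     (\<forall>i<length vs. {vs ! i, vs ! (Suc i mod length vs)} \<in> snd G)"

definition is_tree :: "'v graph \<Rightarrow> bool" where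
  "is_tree G \<longleftrightarrow> fst G \<noteq> {} \<and>
     (\<forall>e\<in>snd G. \<exists>u\<in>fst G. \<exists>v\<in>fst G. u \<noteq> v \<and> e = {u, v}) \<and>
     (\<forall>u\<in>fst G. \<forall>v\<in>fst G. same_component G u v) \<and>
     (\<nexists>vs. is_cycle G vs)"

text \<open>Trees on a fixed vertex set are identified with their edge sets.\<close>

definition cayley_trees :: "nat \<Rightarrow> nat set set set" where
  "cayley_trees n = {E. is_tree ({1..n}, E)}"


section \<open>Continuous-time Markov processes on a finite state space\<close>

definition transition_semigroup :: "'s set \<Rightarrow> (real \<Rightarrow> 's \<Rightarrow> 's \<Rightarrow> real) \<Rightarrow> bool" where
  "transition_semigroup S p \<longleftrightarrow>
     (\<forall>t\<ge>0. \<forall>x\<in>S. (\<forall>y\<in>S. 0 \<le> p t x y) \<and> (\<Sum>y\<in>S. p t x y) = 1) \<and>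
     (\<forall>x\<in>S. \<forall>y\<in>S. p 0 x y = of_bool (x = y)) \<and>
     (\<forall>s\<ge>0. \<forall>t\<ge>0. \<forall>x\<in>S. \<forall>y\<in>S. p (s + t) x y = (\<Sum>z\<in>S. p s x z * p t z y))"

text \<open>
  \<open>q x y\<close> is the rate of jumps from \<open>x\<close> to \<open>y\<close>, for \<open>x \<noteq> y\<close>. As the rows of \<open>p t\<close> sum to \<open>1\<close>
  and \<open>S\<close> is finite, the diagonal of the generator is determined by the off-diagonal rates.
\<close>

definition has_jump_rates ::
  "'s set \<Rightarrow> (real \<Rightarrow> 's \<Rightarrow> 's \<Rightarrow> real) \<Rightarrow> ('s \<Rightarrow> 's \<Rightarrow> real) \<Rightarrow> bool" where
  "has_jump_rates S p q \<longleftrightarrow>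
     (\<forall>x\<in>S. \<forall>y\<in>S. x \<noteq> y \<longrightarrow> ((\<lambda>t. p t x y) has_real_derivative q x y) (at 0 within {0..}))"

text \<open>
  \<open>X\<close> is a right-continuous Markov process started from \<open>x0\<close>, with jump rates \<open>q\<close>, on the
  finite (discrete) state space \<open>S\<close>. That \<open>X t\<close> lies in \<open>S\<close> almost surely follows from its
  marginal law. It is not demanded on all of \<open>space M\<close>, since below \<open>M\<close> is a conditional law.
\<close>

definition markov_jump_process ::
  "'a measure \<Rightarrow> 's set \<Rightarrow> ('s \<Rightarrow> 's \<Rightarrow> real) \<Rightarrow> 's \<Rightarrow> (real \<Rightarrow> 'a \<Rightarrow> 's) \<Rightarrow> bool" where
  "markov_jump_process M S q x0 X \<longleftrightarrow>
     prob_space M \<and> finite S \<and> x0 \<in> S \<and>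
     (\<forall>t\<ge>0. X t \<in> measurable M (count_space UNIV)) \<and>
     (\<forall>\<omega>\<in>space M. \<forall>t\<ge>0. eventually (\<lambda>s. X s \<omega> = X t \<omega>) (at_right t)) \<and>
     (\<exists>p. transition_semigroup S p \<and> has_jump_rates S p q \<and>
       (\<forall>(k :: nat) (t :: nat \<Rightarrow> real) (x :: nat \<Rightarrow> 's).
          t 0 = 0 \<longrightarrow> (\<forall>i<k. t i \<le> t (Suc i)) \<longrightarrow> (\<forall>i\<le>k. x i \<in> S) \<longrightarrow>
          measure M {\<omega>\<in>space M. \<forall>i\<le>k. X (t i) \<omega> = x i} =
            of_bool (x 0 = x0) * (\<Prod>i<k. p (t (Suc i) - t i) (x i) (x (Suc i)))))"


section \<open>The fire dynamics\<close>

datatype edge_state = Inflammable | Fireproof | Burnt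

type_synonym 'v config = "'v set \<Rightarrow> edge_state"

definition configs :: "'v set set \<Rightarrow> 'v config set" where
  "configs E = E \<rightarrow>\<^sub>E UNIV"

definition initial_config :: "'v set set \<Rightarrow> 'v config" where
  "initial_config E = (\<lambda>e\<in>E. Inflammable)"

definition inflammable_edges :: "'v set set \<Rightarrow> 'v config \<Rightarrow> 'v set set" where
  "inflammable_edges E x = {e \<in> E. x e = Inflammable}"

definition inflammable_cluster :: "'v set set \<Rightarrow> 'v config \<Rightarrow> 'v set \<Rightarrow> 'v set set" where
  "inflammable_cluster E x e =
     {f. (e, f) \<in> {(a, b). a \<in> inflammable_edges E x \<and> b \<in> inflammable_edges E x \<and>
                          a \<inter> b \<noteq> {}}\<^sup>*}"

definition set_on_fire :: "'v set set \<Rightarrow> 'v config \<Rightarrow> 'v set \<Rightarrow> 'v config" where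
  "set_on_fire E x e = (\<lambda>f. if f \<in> inflammable_cluster E x e then Burnt else x f)"

text \<open>
  Distinct inflammable edges of one cluster lead to the same configuration when set on fire, so
  their rates add up.
\<close>

definition fire_rate :: "'v set set \<Rightarrow> real \<Rightarrow> 'v config \<Rightarrow> 'v config \<Rightarrow> real" where
  "fire_rate E r x y =
     (\<Sum>e\<in>inflammable_edges E x.
        1 * of_bool (y = x(e := Fireproof)) + r * of_bool (y = set_on_fire E x e))"

text \<open>The state in which the path is eventually constant; it exists almost surely.\<close>

definition terminal_state :: "(real \<Rightarrow> 'a \<Rightarrow> 's) \<Rightarrow> 'a \<Rightarrow> 's" where
  "terminal_state X \<omega> = (THE x. eventually (\<lambda>t. X t \<omega> = x) at_top)"

definition fireproof_vertices :: "'v graph \<Rightarrow> 'v config \<Rightarrow> 'v set" where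
  "fireproof_vertices G z = {v \<in> fst G. \<forall>e\<in>snd G. v \<in> e \<longrightarrow> z e = Fireproof}"

definition fireproof_forest :: "'v graph \<Rightarrow> 'v config \<Rightarrow> 'v graph" where
  "fireproof_forest G z =
     (fireproof_vertices G z, {e \<in> snd G. z e = Fireproof \<and> e \<subseteq> fireproof_vertices G z})"


section \<open>Fire dynamics on a uniform Cayley tree\<close>

text \<open>
  \<open>T\<close> is a uniform Cayley tree on \<open>{1..n}\<close>; conditionally on \<open>T\<close>, the process \<open>X\<close> is the fire
  dynamics on \<open>T\<close> with firing rate \<open>r\<close>; and \<open>U\<close>, \<open>U'\<close> are independent uniform vertices,
  independent of the resulting fireproof forest. The last independence is stated for the generated
  sigma-algebras, because \<open>indep_var\<close> requires both variables to have the same type.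
\<close>

locale fire_on_cayley_tree = prob_space M
  for M :: "'a measure" and n :: nat and r :: real
    and T :: "'a \<Rightarrow> nat set set" and X :: "real \<Rightarrow> 'a \<Rightarrow> nat config"
    and U U' :: "'a \<Rightarrow> nat" +
  assumes tree_measurable: "T \<in> measurable M (count_space (cayley_trees n))"
    and tree_uniform:
      "distr M (count_space (cayley_trees n)) T = uniform_count_measure (cayley_trees n)"
    and config_on_tree: "\<And>\<omega> t. \<omega> \<in> space M \<Longrightarrow> 0 \<le> t \<Longrightarrow> X t \<omega> \<in> configs (T \<omega>)"
    and fire_dynamics: "\<And>E. E \<in> cayley_trees n \<Longrightarrow>
      markov_jump_process (uniform_measure M {\<omega> \<in> space M. T \<omega> = E})
        (configs E) (fire_rate E r) (initial_config E) X"
    and U_measurable: "U \<in> measurable M (count_space {1..n})"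
    and U'_measurable: "U' \<in> measurable M (count_space {1..n})"
    and U_uniform: "distr M (count_space {1..n}) U = uniform_count_measure {1..n}"
    and U'_uniform: "distr M (count_space {1..n}) U' = uniform_count_measure {1..n}"
    and U_U'_indep: "indep_var (count_space {1..n}) U (count_space {1..n}) U'"
    and forest_indep: "indep_set
      {(\<lambda>\<omega>. fireproof_forest ({1..n}, T \<omega>) (terminal_state X \<omega>)) -` A \<inter> space M | A. True}
      {(\<lambda>\<omega>. (U \<omega>, U' \<omega>)) -` B \<inter> space M | B. True}"

end

theory Submission
  imports Defs "HOL-Real_Asymp.Real_Asymp"
begin

text \<open>
  A fire reaches the path (the spine) between \<open>U\<close> and \<open>U'\<close> from an edge \<open>e\<close> iff all edges between
  \<open>e\<close> and the spine are still inflammable, and \<open>U\<close>, \<open>U'\<close> are in the same tree-component iff all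
  edges touching the spine become fireproof. Writing \<open>d(e)\<close> for the number of edges from \<open>e\<close>
  (included) to the spine, the sum of \<open>r / d(e)\<close> over the edges still connected to the spine,
  replaced by \<open>1\<close> once the spine has burnt, is a supermartingale; so is \<open>exp (- r / 2 * \<Sigma> 1 / d(e))\<close>,
  the sum being over the edges with \<open>d(e) \<le> K\<close>, replaced by \<open>0\<close> once the spine has burnt, provided
  that no edge carries too many of the others. Given the tree, the separation probability is
  therefore at most \<open>r * \<Sigma> 1 / d(e)\<close>, and the connection probability at most \<open>exp (- r / 2 * \<Sigma> 1 / d(e))\<close>.

  A tree with two marked vertices is a spine together with a forest rooted at the spine. There are
  \<open>m n^(n-m-1)\<close> forests on \<open>n\<close> vertices with \<open>m\<close> given roots, whence the law of the spine, which has
  order \<open>sqrt n\<close> vertices, and the first two moments of the number of vertices at distance \<open>j\<close> from it,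
  which concentrates around \<open>m\<close> for \<open>j\<close> small compared to \<open>m\<close>. So \<open>\<Sigma> 1 / d(e)\<close> has order
  \<open>sqrt n * ln n\<close>, which is negligible against \<open>1 / r\<close> if \<open>\<alpha> > 1 / 2\<close> and dominates it if \<open>\<alpha> = 1 / 2\<close>.
\<close>

section \<open>Rooted forests\<close>

text \<open>The number \<open>1 / d(e)\<close> is the mean time for which all \<open>d(e)\<close>
  edges from \<open>e\<close> to the spine stay inflammable when each turns fireproof at rate 1, so
  \<open>r / d(e)\<close> is the expected number of fires that \<open>e\<close> would send to the
  spine. In the drift, \<open>e\<close> loses its share \<open>r / d(e)\<close> at rate
  \<open>d(e)\<close>, hence \<open>r\<close> per unit of time, and this pays exactly for its own
  fires. The exponential version is not exactly balanced: a single fireproof edge can cut off many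
  others at once, and the effect is controlled only if their total weight is at most of order
  \<open>1 / r\<close>. As this fails for some trees, a second moment of the subtrees hanging at the
  spine has to show that such trees are rare. A small \<open>K\<close> keeps these moments small,
  while \<open>ln K\<close> stays comparable to \<open>ln n\<close>. All counts rest on one move,
  which takes a child of a root and makes it a root. It keeps the number of vertices and adds one
  root. Repeated along a path it gives the law of the spine and of the forest around it; repeated
  generation by generation it gives the moments.\<close>

definition forests :: "'v set \<Rightarrow> 'v set \<Rightarrow> ('v \<Rightarrow> 'v) set" where
  "forests W C = {g \<in> W \<rightarrow>\<^sub>E W \<union> C. \<exists>h :: 'v \<Rightarrow> nat. \<forall>x\<in>W. g x \<in> W \<longrightarrow> h (g x) < h x}"

definition parent_rel :: "'v set \<Rightarrow> ('v \<Rightarrow> 'v) \<Rightarrow> ('v \<times> 'v) set" where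
  "parent_rel W g = {(x, g x) | x. x \<in> W}"

definition descendants :: "'v set \<Rightarrow> ('v \<Rightarrow> 'v) \<Rightarrow> nat \<Rightarrow> 'v \<Rightarrow> 'v set" where
  "descendants W g k z = {y. (y, z) \<in> parent_rel W g ^^ k}"

definition branch :: "'v set \<Rightarrow> ('v \<Rightarrow> 'v) \<Rightarrow> 'v \<Rightarrow> 'v set" where
  "branch W g y = {z \<in> W. (y, z) \<in> (parent_rel W g)\<^sup>*}"

lemma in_parent_rel [simp]: "(x, y) \<in> parent_rel W g \<longleftrightarrow> x \<in> W \<and> y = g x"
  by (auto simp: parent_rel_def)

lemma forestsI:
  assumes "g \<in> W \<rightarrow>\<^sub>E W \<union> C" "\<And>x. x \<in> W \<Longrightarrow> g x \<in> W \<Longrightarrow> h (g x) < (h x :: nat)"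
  shows "g \<in> forests W C"
  using assms unfolding forests_def by blast

lemma finite_forests [simp]: "finite W \<Longrightarrow> finite C \<Longrightarrow> finite (forests W C)"
  by (rule finite_subset[of _ "W \<rightarrow>\<^sub>E W \<union> C"]) (auto simp: forests_def intro!: finite_PiE)

lemma forests_in: "g \<in> forests W C \<Longrightarrow> x \<in> W \<Longrightarrow> g x \<in> W \<union> C"
  by (auto simp: forests_def PiE_iff)

lemma forests_undefined: "g \<in> forests W C \<Longrightarrow> x \<notin> W \<Longrightarrow> g x = undefined"
  by (auto simp: forests_def PiE_iff extensional_def)

lemma forests_empty [simp]: "forests {} C = {\<lambda>x. undefined}"
  by (auto simp: forests_def)

text \<open>A vertex of smallest rank has no admissible parent. In the count below this settles the
  empty first generation, to which the induction hypothesis does not apply.\<close>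

lemma forests_no_roots:
  assumes "W \<noteq> {}"
  shows "forests W {} = {}"
proof (rule ccontr)
  assume "forests W {} \<noteq> {}"
  then obtain g h where g: "g \<in> W \<rightarrow>\<^sub>E W" and h: "\<And>x. x \<in> W \<Longrightarrow> g x \<in> W \<longrightarrow> h (g x) < (h x :: nat)"
    by (auto simp: forests_def)
  obtain x where x: "x \<in> W" "\<And>y. y \<in> W \<Longrightarrow> h x \<le> h y"
    using assms exists_least_iff[of "\<lambda>m. \<exists>x\<in>W. h x = m"] by (metis all_not_in_conv leI)
  show False
    using h[OF x(1)] x g by (metis PiE_mem leD)
qed

text \<open>A child \<open>x\<close> of the root \<open>c\<close> can be detached and made a root
  without changing any other parent. Reattaching it creates no cycle, since \<open>x\<close> leads
  straight out of \<open>W\<close>.\<close>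

lemma bij_betw_forests_remove:
  assumes "x \<in> W" "W \<inter> C = {}" "c \<in> C"
  shows "bij_betw (\<lambda>g. restrict g (W - {x})) {g \<in> forests W C. g x = c}
    (forests (W - {x}) (insert x C))"
proof (rule bij_betwI[where g = "\<lambda>g. g(x := c)"])
  show "(\<lambda>g. restrict g (W - {x})) \<in> {g \<in> forests W C. g x = c} \<rightarrow> forests (W - {x}) (insert x C)"
    by (fastforce simp: forests_def PiE_iff)
  show "(\<lambda>g. g(x := c)) \<in> forests (W - {x}) (insert x C) \<rightarrow> {g \<in> forests W C. g x = c}"
  proof
    fix g assume g: "g \<in> forests (W - {x}) (insert x C)"
    obtain h where h: "\<And>y. y \<in> W - {x} \<Longrightarrow> g y \<in> W - {x} \<longrightarrow> h (g y) < (h y :: nat)"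
      using g by (auto simp: forests_def)
    have "g(x := c) \<in> W \<rightarrow>\<^sub>E W \<union> C"
      using g assms unfolding forests_def PiE_iff extensional_def by auto
    \<comment> \<open>As a root of the smaller forest, \<open>x\<close> had an arbitrary rank. It
      now gets rank 0, and raising the others by one keeps them above it.\<close>
    then have "g(x := c) \<in> forests W C"
      by (rule forestsI[where h = "\<lambda>z. if z = x then 0 else Suc (h z)"]) (use assms h in auto)
    then show "g(x := c) \<in> {g \<in> forests W C. g x = c}"
      by simp
  qed
qed (use assms in \<open>auto simp: forests_def fun_eq_iff PiE_iff extensional_def\<close>)

text \<open>Peeling off the first generation: its members, the set \<open>S\<close>, choose their
  roots freely, and \<open>S\<close> takes over as the root set of the remaining vertices.\<close>

lemma bij_betw_forests_children:
  assumes "W \<inter> C = {}"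
  shows "bij_betw (\<lambda>g. ({x \<in> W. g x \<in> C}, restrict g {x \<in> W. g x \<in> C}, restrict g {x \<in> W. g x \<notin> C}))
    (forests W C) (SIGMA S : Pow W. (S \<rightarrow>\<^sub>E C) \<times> forests (W - S) S)"
proof (rule bij_betwI[where g = "\<lambda>(S, a, g) x. if x \<in> S then a x else g x"])
  show "(\<lambda>g. ({x \<in> W. g x \<in> C}, restrict g {x \<in> W. g x \<in> C}, restrict g {x \<in> W. g x \<notin> C}))
      \<in> forests W C \<rightarrow> (SIGMA S : Pow W. (S \<rightarrow>\<^sub>E C) \<times> forests (W - S) S)"
  proof
    fix g assume g: "g \<in> forests W C"
    let ?S = "{x \<in> W. g x \<in> C}"
    have eq: "{x \<in> W. g x \<notin> C} = W - ?S" by auto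
    obtain h where h: "\<And>y. y \<in> W \<Longrightarrow> g y \<in> W \<longrightarrow> h (g y) < (h y :: nat)"
      using g by (auto simp: forests_def)
    have "restrict g (W - ?S) \<in> (W - ?S) \<rightarrow>\<^sub>E (W - ?S) \<union> ?S"
      using forests_in[OF g] by auto
    then have "restrict g (W - ?S) \<in> forests (W - ?S) ?S"
      unfolding forests_def using h by (auto intro!: exI[of _ h])
    then show "({x \<in> W. g x \<in> C}, restrict g {x \<in> W. g x \<in> C}, restrict g {x \<in> W. g x \<notin> C})
       \<in> (SIGMA S : Pow W. (S \<rightarrow>\<^sub>E C) \<times> forests (W - S) S)"
      unfolding eq by auto
  qed
  show "(\<lambda>(S, a, g) x. if x \<in> S then a x else g x)
      \<in> (SIGMA S : Pow W. (S \<rightarrow>\<^sub>E C) \<times> forests (W - S) S) \<rightarrow> forests W C"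
  proof clarify
    fix S a g assume S: "S \<subseteq> W" and a: "a \<in> S \<rightarrow>\<^sub>E C" and g: "g \<in> forests (W - S) S"
    obtain h where h: "\<And>y. y \<in> W - S \<Longrightarrow> g y \<in> W - S \<longrightarrow> h (g y) < (h y :: nat)"
      using g by (auto simp: forests_def)
    have "(\<lambda>x. if x \<in> S then a x else g x) \<in> W \<rightarrow>\<^sub>E W \<union> C"
      using S a g unfolding forests_def PiE_iff extensional_def by auto
    then show "(\<lambda>x. if x \<in> S then a x else g x) \<in> forests W C"
      by (rule forestsI[where h = "\<lambda>z. if z \<in> S then 0 else Suc (h z)"])
        (use assms a h in \<open>auto simp: PiE_iff\<close>)
  qed
  show "(case ({x \<in> W. g x \<in> C}, restrict g {x \<in> W. g x \<in> C}, restrict g {x \<in> W. g x \<notin> C}) of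
      (S, a, g) \<Rightarrow> \<lambda>x. if x \<in> S then a x else g x) = g" if "g \<in> forests W C" for g
    using that by (auto simp: forests_def fun_eq_iff PiE_iff extensional_def)
  fix y assume "y \<in> (SIGMA S : Pow W. (S \<rightarrow>\<^sub>E C) \<times> forests (W - S) S)"
  then obtain S a g where y: "y = (S, a, g)" and S: "S \<subseteq> W" and a: "a \<in> S \<rightarrow>\<^sub>E C"
    and g: "g \<in> forests (W - S) S"
    by auto
  have gW: "g x \<in> W" if "x \<in> W" "x \<notin> S" for x
    using forests_in[OF g, of x] that S by auto
  have 1: "{x \<in> W. (if x \<in> S then a x else g x) \<in> C} = S"
    using S a gW assms by (auto simp: PiE_iff)
  have 2: "{x \<in> W. (if x \<in> S then a x else g x) \<notin> C} = W - S"
    using S a gW assms by (auto simp: PiE_iff)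
  show "(\<lambda>g. ({x \<in> W. g x \<in> C}, restrict g {x \<in> W. g x \<in> C}, restrict g {x \<in> W. g x \<notin> C}))
      ((\<lambda>(S, a, g) x. if x \<in> S then a x else g x) y) = y"
    unfolding y prod.case 1 2 
    using a forests_undefined[OF g]
    by (auto simp: fun_eq_iff PiE_iff extensional_def)
qed

lemma sum_over_Pow:
  assumes "finite W"
  shows "(\<Sum>S\<in>Pow W. f (card S)) = (\<Sum>k\<le>card W. of_nat (card W choose k) * (f k :: 'b::comm_semiring_1))"
proof -
  have "(\<Sum>S\<in>Pow W. f (card S)) = (\<Sum>k\<le>card W. \<Sum>S\<in>{S\<in>Pow W. card S = k}. f (card S))"
    using assms by (intro sum.group[symmetric]) (auto intro: card_mono)
  also have "\<dots> = (\<Sum>k\<le>card W. of_nat (card W choose k) * f k)"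
    using assms by (intro sum.cong refl) (simp add: n_subsets)
  finally show ?thesis .
qed

text \<open>For \<open>v\<close> non-root vertices, \<open>c\<close> roots and
  \<open>n = v + c\<close> the number is \<open>c * n ^ (v - 1)\<close>; the multiplied form also
  covers \<open>v = 0\<close>. Peeling off the first generation leaves forests with \<open>v\<close>
  vertices in all, so after multiplication by \<open>v\<close> the induction hypothesis applies and
  the sum over the size of that generation is a differentiated binomial formula.\<close>

theorem card_forests:
  assumes "finite W" "finite C" "W \<inter> C = {}"
  shows "real (card W + card C) * card (forests W C) = card C * real (card W + card C) ^ card W"
  using assms
proof (induction "card W" arbitrary: W C rule: less_induct)
  case less
  show ?case
  proof (cases "W = {} \<or> C = {}")
    case True
    then show ?thesis by (cases "W = {}") (auto simp: forests_no_roots)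
  next
    case False
    let ?v = "card W" and ?c = "card C"
    have v: "?v > 0" using False less.prems by auto
    have "card (forests W C) = card (SIGMA S : Pow W. (S \<rightarrow>\<^sub>E C) \<times> forests (W - S) S)"
      using bij_betw_same_card[OF bij_betw_forests_children] less.prems by blast
    also have "\<dots> = (\<Sum>S\<in>Pow W. ?c ^ card S * card (forests (W - S) S))"
      using less.prems by (subst card_SigmaI)
        (auto simp: card_cartesian_product card_PiE finite_subset intro!: sum.cong finite_cartesian_product finite_PiE finite_forests)
    finally have "real ?v * card (forests W C)
      = (\<Sum>S\<in>Pow W. real ?c ^ card S * (?v * card (forests (W - S) S)))"
      by (simp add: sum_distrib_left algebra_simps)
    also have "\<dots> = (\<Sum>S\<in>Pow W. real ?c ^ card S * (card S * real ?v ^ (?v - card S)))"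
    proof (intro sum.cong refl)
      fix S assume S: "S \<in> Pow W"
      then have fS: "finite S" using less.prems finite_subset by auto
      have "real ?v * card (forests (W - S) S) = card S * real ?v ^ (?v - card S)"
      proof (cases "S = {}")
        case True then show ?thesis using forests_no_roots[of W] False by simp
      next
        case S0: False
        have le: "card S \<le> ?v" using S less.prems by (auto intro: card_mono)
        have d: "card (W - S) = ?v - card S" using S fS by (auto simp: card_Diff_subset)
        have "card S > 0" using S0 fS by auto
        then have "card (W - S) < ?v" using d v by simp
        from less.hyps[OF this, of S] show ?thesis
          using le less.prems fS unfolding d by auto
      qed
      then show "real ?c ^ card S * (?v * card (forests (W - S) S))
        = real ?c ^ card S * (card S * real ?v ^ (?v - card S))" by simp
    qed
    also have "\<dots> = (\<Sum>k\<le>?v. real (?v choose k) * (real ?c ^ k * (k * real ?v ^ (?v - k))))"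
      using less.prems by (rule_tac sum_over_Pow) 
    \<comment> \<open>Taking out one factor \<open>c\<close> exposes the derivative of
      \<open>(c + v) ^ v\<close> with respect to \<open>c\<close>.\<close>
    also have "\<dots> = ?c * (\<Sum>k\<le>?v. real k * real (?v choose k) * real ?c ^ (k - 1) * real ?v ^ (?v - k))"
      unfolding sum_distrib_left
    proof (intro sum.cong refl)
      fix k show "real (?v choose k) * (real ?c ^ k * (k * real ?v ^ (?v - k)))
        = ?c * (real k * real (?v choose k) * real ?c ^ (k - 1) * real ?v ^ (?v - k))"
        by (cases k) (auto simp: algebra_simps)
    qed
    also have "\<dots> = ?c * (real ?v * (real ?c + real ?v) ^ (?v - 1))"
      by (subst binomial_deriv1) simp
    finally have "card (forests W C) = ?c * (real ?c + real ?v) ^ (?v - 1)"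
      using v by simp
    then show ?thesis using v by (cases ?v) (auto simp: algebra_simps)
  qed
qed

section \<open>Descendants, and the effect of turning a child of a root into a root\<close>

lemma single_valued_parent_rel: "single_valued (parent_rel W g ^^ k)"
  by (rule single_valued_relpow) (auto simp: single_valued_def)

lemma descendants_0 [simp]: "descendants W g 0 z = {z}"
  by (auto simp: descendants_def)

lemma descendants_Suc: "descendants W g (Suc k) z = (\<Union>x\<in>{x \<in> W. g x = z}. descendants W g k x)"
  unfolding descendants_def by fastforce

lemma descendants_subset: "descendants W g k z \<subseteq> insert z W"
  unfolding descendants_def by (cases k) (auto dest: relpow_Suc_D2 simp del: relpow.simps(2))

lemma finite_descendants [simp]: "finite W \<Longrightarrow> finite (descendants W g k z)"
  by (rule finite_subset[OF descendants_subset]) simp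

lemma descendants_disjoint: "x \<noteq> y \<Longrightarrow> descendants W g k x \<inter> descendants W g k y = {}"
  using single_valuedD[OF single_valued_parent_rel] unfolding descendants_def by fast

lemma sum_descendants_Suc:
  fixes \<Psi> :: "_ \<Rightarrow> 'b::comm_monoid_add"
  assumes "finite W"
  shows "(\<Sum>y\<in>descendants W g (Suc k) z. \<Psi> y) =
    (\<Sum>x\<in>{x \<in> W. g x = z}. \<Sum>y\<in>descendants W g k x. \<Psi> y)"
  unfolding descendants_Suc
proof (rule sum.UNION_disjoint)
  show "\<forall>x\<in>{x \<in> W. g x = z}. \<forall>y\<in>{x \<in> W. g x = z}. x \<noteq> y \<longrightarrow>
      descendants W g k x \<inter> descendants W g k y = {}"
    using descendants_disjoint by fast
qed (use assms in auto)

abbreviation pruned :: "'v set \<Rightarrow> ('v \<Rightarrow> 'v) \<Rightarrow> 'v \<Rightarrow> 'v \<Rightarrow> 'v" where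
  "pruned W g x \<equiv> restrict g (W - {x})"

text \<open>A path of the parent relation through \<open>x\<close> can continue only to
  \<open>g x\<close>, and ends there because \<open>g x\<close> is outside \<open>W\<close>. So only
  the descendants of \<open>g x\<close> notice that \<open>x\<close> is no longer its child.\<close>

lemma descendants_remove:
  assumes gx: "g x \<notin> W" and "z \<noteq> g x"
  shows "descendants (W - {x}) (pruned W g x) k z = descendants W g k z"
proof -
  have "(y, z) \<in> parent_rel (W - {x}) (pruned W g x) ^^ k" if "(y, z) \<in> parent_rel W g ^^ k" for y
    using that
  proof (induction k arbitrary: y)
    case (Suc k)
    from relpow_Suc_D2[OF Suc.prems] have y: "y \<in> W" "(g y, z) \<in> parent_rel W g ^^ k" by auto
    have "y \<noteq> x"
    proof
      assume "y = x"
      with y(2) assms show False by (cases k) (auto dest!: relpow_Suc_D2 simp del: relpow.simps(2))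
    qed
    with y Suc.IH show ?case
      by (intro relpow_Suc_I2[of y "g y"]) auto
  qed auto
  moreover have "(y, z) \<in> parent_rel W g ^^ k" if "(y, z) \<in> parent_rel (W - {x}) (pruned W g x) ^^ k" for y
    using that
  proof (induction k arbitrary: y)
    case (Suc k)
    from relpow_Suc_D2[OF Suc.prems] Suc.IH show ?case
      by (intro relpow_Suc_I2[of y "g y"]) auto
  qed auto
  ultimately show ?thesis
    unfolding descendants_def by blast
qed

text \<open>The step by which a path to the root shrinks: \<open>x\<close>, its last vertex before
  the root, becomes the new root.\<close>

lemma branch_remove:
  assumes "x \<in> W" and gx: "g x \<notin> W" and "y \<in> descendants W g k x"
  shows "branch W g y = insert x (branch (W - {x}) (pruned W g x) y)"
proof -
  let ?R = "parent_rel W g" and ?R' = "parent_rel (W - {x}) (pruned W g x)"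
  have "(y, z) \<in> ?R\<^sup>* \<longleftrightarrow> (y, z) \<in> ?R'\<^sup>*" if "z \<noteq> g x" for z
    using descendants_remove[of g x, OF gx that] unfolding rtrancl_power descendants_def by blast
  moreover have "(y, x) \<in> ?R\<^sup>*"
    using assms(3) unfolding rtrancl_power descendants_def by auto
  moreover have "z \<noteq> g x" if "z \<in> W" for z
    using that gx by auto
  ultimately show ?thesis
    using assms(1) unfolding branch_def by auto
qed

lemma branch_root: "y \<notin> W \<Longrightarrow> branch W g y = {}"
  unfolding branch_def by (auto elim: converse_rtranclE)

lemma branch_subset: "branch W g y \<subseteq> W"
  by (auto simp: branch_def)

lemma sum_forests_remove:
  fixes \<Psi> :: "_ \<Rightarrow> 'b::comm_monoid_add"
  assumes "x \<in> W" "W \<inter> C = {}" "c \<in> C"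
  shows "(\<Sum>g\<in>{g \<in> forests W C. g x = c}. \<Psi> (pruned W g x)) =
    (\<Sum>g\<in>forests (W - {x}) (insert x C). \<Psi> g)"
  by (rule sum.reindex_bij_betw[OF bij_betw_forests_remove[OF assms]])

text \<open>The double count behind all recursions below: a forest with a marked child of
  \<open>c\<close> is the same as a vertex \<open>x\<close> together with a forest in which
  \<open>x\<close> is one more root.\<close>

lemma sum_forests_children:
  fixes \<Psi> :: "'v \<Rightarrow> ('v \<Rightarrow> 'v) \<Rightarrow> 'b::comm_monoid_add"
  assumes "finite W" "finite C" "W \<inter> C = {}" "c \<in> C"
  shows "(\<Sum>g\<in>forests W C. \<Sum>x\<in>{x \<in> W. g x = c}. \<Psi> x (pruned W g x)) =
    (\<Sum>x\<in>W. \<Sum>g\<in>forests (W - {x}) (insert x C). \<Psi> x g)"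
proof -
  have "(\<Sum>g\<in>forests W C. \<Sum>x\<in>{x \<in> W. g x = c}. \<Psi> x (pruned W g x)) =
     (\<Sum>x\<in>W. \<Sum>g\<in>{g \<in> forests W C. g x = c}. \<Psi> x (pruned W g x))"
    using assms by (intro sum.swap_restrict) auto
  also have "\<dots> = (\<Sum>x\<in>W. \<Sum>g\<in>forests (W - {x}) (insert x C). \<Psi> x g)"
    using assms by (intro sum.cong refl sum_forests_remove)
  finally show ?thesis .
qed

text \<open>\<open>branch W g y\<close> plays the role of the path from \<open>y\<close> to its root \<open>c\<close>: turning it into roots leaves
  a forest on the remaining vertices.\<close>

definition spine_sum ::
  "('v set \<Rightarrow> ('v \<Rightarrow> 'v) \<Rightarrow> 'b::comm_monoid_add) \<Rightarrow> 'v set \<Rightarrow> 'v set \<Rightarrow> nat \<Rightarrow> 'v \<Rightarrow> 'b" where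
  "spine_sum \<Phi> W C k c = (\<Sum>g\<in>forests W C. \<Sum>y\<in>descendants W g k c.
     \<Phi> (C \<union> branch W g y) (restrict g (W - branch W g y)))"

lemma forests_restrict_self: "g \<in> forests W C \<Longrightarrow> restrict g W = g"
  by (auto simp: fun_eq_iff forests_undefined)

lemma spine_sum_0:
  assumes "W \<inter> C = {}" "c \<in> C"
  shows "spine_sum \<Phi> W C 0 c = (\<Sum>g\<in>forests W C. \<Phi> C g)"
proof -
  have "c \<notin> W" using assms by auto
  then show ?thesis
    unfolding spine_sum_def by (auto simp: branch_root forests_restrict_self intro!: sum.cong)
qed

text \<open>Here \<open>x\<close> is the first vertex below \<open>c\<close> on the path to
  \<open>y\<close>; once it is a root, a path of length \<open>k\<close> from \<open>x\<close>
  remains. After \<open>k\<close> unfoldings the sum runs over sequences of \<open>k\<close>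
  distinct vertices and, for each, over all forests rooted at \<open>C\<close> and these vertices:
  given the spine, the rest of the tree is a uniform forest.\<close>

lemma spine_sum_Suc:
  assumes "finite W" "finite C" "W \<inter> C = {}" "c \<in> C"
  shows "spine_sum \<Phi> W C (Suc k) c = (\<Sum>x\<in>W. spine_sum \<Phi> (W - {x}) (insert x C) k x)"
proof -
  have cW: "c \<notin> W" using assms by auto
  have eq: "(\<Sum>y\<in>descendants W g k x. \<Phi> (C \<union> branch W g y) (restrict g (W - branch W g y))) =
    (\<Sum>y\<in>descendants (W - {x}) (pruned W g x) k x.
       \<Phi> (insert x C \<union> branch (W - {x}) (pruned W g x) y)
         (restrict (pruned W g x) (W - {x} - branch (W - {x}) (pruned W g x) y)))"
    if "x \<in> W" "g x = c" for x g
  proof (rule sum.cong)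
    show "descendants W g k x = descendants (W - {x}) (pruned W g x) k x"
      using that cW by (subst descendants_remove) auto
  next
    fix y assume y: "y \<in> descendants (W - {x}) (pruned W g x) k x"
    then have y': "y \<in> descendants W g k x"
      using that cW by (subst (asm) descendants_remove) auto
    let ?b = "branch (W - {x}) (pruned W g x) y"
    have br: "branch W g y = insert x ?b"
      using branch_remove[OF _ _ y'] that cW by auto
    have "W - branch W g y = W - {x} - ?b" unfolding br by auto
    then show "\<Phi> (C \<union> branch W g y) (restrict g (W - branch W g y)) =
      \<Phi> (insert x C \<union> ?b) (restrict (pruned W g x) (W - {x} - ?b))"
      unfolding br by (simp add: Int_absorb1 Diff_subset Int_Diff)
  qed
  show ?thesis
    unfolding spine_sum_def sum_descendants_Suc[OF assms(1)]
    by (subst sum_forests_children[OF assms, symmetric]) (auto intro!: sum.cong simp: eq)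
qed

text \<open>Conditioning on the path: a bound on the mean of \<open>\<Phi>\<close> that holds for
  every root set of size \<open>card C + k\<close> passes to forests with a marked vertex
  \<open>k\<close> generations below \<open>c\<close>.\<close>

lemma spine_sum_le:
  fixes \<Phi> :: "'v set \<Rightarrow> ('v \<Rightarrow> 'v) \<Rightarrow> real" and bd :: real
  assumes "finite W" "finite C" "W \<inter> C = {}" "c \<in> C"
    and "\<And>W' C'. finite W' \<Longrightarrow> finite C' \<Longrightarrow> W' \<inter> C' = {} \<Longrightarrow> W' \<union> C' = W \<union> C \<Longrightarrow>
      card C' = card C + k \<Longrightarrow> (\<Sum>g\<in>forests W' C'. \<Phi> C' g) \<le> bd * card (forests W' C')"
  shows "spine_sum \<Phi> W C k c \<le> bd * spine_sum (\<lambda>_ _. 1) W C k c"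
  using assms
proof (induction k arbitrary: W C c)
  case 0
  then show ?case by (simp add: spine_sum_0)
next
  case (Suc k)
  have "spine_sum \<Phi> (W - {x}) (insert x C) k x \<le> bd * spine_sum (\<lambda>_ _. 1) (W - {x}) (insert x C) k x"
    if x: "x \<in> W" for x
  proof (rule Suc.IH)
    fix W' C' assume *: "finite W'" "finite C'" "W' \<inter> C' = {}" "W' \<union> C' = W - {x} \<union> insert x C"
      "card C' = card (insert x C) + k"
    have "x \<notin> C" using x Suc.prems by auto
    with * x Suc.prems(2) show "(\<Sum>g\<in>forests W' C'. \<Phi> C' g) \<le> bd * card (forests W' C')"
      by (intro Suc.prems(5)) auto
  qed (use Suc.prems x in auto)
  with Suc.prems show ?case
    by (simp add: spine_sum_Suc sum_distrib_left sum_mono)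
qed

text \<open>With \<open>\<Phi> = 1\<close> the recursion picks \<open>k\<close> distinct path
  vertices in order, whence the falling factorial, and ends with the number of forests with
  \<open>card C + k\<close> roots. The power of \<open>n\<close> on the left avoids negative
  exponents.\<close>

lemma sum_card_descendants:
  assumes "finite W" "finite C" "W \<inter> C = {}" "c \<in> C"
  shows "(\<Sum>g\<in>forests W C. real (card (descendants W g k c))) * real (card W + card C) ^ Suc k =
    (\<Prod>i<k. real (card W) - real i) * (card C + k) * real (card W + card C) ^ card W"
proof -
  have "spine_sum (\<lambda>_ _. 1::real) W C k c * real (card W + card C) ^ Suc k =
    (\<Prod>i<k. real (card W) - real i) * (card C + k) * real (card W + card C) ^ card W"
    using assms
  proof (induction k arbitrary: W C c)
    case 0
    then show ?case using card_forests[of W C] by (simp add: spine_sum_0 mult.commute)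
  next
    case (Suc k)
    let ?v = "card W" and ?n = "card W + card C"
    have *: "spine_sum (\<lambda>_ _. 1::real) (W - {x}) (insert x C) k x * real ?n ^ Suc k =
      (\<Prod>i<k. real (?v - 1) - real i) * (card C + Suc k) * real ?n ^ (?v - 1)" if "x \<in> W" for x
    proof -
      have "x \<notin> C" "?v > 0" using that Suc.prems by (auto simp: card_gt_0_iff)
      moreover have "card (W - {x}) = ?v - 1" using that Suc.prems by simp
      ultimately show ?thesis
        using Suc.IH[of "W - {x}" "insert x C" x] that Suc.prems by auto
    qed
    have "spine_sum (\<lambda>_ _. 1::real) W C (Suc k) c * real ?n ^ Suc (Suc k)
      = ?n * (\<Sum>x\<in>W. spine_sum (\<lambda>_ _. 1::real) (W - {x}) (insert x C) k x * real ?n ^ Suc k)"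
      using Suc.prems by (simp add: spine_sum_Suc sum_distrib_left sum_distrib_right mult_ac)
    also have "\<dots> = ?n * (\<Sum>x\<in>W. (\<Prod>i<k. real (?v - 1) - real i) * (card C + Suc k) * real ?n ^ (?v - 1))"
      using * by simp
    also have "\<dots> = (\<Prod>i<Suc k. real ?v - real i) * (card C + Suc k) * real ?n ^ ?v"
    proof (cases "?v = 0")
      case False
      then have "(\<Prod>i<Suc k. real ?v - real i) = ?v * (\<Prod>i<k. real (?v - 1) - real i)"
        by (subst prod.lessThan_Suc_shift) (simp add: of_nat_diff algebra_simps)
      moreover have "real ?n ^ ?v = ?n * real ?n ^ (?v - 1)" using False by (cases ?v) auto
      ultimately show ?thesis by simp
    qed (use Suc.prems in \<open>auto simp: prod.lessThan_Suc_shift\<close>)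
    finally show ?case by (simp only:)
  qed
  moreover have "spine_sum (\<lambda>_ _. 1::real) W C k c = (\<Sum>g\<in>forests W C. real (card (descendants W g k c)))"
    by (simp add: spine_sum_def)
  ultimately show ?thesis by simp
qed

text \<open>The descendants are split according to whether their path to \<open>c\<close> passes
  through \<open>x\<close>. In the pruned forest the two groups hang below two different
  roots.\<close>

lemma card_descendants_Suc_remove:
  assumes "finite W" "x \<in> W" "g x = c" "c \<notin> W"
  shows "card (descendants W g (Suc k) c) = card (descendants (W - {x}) (pruned W g x) k x)
    + card (descendants (W - {x}) (pruned W g x) (Suc k) c)"
proof -
  have "{y \<in> W - {x}. restrict g (W - {x}) y = c} = {y \<in> W. g y = c} - {x}" by auto
  moreover have "descendants (W - {x}) (pruned W g x) k y = descendants W g k y" if "y \<in> W" for y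
    using that assms by (intro descendants_remove) auto
  ultimately have "(\<Union>y\<in>{y \<in> W - {x}. restrict g (W - {x}) y = c}. descendants (W - {x}) (pruned W g x) k y)
     = (\<Union>y\<in>{y \<in> W. g y = c} - {x}. descendants W g k y)"
    by auto
  then have eq: "descendants (W - {x}) (pruned W g x) (Suc k) c = (\<Union>y\<in>{y \<in> W. g y = c} - {x}. descendants W g k y)"
    unfolding descendants_Suc .
  have "descendants W g (Suc k) c = descendants W g k x \<union> (\<Union>y\<in>{y \<in> W. g y = c} - {x}. descendants W g k y)"
    unfolding descendants_Suc using assms by auto
  moreover have "descendants W g k x \<inter> (\<Union>y\<in>{y \<in> W. g y = c} - {x}. descendants W g k y) = {}"
    using descendants_disjoint[of x _ W g k] by fast
  moreover have "descendants (W - {x}) (pruned W g x) k x = descendants W g k x"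
    using assms by (intro descendants_remove) auto
  ultimately show ?thesis unfolding eq using assms(1) by (simp add: card_Un_disjoint)
qed

lemma card_descendants_Suc:
  assumes "finite W"
  shows "card (descendants W g (Suc k) c) = (\<Sum>x\<in>{x \<in> W. g x = c}. card (descendants W g k x))"
  using sum_descendants_Suc[OF assms, of "\<lambda>_. 1 :: nat" g k c] by simp

text \<open>Children on the side of \<open>c\<close> are promoted one generation at a time. This
  leaves the descendants of \<open>c'\<close> alone and adds one root per step, until only the first
  moment for \<open>c'\<close> remains.\<close>

lemma sum_card_descendants_two_roots:
  assumes "finite W" "finite C" "W \<inter> C = {}" "c \<in> C" "c' \<in> C" "c \<noteq> c'"
  shows "real (card W + card C) * (\<Sum>g\<in>forests W C. real (card (descendants W g k c) * card (descendants W g l c')))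
    \<le> real (card C + k + l) * real (card W + card C) ^ card W"
  using assms
proof (induction k arbitrary: W C c)
  case 0
  let ?v = "card W" and ?n = "card W + card C"
  have n: "?n > 0" using 0 by (auto simp: card_gt_0_iff)
  \<comment> \<open>For \<open>l > card W\<close> there may be negative factors, but the factor with
    \<open>i = card W\<close> vanishes.\<close>
  have "(\<Prod>i<l. real ?v - real i) \<le> real ?n ^ l"
  proof (cases "l \<le> ?v")
    case True
    have "(\<Prod>i<l. real ?v - real i) \<le> (\<Prod>i<l. real ?n)"
      using True by (intro prod_mono) (auto simp: of_nat_diff)
    then show ?thesis by simp
  next
    case False
    then have "(\<Prod>i<l. real ?v - real i) = 0" by (intro prod_zero) (auto intro!: bexI[of _ ?v])
    then show ?thesis by (simp only: zero_le_power of_nat_0_le_iff)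
  qed
  then have "(\<Sum>g\<in>forests W C. real (card (descendants W g l c'))) * real ?n ^ Suc l
    \<le> real ?n ^ l * (card C + l) * real ?n ^ ?v"
    using 0 by (subst sum_card_descendants) (auto intro!: mult_right_mono)
  then have "real ?n ^ l * (real ?n * (\<Sum>g\<in>forests W C. real (card (descendants W g l c'))))
      \<le> real ?n ^ l * (real (card C + l) * real ?n ^ ?v)"
    by (simp add: mult_ac)
  then have "real ?n * (\<Sum>g\<in>forests W C. real (card (descendants W g l c')))
      \<le> real (card C + l) * real ?n ^ ?v"
    by (rule mult_left_le_imp_le) (intro zero_less_power, use n in linarith)
  then show ?case by simp
next
  case (Suc k)
  let ?v = "card W" and ?n = "card W + card C"
  let ?D = "\<lambda>x g. real (card (descendants (W - {x}) g k x) * card (descendants (W - {x}) g l c'))"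
  have cW: "c \<notin> W" using Suc.prems by auto
  have "(\<Sum>g\<in>forests W C. real (card (descendants W g (Suc k) c) * card (descendants W g l c')))
    = (\<Sum>g\<in>forests W C. \<Sum>x\<in>{x \<in> W. g x = c}. ?D x (pruned W g x))"
    unfolding card_descendants_Suc[OF Suc.prems(1)] sum_distrib_right of_nat_sum
  proof (intro sum.cong refl)
    fix g x assume x: "x \<in> {x \<in> W. g x = c}"
    then have "g x \<notin> W" "x \<noteq> g x" "c' \<noteq> g x" using cW Suc.prems(6) by auto
    then show "real (card (descendants W g k x) * card (descendants W g l c')) = ?D x (pruned W g x)"
      by (simp add: descendants_remove)
  qed
  also have "\<dots> = (\<Sum>x\<in>W. \<Sum>g\<in>forests (W - {x}) (insert x C). ?D x g)"
    by (rule sum_forests_children) (use Suc.prems in auto)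
  finally have "?n * (\<Sum>g\<in>forests W C. real (card (descendants W g (Suc k) c) * card (descendants W g l c')))
    = (\<Sum>x\<in>W. ?n * (\<Sum>g\<in>forests (W - {x}) (insert x C). ?D x g))"
    by (simp add: sum_distrib_left)
  also have "\<dots> \<le> (\<Sum>x\<in>W. real (card C + Suc k + l) * real ?n ^ (?v - 1))"
  proof (rule sum_mono)
    fix x assume x: "x \<in> W"
    then have "x \<notin> C" "?v > 0" "x \<noteq> c'" using Suc.prems by (auto simp: card_gt_0_iff)
    moreover have "card (W - {x}) = ?v - 1" using x Suc.prems by simp
    ultimately show "?n * (\<Sum>g\<in>forests (W - {x}) (insert x C). ?D x g)
        \<le> real (card C + Suc k + l) * real ?n ^ (?v - 1)"
      using Suc.IH[of "W - {x}" "insert x C" x] x Suc.prems by auto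
  qed
  also have "\<dots> = real (card C + Suc k + l) * (real ?v * real ?n ^ (?v - 1))"
    by simp
  also have "\<dots> \<le> real (card C + Suc k + l) * real ?n ^ ?v"
    by (intro mult_left_mono) (cases ?v; auto intro!: mult_right_mono)+
  finally show ?case .
qed

text \<open>One factor of the square is expanded over the children \<open>x\<close> of
  \<open>c\<close>, and the other is split at the same \<open>x\<close>. This leaves the square for
  \<open>x\<close>, one generation lower, and a product for the two distinct roots \<open>x\<close>
  and \<open>c\<close>, which the preceding estimate bounds.\<close>

lemma sum_card_descendants_square:
  assumes "finite W" "finite C" "W \<inter> C = {}" "c \<in> C"
  shows "real (card W + card C) * (\<Sum>g\<in>forests W C. real (card (descendants W g k c)) ^ 2)
    \<le> real ((k + 1) * (card C + 2 * k)) * real (card W + card C) ^ card W"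
  using assms
proof (induction k arbitrary: W C c)
  case 0
  then show ?case using card_forests[of W C] by simp
next
  case (Suc k)
  let ?v = "card W" and ?n = "card W + card C"
  let ?d = "\<lambda>x g k y. real (card (descendants (W - {x}) g k y))"
  have cW: "c \<notin> W" using Suc.prems by auto
  have "real (card (descendants W g (Suc k) c)) ^ 2
    = (\<Sum>x\<in>{x \<in> W. g x = c}. ?d x (pruned W g x) k x ^ 2 +
        ?d x (pruned W g x) k x * ?d x (pruned W g x) (Suc k) c)" for g
  proof -
    have "real (card (descendants W g (Suc k) c)) ^ 2 =
      (\<Sum>x\<in>{x \<in> W. g x = c}. real (card (descendants W g k x)) * real (card (descendants W g (Suc k) c)))"
      unfolding power2_eq_square sum_distrib_right[symmetric]
      by (subst (2) card_descendants_Suc[OF Suc.prems(1)]) simp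
    also have "\<dots> = (\<Sum>x\<in>{x \<in> W. g x = c}. ?d x (pruned W g x) k x ^ 2 +
        ?d x (pruned W g x) k x * ?d x (pruned W g x) (Suc k) c)"
    proof (intro sum.cong refl)
      fix x assume x: "x \<in> {x \<in> W. g x = c}"
      then have "descendants (W - {x}) (pruned W g x) k x = descendants W g k x"
        using cW by (intro descendants_remove) auto
      with x show "real (card (descendants W g k x)) * real (card (descendants W g (Suc k) c)) =
        ?d x (pruned W g x) k x ^ 2 +
        ?d x (pruned W g x) k x * ?d x (pruned W g x) (Suc k) c"
        using card_descendants_Suc_remove[of W x g c k] cW Suc.prems(1)
        by (auto simp: power2_eq_square algebra_simps)
    qed
    finally show ?thesis .
  qed
  then have "(\<Sum>g\<in>forests W C. real (card (descendants W g (Suc k) c)) ^ 2)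
    = (\<Sum>x\<in>W. \<Sum>g\<in>forests (W - {x}) (insert x C). ?d x g k x ^ 2 + ?d x g k x * ?d x g (Suc k) c)"
    using sum_forests_children[OF Suc.prems, of "\<lambda>x g. ?d x g k x ^ 2 + ?d x g k x * ?d x g (Suc k) c"]
    by simp
  then have "?n * (\<Sum>g\<in>forests W C. real (card (descendants W g (Suc k) c)) ^ 2)
    = (\<Sum>x\<in>W. ?n * (\<Sum>g\<in>forests (W - {x}) (insert x C). ?d x g k x ^ 2)
        + ?n * (\<Sum>g\<in>forests (W - {x}) (insert x C). ?d x g k x * ?d x g (Suc k) c))"
    by (simp add: sum_distrib_left sum.distrib distrib_left)
  also have "\<dots> \<le> (\<Sum>x\<in>W. real ((k + 1) * (card C + 1 + 2 * k)) * real ?n ^ (?v - 1)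
      + real (card C + 1 + k + Suc k) * real ?n ^ (?v - 1))"
  proof (intro sum_mono add_mono)
    fix x assume x: "x \<in> W"
    then have *: "x \<notin> C" "?v > 0" "x \<noteq> c" using Suc.prems by (auto simp: card_gt_0_iff)
    have **: "card (W - {x}) = ?v - 1" using x Suc.prems by simp
    show "?n * (\<Sum>g\<in>forests (W - {x}) (insert x C). ?d x g k x ^ 2)
        \<le> real ((k + 1) * (card C + 1 + 2 * k)) * real ?n ^ (?v - 1)"
      using Suc.IH[of "W - {x}" "insert x C" x] x Suc.prems * ** by auto
    show "?n * (\<Sum>g\<in>forests (W - {x}) (insert x C). ?d x g k x * ?d x g (Suc k) c)
        \<le> real (card C + 1 + k + Suc k) * real ?n ^ (?v - 1)"
      using sum_card_descendants_two_roots[of "W - {x}" "insert x C" x c k "Suc k"] x Suc.prems * ** by auto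
  qed
  also have "\<dots> = real ((k + 1) * (card C + 1 + 2 * k) + (card C + 1 + k + Suc k)) * (real ?v * real ?n ^ (?v - 1))"
    by (simp add: algebra_simps)
  \<comment> \<open>With \<open>c = card C\<close> this is \<open>(k + 1) * (c + 2 * k + 1) + (c + 2
    * k + 2) \<le> (k + 2) * (c + 2 * k + 2)\<close>.\<close>
  also have "\<dots> \<le> real ((Suc k + 1) * (card C + 2 * Suc k)) * real ?n ^ ?v"
    by (intro mult_mono) (cases ?v; auto intro!: mult_right_mono simp: algebra_simps)+
  finally show ?case .
qed

section \<open>Levels and generations: distance to the root set\<close>

lemma forests_rank_induct [consumes 2, case_names step]:
  assumes "g \<in> forests W C" "y \<in> W"
    and "\<And>y. y \<in> W \<Longrightarrow> (g y \<in> W \<Longrightarrow> P (g y)) \<Longrightarrow> P y"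
  shows "P y"
proof -
  obtain h where h: "\<And>x. x \<in> W \<Longrightarrow> g x \<in> W \<longrightarrow> h (g x) < (h x :: nat)"
    using assms(1) by (auto simp: forests_def)
  show ?thesis
    using assms(2)
  proof (induction "h y" arbitrary: y rule: less_induct)
    case less
    with h assms(3) show ?case by blast
  qed
qed

lemma branch_step: "y \<in> W \<Longrightarrow> branch W g y = insert y (branch W g (g y))"
  unfolding branch_def by (auto elim: converse_rtranclE intro: converse_rtrancl_into_rtrancl)

text \<open>Ranks do not increase along the path from \<open>g y\<close>, whereas \<open>y\<close>
  has a larger rank than \<open>g y\<close>.\<close>

lemma branch_acyclic:
  assumes "g \<in> forests W C" "y \<in> W"
  shows "y \<notin> branch W g (g y)"
proof
  assume "y \<in> branch W g (g y)"
  then have *: "(g y, y) \<in> (parent_rel W g)\<^sup>*" by (simp add: branch_def)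
  obtain h where h: "\<And>x. x \<in> W \<Longrightarrow> g x \<in> W \<longrightarrow> h (g x) < (h x :: nat)"
    using assms(1) by (auto simp: forests_def)
  have "h z \<le> h (g y)" if "(g y, z) \<in> (parent_rel W g)\<^sup>*" "z \<in> W" for z
    using that
  proof (induction rule: rtrancl_induct)
    case (step u v)
    then show ?case using h[of u] by auto
  qed auto
  moreover have "g y \<in> W"
    using * assms(2) by (cases rule: converse_rtranclE) auto
  ultimately show False using h[of y] * assms(2) by fastforce
qed

lemma finite_branch [simp]: "finite W \<Longrightarrow> finite (branch W g y)"
  by (rule finite_subset[OF branch_subset])

abbreviation level :: "'v set \<Rightarrow> ('v \<Rightarrow> 'v) \<Rightarrow> 'v \<Rightarrow> nat" where
  "level W g y \<equiv> card (branch W g y)"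

lemma card_branch_step:
  assumes "g \<in> forests W C" "y \<in> W" "finite W"
  shows "level W g y = Suc (level W g (g y))"
  using assms branch_acyclic[OF assms(1,2)] by (simp add: branch_step)

lemma descendants_Suc_iff:
  "y \<in> descendants W g (Suc k) z \<longleftrightarrow> y \<in> W \<and> g y \<in> descendants W g k z"
  unfolding descendants_def by (auto dest: relpow_Suc_D2 intro: relpow_Suc_I2 simp del: relpow.simps(2))

lemma descendants_card_branch:
  assumes "g \<in> forests W C" "finite W" "W \<inter> C = {}" "c \<in> C" "y \<in> descendants W g k c"
  shows "level W g y = k"
  using assms(5)
proof (induction k arbitrary: y)
  case 0
  then have "y \<notin> W" using assms by auto
  with 0 show ?case by (simp add: branch_root)
next
  case (Suc k)
  then show ?case using card_branch_step[OF assms(1) _ assms(2), of y]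
    by (simp add: descendants_Suc_iff)
qed

text \<open>As \<open>branch\<close> omits the root, \<open>level\<close> is the distance to the
  root set. This ties it to the ancestry in \<open>k\<close> steps, for which the moments are
  known.\<close>

lemma level_eq_descendants:
  assumes "g \<in> forests W C" "finite W" "W \<inter> C = {}"
  shows "{y \<in> W \<union> C. level W g y = k} = (\<Union>c\<in>C. descendants W g k c)"
proof
  show "(\<Union>c\<in>C. descendants W g k c) \<subseteq> {y \<in> W \<union> C. level W g y = k}"
    using descendants_card_branch[OF assms] descendants_subset by fast
  have "\<exists>c\<in>C. y \<in> descendants W g (level W g y) c" if "y \<in> W" for y
    using assms(1) that
  proof (induction rule: forests_rank_induct)
    case (step y)
    have "\<exists>c\<in>C. g y \<in> descendants W g (level W g (g y)) c"
    proof (cases "g y \<in> W")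
      case False
      then have "g y \<in> C" using forests_in[OF assms(1) step(1)] by auto
      then show ?thesis by (auto simp: branch_root[OF False])
    qed (use step in auto)
    then show ?case
      using card_branch_step[OF assms(1) step(1) assms(2)] step(1) by (auto simp: descendants_Suc_iff)
  qed
  moreover have "y \<in> descendants W g (level W g y) y" if "y \<in> C" for y
  proof -
    have "y \<notin> W" using that assms(3) by auto
    then show ?thesis by (simp add: branch_root)
  qed
  ultimately show "{y \<in> W \<union> C. level W g y = k} \<subseteq> (\<Union>c\<in>C. descendants W g k c)"
    by blast
qed

definition generation :: "'v set \<Rightarrow> 'v set \<Rightarrow> ('v \<Rightarrow> 'v) \<Rightarrow> nat \<Rightarrow> nat" where
  "generation W C g k = card {y \<in> W \<union> C. level W g y = k}"

lemma generation_eq_sum: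
  assumes "g \<in> forests W C" "finite W" "finite C" "W \<inter> C = {}"
  shows "generation W C g k = (\<Sum>c\<in>C. card (descendants W g k c))"
proof -
  have "card (\<Union>c\<in>C. descendants W g k c) = (\<Sum>c\<in>C. card (descendants W g k c))"
    by (rule card_UN_disjoint) (use assms(2,3) descendants_disjoint[of _ _ W g k] in auto)
  then show ?thesis
    unfolding generation_def level_eq_descendants[OF assms(1,2,4)] .
qed

context
  fixes W C :: "'v set"
  assumes fin: "finite W" "finite C" and disj: "W \<inter> C = {}" and C: "C \<noteq> {}"
begin

lemma card_forests_eq:
  "real (card C) * real (card W + card C) ^ card W = real (card W + card C) * card (forests W C)"
  using card_forests[OF fin disj] by simp

text \<open>On average a generation exceeds the previous one by one vertex, up to a product that is
  close to 1 as long as \<open>k * (card C + k)\<close> is small compared to the number of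
  vertices.\<close>

lemma sum_generation:
  "(\<Sum>g\<in>forests W C. real (generation W C g k)) =
    (\<Prod>i<k. 1 - real (card C + i) / (card W + card C)) * (card C + k) * card (forests W C)"
proof -
  let ?v = "card W" and ?n = "card W + card C"
  have n: "real ?n > 0" using fin C by (simp add: card_gt_0_iff add_nonneg_pos)
  have cancel: "X = P / N ^ k * q * f" if "X * N ^ Suc k = P * q * (N * f)" "N > 0" for X P q f N :: real
    using that by (simp add: field_simps)
  have "(\<Sum>g\<in>forests W C. real (generation W C g k)) * real ?n ^ Suc k =
     (\<Sum>g\<in>forests W C. \<Sum>c\<in>C. real (card (descendants W g k c))) * real ?n ^ Suc k"
    using fin disj by (simp add: generation_eq_sum)
  also have "\<dots> = (\<Sum>c\<in>C. (\<Sum>g\<in>forests W C. real (card (descendants W g k c))) * real ?n ^ Suc k)"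
    by (subst sum.swap) (simp only: sum_distrib_right)
  also have "\<dots> = (\<Prod>i<k. real ?v - real i) * (card C + k) * (card C * real ?n ^ ?v)"
  proof -
    have "(\<Sum>g\<in>forests W C. real (card (descendants W g k c))) * real ?n ^ Suc k =
      (\<Prod>i<k. real ?v - real i) * (card C + k) * real ?n ^ ?v" if "c \<in> C" for c
      by (rule sum_card_descendants[OF fin disj that])
    then show ?thesis by (simp add: mult_ac)
  qed
  also have "\<dots> = (\<Prod>i<k. real ?v - real i) * (card C + k) * (real ?n * card (forests W C))"
    by (simp only: card_forests_eq)
  finally have "(\<Sum>g\<in>forests W C. real (generation W C g k)) =
    (\<Prod>i<k. real ?v - real i) / real ?n ^ k * (card C + k) * card (forests W C)"
    by (rule cancel) (rule n)
  also have "(\<Prod>i<k. real ?v - real i) / real ?n ^ k = (\<Prod>i<k. (real ?v - real i) / real ?n)"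
    by (simp add: prod_dividef)
  also have "(\<Prod>i<k. (real ?v - real i) / real ?n) = (\<Prod>i<k. 1 - real (card C + i) / ?n)"
    using n by (intro prod.cong refl) (simp add: field_simps)
  finally show ?thesis .
qed

lemma generation_product_bounds:
  "0 \<le> (\<Prod>i<k. 1 - real (card C + i) / (card W + card C))"
  "(\<Prod>i<k. 1 - real (card C + i) / (card W + card C)) \<le> 1"
  "1 - k * (real (card C + k) / (card W + card C)) \<le> (\<Prod>i<k. 1 - real (card C + i) / (card W + card C))"
proof -
  let ?v = "card W" and ?n = "card W + card C"
  let ?P = "\<Prod>i<k. 1 - real (card C + i) / ?n"
  have n: "real ?n > 0" using fin C by (simp add: card_gt_0_iff add_nonneg_pos)
  have "0 \<le> ?P \<and> ?P \<le> 1 \<and> 1 - k * (real (card C + k) / ?n) \<le> ?P"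
  proof (cases "k \<le> ?v")
    case True
    then have "?P \<ge> 0 \<and> ?P \<le> 1"
      using n by (auto intro!: prod_nonneg prod_le_1 simp: field_simps)
    moreover have "1 - (\<Sum>i<k. real (card C + i) / ?n) \<le> ?P"
      using True n by (intro Weierstrass_prod_ineq) (auto simp: field_simps)
    moreover have "(\<Sum>i<k. real (card C + i) / ?n) \<le> (\<Sum>i<k. real (card C + k) / ?n)"
      using n by (intro sum_mono divide_right_mono) auto
    ultimately show ?thesis by simp
  next
    case False
    \<comment> \<open>The factor with \<open>i = card W\<close> is zero, and the claimed lower bound
      is at most 0 because \<open>card W + card C \<le> card C + k\<close>.\<close>
    then have P0: "?P = 0"
      using n by (intro prod_zero) (auto intro!: bexI[of _ ?v] simp: field_simps)
    have "1 \<le> real k * (real (card C + k) / ?n)"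
    proof -
      have "1 \<le> k" "?n \<le> card C + k" using False by auto
      then have "real ?n \<le> real k * real (card C + k)"
        using mult_mono[of 1 "real k" "real ?n" "real (card C + k)"] by auto
      then show ?thesis using n by (simp add: field_simps)
    qed
    then show ?thesis unfolding P0 by simp
  qed
  then show "0 \<le> ?P" "?P \<le> 1" "1 - k * (real (card C + k) / ?n) \<le> ?P" by auto
qed

lemma sum_generation_le:
  "(\<Sum>g\<in>forests W C. real (generation W C g k)) \<le> (card C + k) * card (forests W C)"
  unfolding sum_generation
  using mult_right_mono[OF generation_product_bounds(2)[of k], of "real (card C + k) * card (forests W C)"]
  by (simp add: mult_ac)

lemma sum_generation_ge:
  "(1 - k * (real (card C + k) / (card W + card C))) * (card C + k) * card (forests W C)
    \<le> (\<Sum>g\<in>forests W C. real (generation W C g k))"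
  unfolding sum_generation
  by (intro mult_right_mono generation_product_bounds) auto

text \<open>The square is a sum over ordered pairs of roots. Each of the \<open>card C\<close>
  diagonal pairs may exceed the bound for distinct roots by \<open>k * (card C + 2 * k)\<close>,
  which turns one factor \<open>card C\<close> into \<open>card C + k\<close>.\<close>

lemma sum_generation_square:
  "(\<Sum>g\<in>forests W C. real (generation W C g k) ^ 2)
    \<le> real (card C + 2 * k) * (card C + k) * card (forests W C)"
proof -
  let ?v = "card W" and ?n = "card W + card C" and ?c = "card C"
  let ?d = "\<lambda>g c. card (descendants W g k c)"
  have n: "real ?n > 0" using fin C by (simp add: card_gt_0_iff add_nonneg_pos)
  have c: "?c > 0" using fin C by (simp add: card_gt_0_iff)
  have "?n * (\<Sum>g\<in>forests W C. real (generation W C g k) ^ 2)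
    = ?n * (\<Sum>g\<in>forests W C. \<Sum>c\<in>C. \<Sum>c'\<in>C. real (?d g c * ?d g c'))"
    using fin disj by (simp add: generation_eq_sum power2_eq_square sum_product)
  also have "\<dots> = (\<Sum>c\<in>C. \<Sum>c'\<in>C. ?n * (\<Sum>g\<in>forests W C. real (?d g c * ?d g c')))"
    unfolding sum_distrib_left sum.swap[of _ "forests W C" C] by simp
  also have "\<dots> \<le> (\<Sum>c\<in>C. \<Sum>c'\<in>C. (if c' = c then real (k * (?c + 2 * k)) * real ?n ^ ?v else 0)
       + real (?c + 2 * k) * real ?n ^ ?v)"
  proof (intro sum_mono)
    fix c c' assume cc: "c \<in> C" "c' \<in> C"
    show "?n * (\<Sum>g\<in>forests W C. real (?d g c * ?d g c')) \<le>
      (if c' = c then real (k * (?c + 2 * k)) * real ?n ^ ?v else 0) + real (?c + 2 * k) * real ?n ^ ?v"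
    proof (cases "c' = c")
      case True
      then show ?thesis using sum_card_descendants_square[OF fin disj cc(1), of k]
        by (simp add: power2_eq_square algebra_simps)
    next
      case False
      then show ?thesis using sum_card_descendants_two_roots[OF fin disj cc, of k k]
        by (simp add: algebra_simps)
    qed
  qed
  also have "\<dots> = real (?c + 2 * k) * (?c + k) * (?c * real ?n ^ ?v)"
    using fin by (simp add: sum.distrib, simp add: algebra_simps)
  also have "\<dots> = ?n * (real (?c + 2 * k) * (?c + k) * card (forests W C))"
    by (simp only: card_forests_eq) simp
  finally show ?thesis by (rule mult_left_le_imp_le) (use n in simp)
qed

text \<open>The deviation is measured from \<open>card C\<close> and not from the mean. The terms
  \<open>card C ^ 2\<close> cancel, so the bound is small against \<open>card C ^ 2\<close> once
  \<open>k\<close> is much smaller than \<open>card C\<close> and \<open>k * card C\<close> much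
  smaller than the number of vertices.\<close>

lemma sum_generation_variance:
  "(\<Sum>g\<in>forests W C. (real (generation W C g k) - card C) ^ 2)
    \<le> (k * card C + 2 * k ^ 2 + 2 * card C * k * real (card C + k) ^ 2 / (card W + card C)) * card (forests W C)"
proof -
  let ?n = "card W + card C" and ?c = "card C" and ?f = "card (forests W C)"
  let ?Z = "\<lambda>g. real (generation W C g k)"
  have n: "real ?n > 0" using fin C by (simp add: card_gt_0_iff add_nonneg_pos)
  have "(\<Sum>g\<in>forests W C. (?Z g - ?c) ^ 2)
      = (\<Sum>g\<in>forests W C. ?Z g ^ 2) - 2 * ?c * (\<Sum>g\<in>forests W C. ?Z g) + ?c ^ 2 * ?f"
    by (simp add: power2_diff sum.distrib sum_subtractf sum_distrib_left mult_ac)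
  also have "\<dots> \<le> real (?c + 2 * k) * (?c + k) * ?f
     - 2 * ?c * ((1 - k * (real (?c + k) / ?n)) * (?c + k) * ?f) + ?c ^ 2 * ?f"
    by (intro add_right_mono diff_mono sum_generation_square mult_left_mono sum_generation_ge) auto
  also have "\<dots> = (k * ?c + 2 * k ^ 2 + 2 * ?c * k * real (?c + k) ^ 2 / ?n) * ?f"
    using n by (simp add: field_simps power2_eq_square)
  finally show ?thesis .
qed

text \<open>Squares taken separately for each subtree hanging at a root. This controls the largest
  of these subtrees, and with it the number of vertices whose path to the roots uses a given
  edge.\<close>

lemma sum_branch_population_square:
  "(\<Sum>g\<in>forests W C. \<Sum>x\<in>{x \<in> W. g x \<in> C}. real (card (descendants W g k x)) ^ 2)
    \<le> real ((k + 1) * (card C + 2 * k + 1)) * card (forests W C)"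
proof -
  let ?v = "card W" and ?n = "card W + card C" and ?c = "card C"
  have n: "real ?n > 0" using fin C by (simp add: card_gt_0_iff add_nonneg_pos)
  have "(\<Sum>x\<in>{x \<in> W. g x \<in> C}. real (card (descendants W g k x)) ^ 2)
    = (\<Sum>c\<in>C. \<Sum>x\<in>{x \<in> W. g x = c}. real (card (descendants (W - {x}) (pruned W g x) k x)) ^ 2)" for g
  proof -
    have "{x \<in> W. g x \<in> C} = (\<Union>c\<in>C. {x \<in> W. g x = c})" by auto
    then have "(\<Sum>x\<in>{x \<in> W. g x \<in> C}. real (card (descendants W g k x)) ^ 2)
      = (\<Sum>c\<in>C. \<Sum>x\<in>{x \<in> W. g x = c}. real (card (descendants W g k x)) ^ 2)"
      using fin by (auto intro!: sum.UNION_disjoint)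
    also have "\<dots> = (\<Sum>c\<in>C. \<Sum>x\<in>{x \<in> W. g x = c}. real (card (descendants (W - {x}) (pruned W g x) k x)) ^ 2)"
    proof (intro sum.cong refl)
      fix c x assume "c \<in> C" "x \<in> {x \<in> W. g x = c}"
      then have "g x \<notin> W" "x \<noteq> g x" using disj by auto
      then show "real (card (descendants W g k x)) ^ 2 =
        real (card (descendants (W - {x}) (pruned W g x) k x)) ^ 2"
        by (simp add: descendants_remove)
    qed
    finally show ?thesis .
  qed
  note eq = this
  have "?n * (\<Sum>g\<in>forests W C. \<Sum>x\<in>{x \<in> W. g x \<in> C}. real (card (descendants W g k x)) ^ 2)
    = (\<Sum>c\<in>C. ?n * (\<Sum>g\<in>forests W C. \<Sum>x\<in>{x \<in> W. g x = c}. real (card (descendants (W - {x}) (pruned W g x) k x)) ^ 2))"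
    unfolding eq sum.swap[of _ C "forests W C"] sum_distrib_left[of _ _ C] ..
  also have "\<dots> = (\<Sum>c\<in>C. ?n * (\<Sum>x\<in>W. \<Sum>g\<in>forests (W - {x}) (insert x C). real (card (descendants (W - {x}) g k x)) ^ 2))"
    by (intro sum.cong refl arg_cong[where f = "\<lambda>x. _ * x"] sum_forests_children fin disj)
  also have "\<dots> = (\<Sum>c\<in>C. \<Sum>x\<in>W. ?n * (\<Sum>g\<in>forests (W - {x}) (insert x C). real (card (descendants (W - {x}) g k x)) ^ 2))"
    by (simp only: sum_distrib_left)
  also have "\<dots> \<le> (\<Sum>c\<in>C. \<Sum>x\<in>W. real ((k + 1) * (?c + 1 + 2 * k)) * real ?n ^ (?v - 1))"
  proof (intro sum_mono)
    fix x assume x: "x \<in> W"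
    then have "x \<notin> C" "?v > 0" using disj fin by (auto simp: card_gt_0_iff)
    moreover have "card (W - {x}) = ?v - 1" using x fin by simp
    ultimately show "?n * (\<Sum>g\<in>forests (W - {x}) (insert x C). real (card (descendants (W - {x}) g k x)) ^ 2)
        \<le> real ((k + 1) * (?c + 1 + 2 * k)) * real ?n ^ (?v - 1)"
      using sum_card_descendants_square[of "W - {x}" "insert x C" x k] x fin disj by auto
  qed
  also have "\<dots> = real ((k + 1) * (?c + 1 + 2 * k)) * ?c * (real ?v * real ?n ^ (?v - 1))"
    by simp
  also have "\<dots> \<le> real ((k + 1) * (?c + 1 + 2 * k)) * ?c * real ?n ^ ?v"
    by (intro mult_left_mono) (cases ?v; auto intro!: mult_right_mono)+
  also have "\<dots> = ?n * (real ((k + 1) * (?c + 2 * k + 1)) * card (forests W C))"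
    using card_forests_eq by (simp add: mult_ac)
  finally show ?thesis by (rule mult_left_le_imp_le) (use n in simp)
qed

end

section \<open>The spine between two vertices\<close>

text \<open>The probability that two independent uniform vertices of a uniform tree on
  \<open>n\<close> labels are at distance at least \<open>k\<close>. It is a product of the birthday
  problem, whence the order \<open>sqrt n\<close>.\<close>

definition spine_tail :: "nat \<Rightarrow> nat \<Rightarrow> real" where
  "spine_tail n k = (\<Prod>i<k. 1 - real (Suc i) / n)"

text \<open>The probability that the spine has \<open>Suc k\<close> vertices: the mean size of
  generation \<open>k\<close> in a uniform tree with one root, divided by \<open>n\<close>.\<close>

definition spine_weight :: "nat \<Rightarrow> nat \<Rightarrow> real" where
  "spine_weight n k = spine_tail n k * real (Suc k) / n"

lemma spine_weight_eq_diff: "spine_weight n k = spine_tail n k - spine_tail n (Suc k)"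
  by (simp add: spine_weight_def spine_tail_def algebra_simps)

lemma spine_tail_bounds: "k \<le> n \<Longrightarrow> 0 \<le> spine_tail n k" "k \<le> n \<Longrightarrow> spine_tail n k \<le> 1"
  by (auto simp: spine_tail_def divide_simps intro!: prod_nonneg prod_le_1)

lemma spine_weight_nonneg: "k \<le> n \<Longrightarrow> 0 \<le> spine_weight n k"
  using spine_tail_bounds(1)[of k n] by (auto simp: spine_weight_def)

lemma spine_weight_le: "k \<le> n \<Longrightarrow> spine_weight n k \<le> real (Suc k) / n"
  using mult_right_mono[OF spine_tail_bounds(2)[of k n], of "real (Suc k) / n"] by (auto simp: spine_weight_def)

lemma spine_tail_n: "n > 0 \<Longrightarrow> spine_tail n n = 0"
  unfolding spine_tail_def by (rule prod_zero) (auto intro!: bexI[of _ "n - 1"])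

lemma sum_spine_weight: "n > 0 \<Longrightarrow> (\<Sum>k<n. spine_weight n k) = 1"
  unfolding spine_weight_eq_diff by (subst sum_lessThan_telescope') (simp add: spine_tail_n, simp add: spine_tail_def)

lemma card_Suc_le_real: "real (card {k. k < n \<and> real (Suc k) \<le> x}) \<le> x" if "x \<ge> 0" for n :: nat
proof -
  have "card {k. k < n \<and> real (Suc k) \<le> x} \<le> card {..<nat \<lfloor>x\<rfloor>}"
    by (rule card_mono) (auto simp: le_nat_floor less_eq_Suc_le simp del: of_nat_Suc)
  also have "real (card {..<nat \<lfloor>x\<rfloor>}) \<le> x" using that by simp
  finally show ?thesis by simp
qed

text \<open>Summation by parts turns the mean into the sum of the tails. Those with
  \<open>Suc k \<le> sqrt n\<close> are at most 1 each. The later ones are at most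
  \<open>sqrt n\<close> times the weight, which is the tail times \<open>Suc k / n\<close>, and the
  weights add up to 1. Each part gives \<open>sqrt n\<close>.\<close>

lemma mean_spine_size:
  assumes "n > 0"
  shows "(\<Sum>k<n. real (Suc k) * spine_weight n k) \<le> 2 * sqrt n"
proof -
  have "(\<Sum>k<m. real (Suc k) * spine_weight n k) = (\<Sum>k<m. spine_tail n k) - real m * spine_tail n m" for m
    by (induction m) (auto simp: spine_weight_eq_diff algebra_simps)
  then have "(\<Sum>k<n. real (Suc k) * spine_weight n k) = (\<Sum>k<n. spine_tail n k)"
    using spine_tail_n[OF assms] by simp
  also have "\<dots> \<le> (\<Sum>k<n. of_bool (Suc k \<le> sqrt n) + sqrt n * spine_weight n k)"
  proof (rule sum_mono)
    fix k assume "k \<in> {..<n}"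
    then have k: "k \<le> n" by simp
    show "spine_tail n k \<le> of_bool (Suc k \<le> sqrt n) + sqrt n * spine_weight n k"
    proof (cases "Suc k \<le> sqrt n")
      case True
      then show ?thesis using spine_tail_bounds[OF k] spine_weight_nonneg[OF k] by (simp add: add_increasing2)
    next
      case False
      have "sqrt n * spine_weight n k = spine_tail n k * (real (Suc k) / sqrt n)"
      proof -
        have "sqrt n * spine_weight n k = spine_tail n k * (real (Suc k) * (sqrt n / n))"
          by (simp add: spine_weight_def)
        also have "sqrt n / n = inverse (sqrt n)" by (rule sqrt_divide_self_eq) simp
        finally show ?thesis by (simp only: divide_inverse)
      qed
      moreover have "real (Suc k) / sqrt n \<ge> 1" using False assms by simp
      ultimately show ?thesis using spine_tail_bounds(1)[OF k] False mult_left_mono[of 1 "real (Suc k) / sqrt n" "spine_tail n k"] by simp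
    qed
  qed
  also have "\<dots> = real (card {k. k < n \<and> real (Suc k) \<le> sqrt n}) + sqrt n"
    using sum_spine_weight[OF assms] by (simp add: sum.distrib sum_distrib_left[symmetric] sum_of_bool_eq lessThan_def Collect_conj_eq)
  also have "card {k. k < n \<and> real (Suc k) \<le> sqrt n} \<le> sqrt n"
    by (rule card_Suc_le_real) simp
  finally show ?thesis by simp
qed

text \<open>The spine decomposition in the form in which it is used: \<open>a\<close> and
  \<open>y\<close> are the marked vertices, and bounds for the means over forests with a given
  number of roots are averaged with the law of the spine size.\<close>

lemma sum_spine_le:
  fixes \<Phi> :: "'v set \<Rightarrow> ('v \<Rightarrow> 'v) \<Rightarrow> real" and bd :: "nat \<Rightarrow> real"
  assumes fin: "finite W" and a: "a \<notin> W" and n: "n = Suc (card W)"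
    and bd: "\<And>W' C'. finite W' \<Longrightarrow> finite C' \<Longrightarrow> C' \<noteq> {} \<Longrightarrow> W' \<inter> C' = {} \<Longrightarrow> W' \<union> C' = insert a W \<Longrightarrow>
      (\<Sum>g\<in>forests W' C'. \<Phi> C' g) \<le> bd (card C') * card (forests W' C')"
  shows "(\<Sum>g\<in>forests W {a}. \<Sum>y\<in>insert a W. \<Phi> (insert a (branch W g y)) (restrict g (W - branch W g y)))
    \<le> (\<Sum>k<n. spine_weight n k * bd (Suc k)) * (n * card (forests W {a}))"
proof -
  have fin': "finite {a}" "W \<inter> {a} = {}" "a \<in> {a}" "{a} \<noteq> {}" using a by auto
  have group: "(\<Sum>y\<in>insert a W. \<Psi> y) = (\<Sum>k<n. \<Sum>y\<in>descendants W g k a. \<Psi> y)"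
    if g: "g \<in> forests W {a}" for g and \<Psi> :: "'v \<Rightarrow> real"
  proof -
    have "(\<Sum>y\<in>insert a W. \<Psi> y) = (\<Sum>k<n. \<Sum>y\<in>{y \<in> insert a W. level W g y = k}. \<Psi> y)"
    proof (rule sum.group[symmetric])
      show "(\<lambda>y. level W g y) ` insert a W \<subseteq> {..<n}"
        unfolding n using card_mono[OF fin branch_subset] by (fastforce simp: less_Suc_eq_le)
    qed (use fin in auto)
    moreover have "{y \<in> insert a W. level W g y = k} = descendants W g k a" for k
      using level_eq_descendants[OF g fin fin'(2), of k] by simp
    ultimately show ?thesis by simp
  qed
  have weight: "spine_sum (\<lambda>_ _. 1 :: real) W {a} k a = spine_weight n k * (n * card (forests W {a}))" for k
  proof -
    have "spine_sum (\<lambda>_ _. 1 :: real) W {a} k a = (\<Sum>g\<in>forests W {a}. real (generation W {a} g k))"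
      unfolding spine_sum_def using fin a by (simp add: generation_eq_sum)
    also have "\<dots> = spine_weight n k * (n * card (forests W {a}))"
    proof -
      have "real (card {a} + i) / real (card W + card {a}) = real (Suc i) / real n" for i
        by (simp add: n)
      then have "(\<Sum>g\<in>forests W {a}. real (generation W {a} g k)) =
          spine_tail n k * real (Suc k) * card (forests W {a})"
        using sum_generation[OF fin fin'(1,2,4), of k] by (simp add: spine_tail_def)
      moreover have "real n > 0" using n by simp
      ultimately show ?thesis by (simp add: spine_weight_def)
    qed
    finally show ?thesis .
  qed
  have "(\<Sum>g\<in>forests W {a}. \<Sum>y\<in>insert a W. \<Phi> (insert a (branch W g y)) (restrict g (W - branch W g y)))
    = (\<Sum>g\<in>forests W {a}. \<Sum>k<n. \<Sum>y\<in>descendants W g k a. \<Phi> (insert a (branch W g y)) (restrict g (W - branch W g y)))"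
    using group by simp
  also have "\<dots> = (\<Sum>k<n. spine_sum \<Phi> W {a} k a)"
    unfolding spine_sum_def by (subst sum.swap) simp
  also have "\<dots> \<le> (\<Sum>k<n. bd (Suc k) * spine_sum (\<lambda>_ _. 1 :: real) W {a} k a)"
  proof (rule sum_mono)
    fix k
    have "(\<Sum>g\<in>forests W' C'. \<Phi> C' g) \<le> bd (Suc k) * card (forests W' C')"
      if "finite W'" "finite C'" "W' \<inter> C' = {}" "W' \<union> C' = W \<union> {a}" "card C' = card {a} + k" for W' C'
      using bd[of W' C'] that by force
    from spine_sum_le[OF fin fin'(1-3) this]
    show "spine_sum \<Phi> W {a} k a \<le> bd (Suc k) * spine_sum (\<lambda>_ _. 1 :: real) W {a} k a" .
  qed
  also have "\<dots> = (\<Sum>k<n. spine_weight n k * bd (Suc k)) * (n * card (forests W {a}))"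
    unfolding weight sum_distrib_right by (simp add: mult_ac)
  finally show ?thesis .
qed

section \<open>Supermartingales of jump processes\<close>

text \<open>Only derivatives at time 0 are given, so \<open>t\<close> is cut into \<open>k\<close>
  short steps of length \<open>s\<close>. Each multiplies \<open>\<phi>\<close> by at most
  \<open>1 - l * s\<close>, with an error \<open>eps * s\<close>; the errors add up to at most
  \<open>e\<close>, and \<open>(1 - l * s) ^ k \<le> exp (- l * t)\<close>.\<close>

lemma semigroup_supermartingale:
  fixes q :: "'s \<Rightarrow> 's \<Rightarrow> real"
  assumes fin: "finite S" and sg: "transition_semigroup S p" and rates: "has_jump_rates S p q"
    and l: "l \<ge> 0" and \<phi>: "\<And>x. x \<in> S \<Longrightarrow> 0 \<le> \<phi> x"
    and gen: "\<And>x. x \<in> S \<Longrightarrow> (\<Sum>y\<in>S. q x y * (\<phi> y - \<phi> x)) \<le> - l * \<phi> x"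
    and t: "t \<ge> 0" and x: "x \<in> S"
  shows "(\<Sum>y\<in>S. p t x y * \<phi> y) \<le> exp (- l * t) * \<phi> x"
proof -
  have p_nonneg: "0 \<le> p t x y" if "t \<ge> 0" "x \<in> S" "y \<in> S" for t x y
    using sg that unfolding transition_semigroup_def by blast
  have p_sum: "(\<Sum>y\<in>S. p t x y) = 1" if "t \<ge> 0" "x \<in> S" for t x
    using sg that unfolding transition_semigroup_def by blast
  have p_0: "p 0 x y = of_bool (x = y)" if "x \<in> S" "y \<in> S" for x y
    using sg that unfolding transition_semigroup_def by blast
  have p_add: "p (s + t) x y = (\<Sum>z\<in>S. p s x z * p t z y)" if "s \<ge> 0" "t \<ge> 0" "x \<in> S" "y \<in> S" for s t x y
    using sg that unfolding transition_semigroup_def by blast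
  define A where "A s x = (\<Sum>y\<in>S. p s x y * \<phi> y)" for s x
  have A_0: "A 0 x = \<phi> x" if "x \<in> S" for x
  proof -
    have "A 0 x = (\<Sum>y\<in>S. if x = y then \<phi> y else 0)"
      unfolding A_def using p_0 that by (intro sum.cong) auto
    then show ?thesis using fin that by simp
  qed
  have A_add: "A (s + t) x = (\<Sum>z\<in>S. p s x z * A t z)" if "s \<ge> 0" "t \<ge> 0" "x \<in> S" for s t x
  proof -
    have "A (s + t) x = (\<Sum>y\<in>S. \<Sum>z\<in>S. p s x z * (p t z y * \<phi> y))"
      unfolding A_def using p_add that by (simp add: sum_distrib_right mult.assoc)
    then show ?thesis unfolding A_def by (subst (asm) sum.swap) (simp add: sum_distrib_left)
  qed
  have short: "\<forall>\<^sub>F s in at 0 within {0..}. \<forall>x\<in>S. (A s x - \<phi> x) / s < - l * \<phi> x + eps"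
    if "eps > 0" for eps
  proof -
    have "\<forall>\<^sub>F s in at 0 within {0..}. (A s x - \<phi> x) / s < - l * \<phi> x + eps" if x: "x \<in> S" for x
    proof -
      \<comment> \<open>The given rates are off-diagonal. As the rows of \<open>p\<close> sum to 1,
        \<open>A s x - \<phi> x\<close> is the sum of
        \<open>p s x y * (\<phi> y - \<phi> x)\<close>, whose term at \<open>y = x\<close> is
        zero.\<close>
      have "((\<lambda>s. \<Sum>y\<in>S - {x}. p s x y * (\<phi> y - \<phi> x)) has_real_derivative
          (\<Sum>y\<in>S - {x}. q x y * (\<phi> y - \<phi> x))) (at 0 within {0..})"
        using rates x unfolding has_jump_rates_def
        by (intro DERIV_sum DERIV_cmult_right) auto
      then have "((\<lambda>s. ((\<Sum>y\<in>S - {x}. p s x y * (\<phi> y - \<phi> x)) - (\<Sum>y\<in>S - {x}. p 0 x y * (\<phi> y - \<phi> x))) / (s - 0)) \<longlongrightarrow>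
          (\<Sum>y\<in>S - {x}. q x y * (\<phi> y - \<phi> x))) (at 0 within {0..})"
        unfolding has_field_derivative_iff by simp
      moreover have "(\<Sum>y\<in>S - {x}. p 0 x y * (\<phi> y - \<phi> x)) = 0"
        using p_0 x by (intro sum.neutral) auto
      moreover have "(\<Sum>y\<in>S - {x}. q x y * (\<phi> y - \<phi> x)) < - l * \<phi> x + eps"
        using gen[OF x] fin x \<open>eps > 0\<close> by (simp add: sum.remove)
      ultimately have "\<forall>\<^sub>F s in at 0 within {0..}. (\<Sum>y\<in>S - {x}. p s x y * (\<phi> y - \<phi> x)) / s < - l * \<phi> x + eps"
        using order_tendstoD(2) by fastforce
      moreover have "\<forall>\<^sub>F s in at 0 within {0..}. s \<ge> (0::real)"
        by (auto simp: eventually_at_filter)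
      ultimately show ?thesis
      proof eventually_elim
        case (elim s)
        have "A s x - \<phi> x = (\<Sum>y\<in>S. p s x y * \<phi> y) - (\<Sum>y\<in>S. p s x y) * \<phi> x"
          unfolding A_def using p_sum[OF elim(2) x] by simp
        also have "\<dots> = (\<Sum>y\<in>S. p s x y * (\<phi> y - \<phi> x))"
          by (simp add: sum_distrib_right sum_subtractf right_diff_distrib)
        also have "\<dots> = (\<Sum>y\<in>S - {x}. p s x y * (\<phi> y - \<phi> x))"
          using fin x by (simp add: sum.remove)
        finally show ?case using elim(1) by simp
      qed
    qed
    then show ?thesis using fin by (simp add: eventually_ball_finite_distrib)
  qed
  have "A t x \<le> exp (- l * t) * \<phi> x + e" if "e > 0" for e
  proof (cases "t = 0")
    case True
    then show ?thesis using A_0[OF x] that by simp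
  next
    case False
    with t have t: "t > 0" by simp
    define eps where "eps = e / t"
    have "eps > 0" using that t by (simp add: eps_def)
    from short[OF this] obtain \<delta> where \<delta>: "\<delta> > 0"
      "\<And>s x. 0 < s \<Longrightarrow> s < \<delta> \<Longrightarrow> x \<in> S \<Longrightarrow> (A s x - \<phi> x) / s < - l * \<phi> x + eps"
      unfolding eventually_at by (force simp: dist_real_def)
    \<comment> \<open>The bound \<open>t / \<delta>\<close> makes the steps shorter than
      \<open>\<delta>\<close>, and \<open>l * t\<close> keeps \<open>1 - l * s\<close>
      nonnegative.\<close>
    obtain k :: nat where k: "real k > max (t / \<delta>) (l * t)" using reals_Archimedean2 by blast
    have k0: "k > 0" using k t l \<delta>(1) by (cases k) (auto simp: divide_less_0_iff)
    define s where "s = t / k"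
    have s: "0 < s" "s < \<delta>" "l * s \<le> 1"
      using k k0 t \<delta>(1) by (auto simp: s_def field_simps)
    have step: "A s x \<le> (1 - l * s) * \<phi> x + eps * s" if "x \<in> S" for x
      using \<delta>(2)[OF s(1,2) that] s(1) by (simp add: field_simps)
    have "A (j * s) x \<le> (1 - l * s) ^ j * \<phi> x + eps * j * s" if "x \<in> S" for j x
      using that
    proof (induction j arbitrary: x)
      case 0
      then show ?case by (simp add: A_0)
    next
      case (Suc j)
      have "A (Suc j * s) x = (\<Sum>z\<in>S. p s x z * A (j * s) z)"
        using A_add[of s "j * s" x] Suc.prems s(1) by (simp add: algebra_simps)
      also have "\<dots> \<le> (\<Sum>z\<in>S. p s x z * ((1 - l * s) ^ j * \<phi> z + eps * j * s))"
        using Suc s(1) by (intro sum_mono mult_left_mono p_nonneg) auto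
      also have "\<dots> = (1 - l * s) ^ j * A s x + (\<Sum>z\<in>S. p s x z) * (eps * j * s)"
        unfolding A_def by (simp add: sum.distrib sum_distrib_left sum_distrib_right algebra_simps)
      also have "\<dots> = (1 - l * s) ^ j * A s x + eps * j * s"
        using p_sum[of s x] s(1) Suc.prems by simp
      also have "\<dots> \<le> (1 - l * s) ^ j * ((1 - l * s) * \<phi> x + eps * s) + eps * j * s"
        using step[OF Suc.prems] s(3) by (intro add_right_mono mult_left_mono) auto
      also have "\<dots> \<le> (1 - l * s) ^ Suc j * \<phi> x + eps * Suc j * s"
      proof -
        have "(1 - l * s) ^ j \<le> 1" using s l by (intro power_le_one) auto
        then have "(1 - l * s) ^ j * (eps * s) \<le> 1 * (eps * s)"
          using \<open>eps > 0\<close> s(1) by (intro mult_right_mono) auto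
        then show ?thesis by (simp add: algebra_simps)
      qed
      finally show ?case .
    qed
    from this[OF x, of k] have "A t x \<le> (1 - l * s) ^ k * \<phi> x + e"
      using k0 t by (simp add: s_def eps_def)
    also have "(1 - l * s) ^ k \<le> exp (- l * s) ^ k"
      using s(3) exp_ge_add_one_self[of "- l * s"] by (intro power_mono) auto
    also have "exp (- l * s) ^ k = exp (- l * t)"
      using k0 by (simp add: exp_of_nat_mult[symmetric] s_def)
    finally show ?thesis using \<phi>[OF x] by (simp add: mult_right_mono)
  qed
  then show ?thesis unfolding A_def by (rule field_le_epsilon)
qed

lemma terminal_state_eqI:
  assumes "\<And>t. t \<ge> t0 \<Longrightarrow> X t \<omega> = x"
  shows "terminal_state X \<omega> = x"
  unfolding terminal_state_def
proof (rule the_equality)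
  show "\<forall>\<^sub>F t in at_top. X t \<omega> = x" using assms by (auto simp: eventually_at_top_linorder)
  fix y assume "\<forall>\<^sub>F t in at_top. X t \<omega> = y"
  then obtain u where "\<And>t. t \<ge> u \<Longrightarrow> X t \<omega> = y" by (auto simp: eventually_at_top_linorder)
  then show "y = x" using assms[of "max t0 u"] by (metis max.cobounded1 max.cobounded2)
qed

text \<open>The comparison of ranks is assumed at rational times, so that almost surely it holds for
  all of them at once. A rational time of least rank ends all changes at rational times, and
  right-continuity extends this to real times.\<close>

lemma eventually_constant_path:
  fixes rk :: "'s \<Rightarrow> nat"
  assumes rc: "\<And>t. t \<ge> 0 \<Longrightarrow> \<forall>\<^sub>F s in at_right t. f s = f t"
    and dec: "\<And>s t. s \<in> \<rat> \<Longrightarrow> t \<in> \<rat> \<Longrightarrow> 0 \<le> s \<Longrightarrow> s \<le> t \<Longrightarrow> f t = f s \<or> rk (f t) < rk (f s)"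
  obtains t0 where "t0 \<in> \<rat>" "t0 \<ge> 0" "\<And>t :: real. t \<ge> t0 \<Longrightarrow> f t = f t0"
proof -
  obtain t0 where t0: "t0 \<in> \<rat>" "t0 \<ge> (0::real)" "\<And>t. t \<in> \<rat> \<Longrightarrow> t \<ge> 0 \<Longrightarrow> rk (f t0) \<le> rk (f t)"
    using exists_least_iff[of "\<lambda>m. \<exists>t\<in>\<rat>. t \<ge> (0::real) \<and> rk (f t) = m"]
    by (metis Rats_0 leI order_refl)
  have eq: "f t = f t0" if "t \<in> \<rat>" "t \<ge> t0" for t
    using dec[OF t0(1) that(1) t0(2) that(2)] t0(3)[OF that(1)] t0(2) that(2) by fastforce
  have "f t = f t0" if t: "t \<ge> t0" for t
  proof -
    from rc[of t] t t0(2) obtain b where b: "b > t" "\<And>s. t < s \<Longrightarrow> s < b \<Longrightarrow> f s = f t"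
      unfolding eventually_at_right_field by auto
    obtain s where "s \<in> \<rat>" "t < s" "s < b" using Rats_dense_in_real[OF b(1)] by blast
    then show ?thesis using b(2)[of s] eq[of s] t by auto
  qed
  with t0 show ?thesis using that by blast
qed

context
  fixes N :: "'a measure" and S :: "'s set" and q x0 X and rk :: "'s \<Rightarrow> nat"
  assumes process: "markov_jump_process N S q x0 X"
    and q_nonneg: "\<And>x y. x \<in> S \<Longrightarrow> y \<in> S \<Longrightarrow> 0 \<le> q x y"
    and q_decr: "\<And>x y. x \<in> S \<Longrightarrow> y \<in> S \<Longrightarrow> x \<noteq> y \<Longrightarrow> q x y \<noteq> 0 \<Longrightarrow> rk y < rk x"
begin

lemma jump_process_law:
  obtains p where "transition_semigroup S p" "has_jump_rates S p q"
    "\<And>t. t \<ge> 0 \<Longrightarrow> AE \<omega> in N. X t \<omega> \<in> S"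
    "\<And>t y. t \<ge> 0 \<Longrightarrow> y \<in> S \<Longrightarrow> measure N {\<omega> \<in> space N. X t \<omega> = y} = p t x0 y"
    "\<And>s t x y. 0 \<le> s \<Longrightarrow> s \<le> t \<Longrightarrow> x \<in> S \<Longrightarrow> y \<in> S \<Longrightarrow>
      measure N {\<omega> \<in> space N. X s \<omega> = x \<and> X t \<omega> = y} = p s x0 x * p (t - s) x y"
proof -
  interpret prob_space N using process by (simp add: markov_jump_process_def)
  have fin: "finite S" and x0: "x0 \<in> S"
    and meas: "\<And>t. t \<ge> 0 \<Longrightarrow> X t \<in> measurable N (count_space UNIV)"
    using process by (auto simp: markov_jump_process_def)
  note [measurable] = meas
  have events: "{\<omega> \<in> space N. X t \<omega> \<in> B} \<in> sets N" if "t \<ge> 0" for t B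
    using measurable_sets[OF meas[OF that], of B] by (simp add: vimage_def Int_def conj_commute)
  obtain p where p: "transition_semigroup S p" "has_jump_rates S p q"
    and law: "\<And>(k :: nat) (t :: nat \<Rightarrow> real) (x :: nat \<Rightarrow> 's).
          t 0 = 0 \<Longrightarrow> (\<forall>i<k. t i \<le> t (Suc i)) \<Longrightarrow> (\<forall>i\<le>k. x i \<in> S) \<Longrightarrow>
          measure N {\<omega>\<in>space N. \<forall>i\<le>k. X (t i) \<omega> = x i} =
            of_bool (x 0 = x0) * (\<Prod>i<k. p (t (Suc i) - t i) (x i) (x (Suc i)))"
    using process unfolding markov_jump_process_def by blast
  \<comment> \<open>The finite-dimensional laws always include time 0, so the laws at one or two
    later times are read off after adding this almost sure event.\<close>
  have X0: "AE \<omega> in N. X 0 \<omega> = x0"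
    using law[of "\<lambda>_. 0" 0 "\<lambda>_. x0"] x0 prob_Collect_eq_1[of "\<lambda>\<omega>. X 0 \<omega> = x0"] by simp
  have marg: "measure N {\<omega> \<in> space N. X t \<omega> = y} = p t x0 y" if t: "t \<ge> 0" and y: "y \<in> S" for t y
  proof -
    have "measure N {\<omega> \<in> space N. X t \<omega> = y} = measure N {\<omega> \<in> space N. X 0 \<omega> = x0 \<and> X t \<omega> = y}"
      using X0 t by (intro finite_measure_eq_AE) (auto elim: AE_mp)
    also have "\<dots> = p t x0 y"
      using law[of "\<lambda>i. if i = 0 then 0 else t" 1 "\<lambda>i. if i = 0 then x0 else y"] t y x0
      by (simp add: le_Suc_eq all_conj_distrib imp_disjL conj_comms)
    finally show ?thesis .
  qed
  moreover have "measure N {\<omega> \<in> space N. X s \<omega> = x \<and> X t \<omega> = y} = p s x0 x * p (t - s) x y"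
    if t: "0 \<le> s" "s \<le> t" and y: "x \<in> S" "y \<in> S" for s t x y
  proof -
    have "measure N {\<omega> \<in> space N. X s \<omega> = x \<and> X t \<omega> = y} =
      measure N {\<omega> \<in> space N. X 0 \<omega> = x0 \<and> X s \<omega> = x \<and> X t \<omega> = y}"
      using X0 t by (intro finite_measure_eq_AE) (auto elim: AE_mp)
    also have "\<dots> = p s x0 x * p (t - s) x y"
      using law[of "\<lambda>i. if i = 0 then 0 else if i = 1 then s else t" 2
          "\<lambda>i. if i = 0 then x0 else if i = 1 then x else y"] t y x0
      by (simp add: numeral_2_eq_2 le_Suc_eq less_Suc_eq all_conj_distrib imp_disjL conj_comms)
    finally show ?thesis .
  qed
  moreover have "AE \<omega> in N. X t \<omega> \<in> S" if t: "t \<ge> 0" for t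
  proof -
    have "measure N {\<omega> \<in> space N. X t \<omega> \<in> S} = measure N (\<Union>y\<in>S. {\<omega> \<in> space N. X t \<omega> = y})"
      by (intro arg_cong[where f = "measure N"]) auto
    also have "\<dots> = (\<Sum>y\<in>S. measure N {\<omega> \<in> space N. X t \<omega> = y})"
      using fin t by (intro finite_measure_finite_Union) (auto simp: disjoint_family_on_def)
    also have "\<dots> = 1"
      using marg t p(1) x0 unfolding transition_semigroup_def by simp
    finally show ?thesis
      using events[OF t] by (subst (asm) prob_Collect_eq_1) auto
  qed
  ultimately show ?thesis using that p by blast
qed

lemma AE_eventually_constant:
  "AE \<omega> in N. \<exists>t0\<ge>0. \<forall>t\<ge>t0. X t \<omega> = terminal_state X \<omega> \<and> terminal_state X \<omega> \<in> S"
proof -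
  interpret prob_space N using process by (simp add: markov_jump_process_def)
  have fin: "finite S" and x0: "x0 \<in> S"
    and meas: "\<And>t. t \<ge> 0 \<Longrightarrow> X t \<in> measurable N (count_space UNIV)"
    and rc: "\<And>\<omega> t. \<omega> \<in> space N \<Longrightarrow> t \<ge> 0 \<Longrightarrow> eventually (\<lambda>s. X s \<omega> = X t \<omega>) (at_right t)"
    using process by (auto simp: markov_jump_process_def)
  note [measurable] = meas
  obtain p where p: "transition_semigroup S p" "has_jump_rates S p q"
    and in_S: "\<And>t. t \<ge> 0 \<Longrightarrow> AE \<omega> in N. X t \<omega> \<in> S"
    and marg: "\<And>t y. t \<ge> 0 \<Longrightarrow> y \<in> S \<Longrightarrow> measure N {\<omega> \<in> space N. X t \<omega> = y} = p t x0 y"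
    and two: "\<And>s t x y. 0 \<le> s \<Longrightarrow> s \<le> t \<Longrightarrow> x \<in> S \<Longrightarrow> y \<in> S \<Longrightarrow>
      measure N {\<omega> \<in> space N. X s \<omega> = x \<and> X t \<omega> = y} = p s x0 x * p (t - s) x y"
    by (rule jump_process_law) (rule that; assumption)
  have zero: "p t x z = 0" if t: "t \<ge> 0" and xz: "x \<in> S" "z \<in> S" and bad: "\<not> (z = x \<or> rk z < rk x)" for t x z
  proof -
    \<comment> \<open>The indicator of the states that cannot be reached from \<open>x\<close>. It
      starts from 0 and is a supermartingale, because a jump lowers the rank.\<close>
    let ?\<phi> = "\<lambda>z. of_bool (\<not> (z = x \<or> rk z < rk x)) :: real"
    have "(\<Sum>y\<in>S. q u y * (?\<phi> y - ?\<phi> u)) \<le> - 0 * ?\<phi> u" if u: "u \<in> S" for u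
    proof -
      have "q u y * (?\<phi> y - ?\<phi> u) \<le> 0" if "y \<in> S" for y
      proof (cases "q u y = 0 \<or> y = u")
        case False
        then have "rk y < rk u" using q_decr[OF u that] by auto
        then show ?thesis using q_nonneg[OF u that] by (intro mult_nonneg_nonpos) (auto)
      qed auto
      then show ?thesis by (simp add: sum_nonpos)
    qed
    then have "(\<Sum>y\<in>S. p t x y * ?\<phi> y) \<le> exp (- 0 * t) * ?\<phi> x"
      by (intro semigroup_supermartingale[OF fin p]) (use t xz in auto)
    moreover have "p t x z * ?\<phi> z \<le> (\<Sum>y\<in>S. p t x y * ?\<phi> y)"
      using p(1) t xz fin unfolding transition_semigroup_def
      by (intro member_le_sum) auto
    moreover have "p t x z \<ge> 0" using p(1) t xz unfolding transition_semigroup_def by blast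
    ultimately show ?thesis using bad by simp
  qed
  have pair: "AE \<omega> in N. X t \<omega> = X s \<omega> \<or> rk (X t \<omega>) < rk (X s \<omega>)" if st: "0 \<le> s" "s \<le> t" for s t
  proof -
    have "AE \<omega> in N. \<not> (X s \<omega> = x \<and> X t \<omega> = y)" if "x \<in> S" "y \<in> S" "\<not> (y = x \<or> rk y < rk x)" for x y
    proof -
      have [measurable]: "X s \<in> measurable N (count_space UNIV)" "X t \<in> measurable N (count_space UNIV)"
        using meas st by auto
      have "measure N {\<omega> \<in> space N. X s \<omega> = x \<and> X t \<omega> = y} = 0"
        using two[OF st that(1,2)] zero[OF _ that(1,2), of "t - s"] that st by simp
      then show ?thesis by (subst (asm) prob_Collect_eq_0) measurable
    qed
    then have "AE \<omega> in N. \<forall>x\<in>S. \<forall>y\<in>S. \<not> (y = x \<or> rk y < rk x) \<longrightarrow> \<not> (X s \<omega> = x \<and> X t \<omega> = y)"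
      using fin by (simp add: AE_finite_all)
    moreover have "AE \<omega> in N. X s \<omega> \<in> S" "AE \<omega> in N. X t \<omega> \<in> S"
      using in_S st by auto
    ultimately show ?thesis
      by eventually_elim blast
  qed
  have ctb: "countable ({s \<in> \<rat>. 0 \<le> (s::real)})" using countable_rat by (rule countable_subset[rotated]) auto
  have "AE \<omega> in N. \<forall>s\<in>{s \<in> \<rat>. 0 \<le> s}. X s \<omega> \<in> S \<and>
      (\<forall>t\<in>{t \<in> \<rat>. 0 \<le> t}. s \<le> t \<longrightarrow> X t \<omega> = X s \<omega> \<or> rk (X t \<omega>) < rk (X s \<omega>))"
    unfolding AE_ball_countable[OF ctb]
  proof (intro ballI AE_conjI)
    fix s assume s: "s \<in> {s \<in> \<rat>. 0 \<le> (s::real)}"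
    then show "AE \<omega> in N. X s \<omega> \<in> S" using in_S by auto
    show "AE \<omega> in N. \<forall>t\<in>{t \<in> \<rat>. 0 \<le> t}. s \<le> t \<longrightarrow> X t \<omega> = X s \<omega> \<or> rk (X t \<omega>) < rk (X s \<omega>)"
      unfolding AE_ball_countable[OF ctb] using pair s by (auto simp: AE_impI)
  qed
  then show ?thesis
  proof (rule AE_mp, intro AE_I2 impI)
    fix \<omega> assume \<omega>: "\<omega> \<in> space N" and *: "\<forall>s\<in>{s \<in> \<rat>. 0 \<le> s}. X s \<omega> \<in> S \<and>
      (\<forall>t\<in>{t \<in> \<rat>. 0 \<le> t}. s \<le> t \<longrightarrow> X t \<omega> = X s \<omega> \<or> rk (X t \<omega>) < rk (X s \<omega>))"
    obtain t0 where t0: "t0 \<in> \<rat>" "t0 \<ge> 0" "\<And>t. t \<ge> t0 \<Longrightarrow> X t \<omega> = X t0 \<omega>"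
    proof (rule eventually_constant_path[of "\<lambda>t. X t \<omega>" rk])
      show "\<forall>\<^sub>F s in at_right t. X s \<omega> = X t \<omega>" if "t \<ge> 0" for t using rc[OF \<omega> that] .
      show "X t \<omega> = X s \<omega> \<or> rk (X t \<omega>) < rk (X s \<omega>)"
        if "s \<in> \<rat>" "t \<in> \<rat>" "0 \<le> s" "s \<le> t" for s t
        using *[rule_format, of s] that by auto
    qed (rule that)
    have "terminal_state X \<omega> = X t0 \<omega>" by (rule terminal_state_eqI) (rule t0(3))
    moreover have "X t0 \<omega> \<in> S" using t0(1,2) * by blast
    ultimately show "\<exists>t0\<ge>0. \<forall>t\<ge>t0. X t \<omega> = terminal_state X \<omega> \<and> terminal_state X \<omega> \<in> S"
      using t0(2,3) by metis
  qed
qed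

text \<open>The function \<open>\<psi>\<close> accounts for states in which the dynamics is
  unfinished: its mean decays like \<open>exp (- t)\<close>, so only \<open>\<phi> x0\<close> is
  left as \<open>t\<close> grows. The terminal state enters through a measurable event
  \<open>A\<close> that forces it into \<open>B\<close>.\<close>

lemma terminal_state_supermartingale:
  assumes \<phi>: "\<And>x. x \<in> S \<Longrightarrow> 0 \<le> \<phi> x" "\<And>x. x \<in> S \<Longrightarrow> (\<Sum>y\<in>S. q x y * (\<phi> y - \<phi> x)) \<le> 0"
    and \<psi>: "\<And>x. x \<in> S \<Longrightarrow> 0 \<le> \<psi> x" "\<And>x. x \<in> S \<Longrightarrow> (\<Sum>y\<in>S. q x y * (\<psi> y - \<psi> x)) \<le> - \<psi> x"
    and B: "\<And>x. x \<in> S \<Longrightarrow> x \<in> B \<Longrightarrow> 1 \<le> \<phi> x + \<psi> x"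
    and A: "A \<in> sets N" "AE \<omega> in N. \<omega> \<in> A \<longrightarrow> terminal_state X \<omega> \<in> B"
  shows "measure N A \<le> \<phi> x0"
proof -
  interpret prob_space N using process by (simp add: markov_jump_process_def)
  have fin: "finite S" and x0: "x0 \<in> S"
    and meas: "\<And>t. t \<ge> 0 \<Longrightarrow> X t \<in> measurable N (count_space UNIV)"
    using process by (auto simp: markov_jump_process_def)
  note [measurable] = meas A(1)
  obtain p where p: "transition_semigroup S p" "has_jump_rates S p q"
    and in_S: "\<And>t. t \<ge> 0 \<Longrightarrow> AE \<omega> in N. X t \<omega> \<in> S"
    and marg: "\<And>t y. t \<ge> 0 \<Longrightarrow> y \<in> S \<Longrightarrow> measure N {\<omega> \<in> space N. X t \<omega> = y} = p t x0 y"
    and two: "\<And>s t x y. 0 \<le> s \<Longrightarrow> s \<le> t \<Longrightarrow> x \<in> S \<Longrightarrow> y \<in> S \<Longrightarrow>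
      measure N {\<omega> \<in> space N. X s \<omega> = x \<and> X t \<omega> = y} = p s x0 x * p (t - s) x y"
    by (rule jump_process_law) (rule that; assumption)
  have events: "{\<omega> \<in> space N. X t \<omega> \<in> B} \<in> sets N" if "t \<ge> 0" for t
    using measurable_sets[OF meas[OF that], of B] by (simp add: vimage_def Int_def conj_commute)
  have bound: "measure N {\<omega> \<in> space N. X t \<omega> \<in> B} \<le> \<phi> x0 + exp (- t) * \<psi> x0" if t: "t \<ge> 0" for t
  proof -
    have "measure N {\<omega> \<in> space N. X t \<omega> \<in> B} = measure N (\<Union>y\<in>S \<inter> B. {\<omega> \<in> space N. X t \<omega> = y})"
      using in_S[OF t] t fin events by (intro finite_measure_eq_AE) (auto elim!: AE_mp)
    also have "\<dots> = (\<Sum>y\<in>S \<inter> B. p t x0 y)"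
      using fin t marg by (subst finite_measure_finite_Union) (auto simp: disjoint_family_on_def)
    also have "\<dots> \<le> (\<Sum>y\<in>S \<inter> B. p t x0 y * (\<phi> y + \<psi> y))"
    proof (rule sum_mono)
      fix y assume y: "y \<in> S \<inter> B"
      then have "0 \<le> p t x0 y" using p(1) t x0 unfolding transition_semigroup_def by blast
      with y B[of y] show "p t x0 y \<le> p t x0 y * (\<phi> y + \<psi> y)"
        using mult_left_mono[of 1 "\<phi> y + \<psi> y" "p t x0 y"] by simp
    qed
    also have "\<dots> \<le> (\<Sum>y\<in>S. p t x0 y * (\<phi> y + \<psi> y))"
      using \<phi>(1) \<psi>(1) p(1) t x0 fin unfolding transition_semigroup_def
      by (intro sum_mono2) auto
    also have "\<dots> = (\<Sum>y\<in>S. p t x0 y * \<phi> y) + (\<Sum>y\<in>S. p t x0 y * \<psi> y)"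
      by (simp add: distrib_left sum.distrib)
    also have "\<dots> \<le> exp (- 0 * t) * \<phi> x0 + exp (- 1 * t) * \<psi> x0"
      by (intro add_mono semigroup_supermartingale[OF fin p]) (use \<phi> \<psi> t x0 in auto)
    finally show ?thesis by simp
  qed
  \<comment> \<open>The path is terminal from some integer time on. So, up to a null set,
    \<open>A\<close> is the increasing union of the events that \<open>X\<close> is in
    \<open>B\<close> at all integer times from \<open>m\<close> on, and each of these is bounded at
    finite times.\<close>
  define A' where "A' m = {\<omega> \<in> space N. \<omega> \<in> A \<and> (\<forall>k\<ge>m. X (real k) \<omega> \<in> B)}" for m
  have [measurable]: "A' m \<in> sets N" for m
  proof -
    have "A' m = A \<inter> (\<Inter>k\<in>{m..}. {\<omega> \<in> space N. X (real k) \<omega> \<in> B})"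
      using sets.sets_into_space[OF A(1)] by (auto simp: A'_def)
    also have "\<dots> \<in> sets N"
      using A(1) events by (intro sets.Int sets.countable_INT') auto
    finally show ?thesis .
  qed
  have A'_le: "measure N (A' m) \<le> \<phi> x0" for m
  proof (rule tendsto_lowerbound)
    have "(\<lambda>k. exp (- real k)) \<longlonglongrightarrow> 0"
      using filterlim_real_sequentially unfolding filterlim_uminus_at_top
      by (rule filterlim_compose[OF exp_at_bot])
    then have "(\<lambda>k. \<phi> x0 + exp (- real k) * \<psi> x0) \<longlonglongrightarrow> \<phi> x0 + 0 * \<psi> x0"
      by (intro tendsto_intros)
    then show "(\<lambda>k. \<phi> x0 + exp (- real k) * \<psi> x0) \<longlonglongrightarrow> \<phi> x0" by simp
    have "measure N (A' m) \<le> \<phi> x0 + exp (- real k) * \<psi> x0" if "k \<ge> m" for k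
    proof -
      have "measure N (A' m) \<le> measure N {\<omega> \<in> space N. X (real k) \<omega> \<in> B}"
        using that by (intro finite_measure_mono events) (auto simp: A'_def)
      with bound[of "real k"] show ?thesis by simp
    qed
    then show "\<forall>\<^sub>F k in sequentially. measure N (A' m) \<le> \<phi> x0 + exp (- real k) * \<psi> x0"
      by (auto simp: eventually_sequentially)
  qed auto
  have "measure N A = measure N (\<Union>m. A' m)"
  proof (rule finite_measure_eq_AE)
    show "AE \<omega> in N. (\<omega> \<in> A) = (\<omega> \<in> (\<Union>m. A' m))"
      using A(2) AE_eventually_constant
    proof eventually_elim
      case (elim \<omega>)
      show ?case
      proof
        assume \<omega>: "\<omega> \<in> A"
        from elim(2) obtain t0 where t0: "\<And>t. t \<ge> t0 \<Longrightarrow> X t \<omega> = terminal_state X \<omega>" by auto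
        obtain m :: nat where "real m \<ge> t0" using real_arch_simple by blast
        with t0 elim(1) \<omega> have "\<omega> \<in> A' m"
          using sets.sets_into_space[OF A(1)] by (auto simp: A'_def)
        then show "\<omega> \<in> (\<Union>m. A' m)" by blast
      qed (auto simp: A'_def)
    qed
  qed auto
  moreover have "(\<lambda>m. measure N (A' m)) \<longlonglongrightarrow> measure N (\<Union>m. A' m)"
  proof (rule finite_Lim_measure_incseq)
    show "range A' \<subseteq> sets N" by auto
    show "incseq A'" unfolding incseq_def A'_def using order_trans by blast
  qed
  ultimately show ?thesis
    using A'_le by (metis LIMSEQ_le_const2)
qed

end

section \<open>Fires and the spine\<close>

lemma finite_configs [simp]: "finite E \<Longrightarrow> finite (configs E)"
proof -
  have "(UNIV :: edge_state set) = {Inflammable, Fireproof, Burnt}"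
    by (auto intro: edge_state.exhaust)
  then have "finite (UNIV :: edge_state set)" by (metis finite.emptyI finite.insertI)
  then show "finite E \<Longrightarrow> finite (configs E)" unfolding configs_def by (intro finite_PiE) auto
qed

text \<open>The drift as a sum over edges instead of target configurations: edges with a common
  target then contribute separately.\<close>

lemma fire_generator:
  fixes \<phi> :: "'v config \<Rightarrow> real"
  assumes "finite E" "z \<in> configs E"
  shows "(\<Sum>y\<in>configs E. fire_rate E r z y * (\<phi> y - \<phi> z)) =
    (\<Sum>e\<in>inflammable_edges E z. (\<phi> (z(e := Fireproof)) - \<phi> z) + r * (\<phi> (set_on_fire E z e) - \<phi> z))"
proof -
  have in1: "z(e := Fireproof) \<in> configs E" if "e \<in> inflammable_edges E z" for e
    using that assms(2) by (auto simp: configs_def inflammable_edges_def PiE_iff extensional_def)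
  have in2: "set_on_fire E z e \<in> configs E" if e: "e \<in> inflammable_edges E z" for e
  proof -
    have "f \<in> E" if "f \<in> inflammable_cluster E z e" for f
      using that e unfolding inflammable_cluster_def
      by (auto elim!: rtranclE simp: inflammable_edges_def)
    then show ?thesis
      using assms(2) by (auto simp: configs_def set_on_fire_def PiE_iff extensional_def)
  qed
  have delta: "(\<Sum>y\<in>configs E. of_bool (y = a) * (\<phi> y - \<phi> z)) = \<phi> a - \<phi> z" if "a \<in> configs E" for a
  proof -
    have "(\<Sum>y\<in>configs E. of_bool (y = a) * (\<phi> y - \<phi> z)) = (\<Sum>y\<in>configs E. if y = a then \<phi> y - \<phi> z else 0)"
      by (intro sum.cong) auto
    then show ?thesis using that assms(1) by simp
  qed
  have "(\<Sum>y\<in>configs E. fire_rate E r z y * (\<phi> y - \<phi> z)) =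
    (\<Sum>e\<in>inflammable_edges E z. (\<Sum>y\<in>configs E. of_bool (y = z(e := Fireproof)) * (\<phi> y - \<phi> z))
      + r * (\<Sum>y\<in>configs E. of_bool (y = set_on_fire E z e) * (\<phi> y - \<phi> z)))"
    unfolding fire_rate_def sum_distrib_right
    by (subst sum.swap) (simp add: distrib_right sum.distrib sum_distrib_left mult.assoc)
  also have "\<dots> = (\<Sum>e\<in>inflammable_edges E z. (\<phi> (z(e := Fireproof)) - \<phi> z) + r * (\<phi> (set_on_fire E z e) - \<phi> z))"
    using delta in1 in2 by (intro sum.cong refl) simp
  finally show ?thesis .
qed

lemma inflammable_edges_fireproof:
  "inflammable_edges E (z(e := Fireproof)) = inflammable_edges E z - {e}"
  by (auto simp: inflammable_edges_def)

lemma inflammable_edges_fire: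
  "inflammable_edges E (set_on_fire E z e) = inflammable_edges E z - inflammable_cluster E z e"
  by (auto simp: inflammable_edges_def set_on_fire_def)

lemma inflammable_cluster_self: "e \<in> inflammable_cluster E z e"
  by (simp add: inflammable_cluster_def)

lemma finite_inflammable_edges [simp]: "finite E \<Longrightarrow> finite (inflammable_edges E z)"
  by (simp add: inflammable_edges_def)

lemma inflammable_cluster_subset:
  assumes "e \<in> inflammable_edges E z"
  shows "inflammable_cluster E z e \<subseteq> inflammable_edges E z"
  using assms unfolding inflammable_cluster_def by (auto elim: rtranclE)

lemma card_inflammable_edges_fire_less:
  assumes "finite E" "e \<in> inflammable_edges E z"
  shows "card (inflammable_edges E (set_on_fire E z e)) < card (inflammable_edges E z)"
  unfolding inflammable_edges_fire
  using assms inflammable_cluster_self[of e E z] by (intro psubset_card_mono) auto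

lemma fire_rate_nonneg: "r \<ge> 0 \<Longrightarrow> 0 \<le> fire_rate E r x y"
  unfolding fire_rate_def by (intro sum_nonneg) auto

lemma fire_rate_decreases:
  assumes "finite E" "fire_rate E r x y \<noteq> 0"
  shows "card (inflammable_edges E y) < card (inflammable_edges E x)"
proof -
  have "\<exists>e\<in>inflammable_edges E x. 1 * of_bool (y = x(e := Fireproof)) + r * of_bool (y = set_on_fire E x e) \<noteq> 0"
    using assms(2) unfolding fire_rate_def by (meson sum.neutral)
  then obtain e where e: "e \<in> inflammable_edges E x" "y = x(e := Fireproof) \<or> y = set_on_fire E x e"
    by (auto split: if_splits simp: of_bool_def)
  then show ?thesis
    using card_inflammable_edges_fire_less[OF assms(1) e(1)] assms(1)
    by (auto simp: inflammable_edges_fireproof card_gt_0_iff)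
qed

text \<open>Every inflammable edge becomes fireproof at rate 1, and fires only lower the count
  further. The count thus serves as the decaying \<open>\<psi>\<close> that detects unfinished
  configurations.\<close>

lemma inflammable_count_generator:
  assumes "finite E" "z \<in> configs E" "r \<ge> 0"
  shows "(\<Sum>y\<in>configs E. fire_rate E r z y * (real (card (inflammable_edges E y)) - card (inflammable_edges E z)))
    \<le> - real (card (inflammable_edges E z))"
proof -
  have "(\<Sum>e\<in>inflammable_edges E z.
      (real (card (inflammable_edges E (z(e := Fireproof)))) - card (inflammable_edges E z))
      + r * (real (card (inflammable_edges E (set_on_fire E z e))) - card (inflammable_edges E z)))
    \<le> (\<Sum>e\<in>inflammable_edges E z. - 1)"
  proof (rule sum_mono)
    fix e assume e: "e \<in> inflammable_edges E z"
    have "real (card (inflammable_edges E (z(e := Fireproof)))) - card (inflammable_edges E z) = - 1"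
      using e assms(1) card_gt_0_iff[of "inflammable_edges E z"]
      by (auto simp: inflammable_edges_fireproof of_nat_diff)
    moreover have "r * (real (card (inflammable_edges E (set_on_fire E z e))) - card (inflammable_edges E z)) \<le> 0"
      using card_inflammable_edges_fire_less[OF assms(1) e] assms(3) by (intro mult_nonneg_nonpos) auto
    ultimately show "(real (card (inflammable_edges E (z(e := Fireproof)))) - card (inflammable_edges E z))
      + r * (real (card (inflammable_edges E (set_on_fire E z e))) - card (inflammable_edges E z)) \<le> - 1"
      by simp
  qed
  then show ?thesis
    unfolding fire_generator[OF assms(1,2), of r "\<lambda>z. real (card (inflammable_edges E z))"] by simp
qed

text \<open>\<open>path e\<close> is the set of edges that must be inflammable for a fire started at \<open>e\<close> to reach the
  spine, \<open>e\<close> included; the edges touching the spine are those with \<open>path e = {e}\<close>.\<close>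

locale spine_paths =
  fixes E :: "'v set set" and path :: "'v set \<Rightarrow> 'v set set" and r :: real
  assumes finite_edges: "finite E" and r_pos: "r > 0"
    and path_self: "e \<in> E \<Longrightarrow> e \<in> path e" and path_edges: "e \<in> E \<Longrightarrow> path e \<subseteq> E"
    and path_trans: "e \<in> E \<Longrightarrow> f \<in> path e \<Longrightarrow> path f \<subseteq> path e"
    and path_adjacent: "e \<in> E \<Longrightarrow> f \<in> E \<Longrightarrow> e \<inter> f \<noteq> {} \<Longrightarrow> path f \<subseteq> insert f (path e)"
    and path_step: "e \<in> E \<Longrightarrow> path e = {e} \<or>
      (\<exists>f\<in>E. f \<inter> e \<noteq> {} \<and> path e = insert e (path f) \<and> e \<notin> path f)"
begin

section \<open>Edges from which a fire reaches the spine\<close>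

definition touching :: "'v set set" where
  "touching = {e \<in> E. path e = {e}}"

definition connected :: "'v config \<Rightarrow> 'v set set" where
  "connected z = {e \<in> E. path e \<subseteq> inflammable_edges E z}"

definition spine_burnt :: "'v config \<Rightarrow> bool" where
  "spine_burnt z \<longleftrightarrow> (\<exists>e\<in>touching. z e = Burnt)"

definition weight :: "'v set \<Rightarrow> real" where
  "weight e = 1 / card (path e)"

lemma finite_path: "e \<in> E \<Longrightarrow> finite (path e)"
  using path_edges finite_edges finite_subset by blast

lemma card_path_pos: "e \<in> E \<Longrightarrow> card (path e) > 0"
  using finite_path path_self by (metis card_gt_0_iff empty_iff)

lemma weight_nonneg: "0 \<le> weight e"
  by (simp add: weight_def)

lemma finite_connected [simp]: "finite (connected z)"
  using finite_edges by (simp add: connected_def)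

lemma connected_inflammable: "e \<in> connected z \<Longrightarrow> e \<in> inflammable_edges E z"
  using path_self by (auto simp: connected_def)

lemma cluster_meets_touching:
  assumes "e \<in> connected z"
  shows "inflammable_cluster E z e \<inter> touching \<noteq> {}"
  using assms
proof (induction "card (path e)" arbitrary: e rule: less_induct)
  case less
  then have e: "e \<in> E" "path e \<subseteq> inflammable_edges E z" by (auto simp: connected_def)
  from path_step[OF e(1)] show ?case
  proof
    assume "path e = {e}"
    then show ?thesis using e inflammable_cluster_self[of e E z] by (auto simp: touching_def)
  next
    assume "\<exists>f\<in>E. f \<inter> e \<noteq> {} \<and> path e = insert e (path f) \<and> e \<notin> path f"
    then obtain f where f: "f \<in> E" "f \<inter> e \<noteq> {}" "path e = insert e (path f)" "e \<notin> path f" by blast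
    then have "card (path f) < card (path e)" using finite_path[OF f(1)] by simp
    moreover have "f \<in> connected z" using f e by (auto simp: connected_def)
    ultimately have "inflammable_cluster E z f \<inter> touching \<noteq> {}" using less.hyps by blast
    moreover have "f \<in> inflammable_edges E z" "e \<in> inflammable_edges E z"
      using connected_inflammable less.prems \<open>f \<in> connected z\<close> by blast+
    then have "inflammable_cluster E z f \<subseteq> inflammable_cluster E z e"
      unfolding inflammable_cluster_def using f(2)
      by (auto intro!: converse_rtrancl_into_rtrancl[of e f])
    ultimately show ?thesis by blast
  qed
qed

text \<open>By \<open>path_adjacent\<close>, an inflammable edge next to a connected one is
  connected; so the property spreads through the whole cluster.\<close>

lemma connected_if_cluster_connected:
  assumes "f \<in> inflammable_cluster E z e" "f \<in> connected z"
  shows "e \<in> connected z"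
proof -
  let ?rel = "{(a, b). a \<in> inflammable_edges E z \<and> b \<in> inflammable_edges E z \<and> a \<inter> b \<noteq> {}}"
  have "(e, f) \<in> ?rel\<^sup>*"
    using assms(1) by (simp add: inflammable_cluster_def)
  then show ?thesis
    using assms(2)
  proof (induction rule: converse_rtrancl_induct)
    case (step a b)
    then have "b \<in> connected z" "a \<in> E" "b \<in> E" "b \<inter> a \<noteq> {}" "a \<in> inflammable_edges E z"
      by (auto simp: inflammable_edges_def)
    then show ?case using path_adjacent[of b a] by (auto simp: connected_def)
  qed auto
qed

lemma touching_connected: "e \<in> touching \<Longrightarrow> e \<in> inflammable_edges E z \<Longrightarrow> e \<in> connected z"
  by (auto simp: touching_def connected_def)

lemma spine_burnt_fireproof:
  assumes "e \<in> inflammable_edges E z"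
  shows "spine_burnt (z(e := Fireproof)) \<longleftrightarrow> spine_burnt z"
proof -
  have "(z(e := Fireproof)) f = Burnt \<longleftrightarrow> z f = Burnt" for f
    using assms by (auto simp: inflammable_edges_def)
  then show ?thesis unfolding spine_burnt_def by blast
qed

text \<open>The cluster of a connected edge contains a touching edge. Conversely, an inflammable
  touching edge is connected, and then so is its whole cluster.\<close>

lemma spine_burnt_fire:
  assumes "e \<in> inflammable_edges E z"
  shows "spine_burnt (set_on_fire E z e) \<longleftrightarrow> spine_burnt z \<or> e \<in> connected z"
proof -
  have "inflammable_cluster E z e \<inter> touching \<noteq> {} \<longleftrightarrow> e \<in> connected z"
    using cluster_meets_touching connected_if_cluster_connected touching_connected
      inflammable_cluster_subset[OF assms] by blast
  then show ?thesis by (auto simp: spine_burnt_def set_on_fire_def)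
qed

lemma connected_fireproof: "connected (z(e := Fireproof)) = {f \<in> connected z. e \<notin> path f}"
  by (auto simp: connected_def inflammable_edges_fireproof)

text \<open>The path of a connected edge consists of connected edges, none of which lies in the
  cluster of an edge that is not connected.\<close>

lemma connected_fire:
  assumes "e \<in> inflammable_edges E z" "e \<notin> connected z"
  shows "connected (set_on_fire E z e) = connected z"
proof -
  have "path f \<inter> inflammable_cluster E z e = {}" if "f \<in> connected z" for f
  proof -
    have "g \<in> connected z" if "g \<in> path f" for g
      using \<open>f \<in> connected z\<close> that path_trans path_edges by (fastforce simp: connected_def)
    then show ?thesis using connected_if_cluster_connected assms(2) by blast
  qed
  then show ?thesis by (auto simp: connected_def inflammable_edges_fire)
qed

text \<open>After exchanging the sums, each \<open>f\<close> is counted once for every edge of its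
  path, that is \<open>1 / weight f\<close> times.\<close>

lemma sum_path_weights:
  assumes "R \<subseteq> E"
  shows "(\<Sum>e\<in>inflammable_edges E z. \<Sum>f\<in>{f \<in> connected z \<inter> R. e \<in> path f}. weight f)
    = card (connected z \<inter> R)"
proof -
  have "(\<Sum>e\<in>inflammable_edges E z. \<Sum>f\<in>{f \<in> connected z \<inter> R. e \<in> path f}. weight f)
    = (\<Sum>f\<in>connected z \<inter> R. \<Sum>e\<in>{e \<in> inflammable_edges E z. e \<in> path f}. weight f)"
    using finite_edges by (intro sum.swap_restrict) auto
  also have "\<dots> = (\<Sum>f\<in>connected z \<inter> R. 1)"
  proof (intro sum.cong refl)
    fix f assume f: "f \<in> connected z \<inter> R"
    then have "{e \<in> inflammable_edges E z. e \<in> path f} = path f" by (auto simp: connected_def)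
    then show "(\<Sum>e\<in>{e \<in> inflammable_edges E z. e \<in> path f}. weight f) = 1"
      using f card_path_pos[of f] by (auto simp: weight_def connected_def)
  qed
  finally show ?thesis by simp
qed

lemma sum_connected_fireproof:
  "(\<Sum>f\<in>connected (z(e := Fireproof)) \<inter> R. weight f) =
    (\<Sum>f\<in>connected z \<inter> R. weight f) - (\<Sum>f\<in>{f \<in> connected z \<inter> R. e \<in> path f}. weight f)"
proof -
  have eq: "connected (z(e := Fireproof)) \<inter> R = connected z \<inter> R - {f \<in> connected z \<inter> R. e \<in> path f}"
    by (auto simp: connected_fireproof)
  show ?thesis unfolding eq by (rule sum_diff) auto
qed

lemma connected_initial: "connected (initial_config E) = E"
proof -
  have "inflammable_edges E (initial_config E) = E"
    by (auto simp: inflammable_edges_def initial_config_def)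
  then show ?thesis using path_edges by (auto simp: connected_def)
qed

lemma spine_burnt_initial: "\<not> spine_burnt (initial_config E)"
  by (auto simp: spine_burnt_def initial_config_def touching_def)

section \<open>The two supermartingales of the fire dynamics\<close>

definition burn_bound :: "'v config \<Rightarrow> real" where
  "burn_bound z = (if spine_burnt z then 1 else r * (\<Sum>f\<in>connected z. weight f))"

lemma burn_bound_nonneg: "0 \<le> burn_bound z"
  unfolding burn_bound_def using r_pos weight_nonneg by (auto intro!: mult_nonneg_nonneg sum_nonneg)

text \<open>Turning edges fireproof lowers the sum at total rate
  \<open>r * card (connected z)\<close>. A fire from a connected edge raises the bound to 1, which
  contributes at most \<open>r\<close> per such edge, and all other fires leave it
  unchanged.\<close>

lemma burn_bound_generator:
  assumes "z \<in> configs E"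
  shows "(\<Sum>y\<in>configs E. fire_rate E r z y * (burn_bound y - burn_bound z)) \<le> 0"
proof (cases "spine_burnt z")
  case True
  then show ?thesis
    unfolding fire_generator[OF finite_edges assms]
    by (intro sum_nonpos) (simp add: burn_bound_def spine_burnt_fireproof spine_burnt_fire)
next
  case False
  let ?I = "inflammable_edges E z"
  let ?d = "\<lambda>e. \<Sum>f\<in>{f \<in> connected z \<inter> E. e \<in> path f}. weight f"
  have E: "connected z \<inter> E = connected z" for z by (auto simp: connected_def)
  have "(burn_bound (z(e := Fireproof)) - burn_bound z) +
      r * (burn_bound (set_on_fire E z e) - burn_bound z) \<le> - r * ?d e + r * of_bool (e \<in> connected z)"
    if e: "e \<in> ?I" for e
  proof -
    have "burn_bound (z(e := Fireproof)) - burn_bound z = - r * ?d e"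
      using False e sum_connected_fireproof[of z e E]
      by (simp add: burn_bound_def spine_burnt_fireproof E right_diff_distrib)
    moreover have "burn_bound (set_on_fire E z e) - burn_bound z \<le> of_bool (e \<in> connected z)"
    proof (cases "e \<in> connected z")
      case True
      then show ?thesis using e burn_bound_nonneg[of z]
        by (simp add: burn_bound_def[of "set_on_fire E z e"] spine_burnt_fire)
    next
      case nc: False
      then show ?thesis using e False
        by (simp add: burn_bound_def spine_burnt_fire connected_fire)
    qed
    then have "r * (burn_bound (set_on_fire E z e) - burn_bound z) \<le> r * of_bool (e \<in> connected z)"
      using r_pos by (intro mult_left_mono) auto
    ultimately show ?thesis by simp
  qed
  then have "(\<Sum>e\<in>?I. (burn_bound (z(e := Fireproof)) - burn_bound z) +
      r * (burn_bound (set_on_fire E z e) - burn_bound z))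
    \<le> (\<Sum>e\<in>?I. - r * ?d e + r * of_bool (e \<in> connected z))"
    by (rule sum_mono)
  also have "\<dots> = - r * (\<Sum>e\<in>?I. ?d e) + r * card {e \<in> ?I. e \<in> connected z}"
    using finite_edges by (simp add: sum.distrib sum_subtractf sum_distrib_left[symmetric] sum_negf Int_def)
  also have "{e \<in> ?I. e \<in> connected z} = connected z" using connected_inflammable by auto
  also have "(\<Sum>e\<in>?I. ?d e) = card (connected z)" using sum_path_weights[of E z] by (simp add: E)
  also have "- r * real (card (connected z)) + r * real (card (connected z)) = 0" by simp
  finally show ?thesis unfolding fire_generator[OF finite_edges assms] .
qed

definition lower_potential :: "'v set set \<Rightarrow> 'v config \<Rightarrow> real" where
  "lower_potential R z = (if spine_burnt z then 0 else exp (- r / 2 * (\<Sum>f\<in>connected z \<inter> R. weight f)))"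

lemma exp_minus_one_le: "exp x - 1 \<le> 2 * x" if "0 \<le> x" "x \<le> 1" for x :: real
proof -
  have "x * x \<le> x * 1" using that by (intro mult_left_mono) auto
  then show ?thesis using exp_bound[OF that] by (simp add: power2_eq_square)
qed

text \<open>If fireproofing \<open>e\<close> cuts off the weight \<open>d\<close>, the potential is
  multiplied by \<open>exp (r / 2 * d)\<close> and grows by at most \<open>r * d\<close> times
  itself: the factor 1/2 pays for \<open>exp x - 1 \<le> 2 * x\<close>, and the assumption on
  \<open>R\<close> gives \<open>x \<le> 1\<close>. Fires from connected edges, inside or outside
  \<open>R\<close>, set the potential to 0 and take away at least as much.\<close>

lemma lower_potential_generator:
  assumes "z \<in> configs E" "R \<subseteq> E"
    and R: "\<And>e. e \<in> E \<Longrightarrow> r / 2 * (\<Sum>f\<in>{f \<in> R. e \<in> path f}. weight f) \<le> 1"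
  shows "(\<Sum>y\<in>configs E. fire_rate E r z y * (lower_potential R y - lower_potential R z)) \<le> 0"
proof (cases "spine_burnt z")
  case True
  then show ?thesis
    unfolding fire_generator[OF finite_edges assms(1)]
    by (intro sum_nonpos) (simp add: lower_potential_def spine_burnt_fireproof spine_burnt_fire)
next
  case False
  let ?I = "inflammable_edges E z" and ?p = "lower_potential R z"
  let ?d = "\<lambda>e. \<Sum>f\<in>{f \<in> connected z \<inter> R. e \<in> path f}. weight f"
  have p: "?p \<ge> 0" by (simp add: lower_potential_def)
  have "(lower_potential R (z(e := Fireproof)) - ?p) + r * (lower_potential R (set_on_fire E z e) - ?p)
      \<le> ?p * r * ?d e - ?p * r * of_bool (e \<in> connected z)"
    if e: "e \<in> ?I" for e
  proof -
    have eE: "e \<in> E" using e by (simp add: inflammable_edges_def)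
    have "lower_potential R (z(e := Fireproof)) - ?p = ?p * (exp (r / 2 * ?d e) - 1)"
    proof -
      have "lower_potential R (z(e := Fireproof)) = ?p * exp (r / 2 * ?d e)"
        using False e
        by (simp add: lower_potential_def spine_burnt_fireproof sum_connected_fireproof exp_add[symmetric] algebra_simps)
      then show ?thesis by (simp add: right_diff_distrib)
    qed
    also have "\<dots> \<le> ?p * (2 * (r / 2 * ?d e))"
    proof (intro mult_left_mono exp_minus_one_le p)
      show "0 \<le> r / 2 * ?d e" using r_pos weight_nonneg by (auto intro!: mult_nonneg_nonneg sum_nonneg)
      have "?d e \<le> (\<Sum>f\<in>{f \<in> R. e \<in> path f}. weight f)"
        using finite_subset[OF assms(2) finite_edges] weight_nonneg by (intro sum_mono2) auto
      then have "r / 2 * ?d e \<le> r / 2 * (\<Sum>f\<in>{f \<in> R. e \<in> path f}. weight f)"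
        using r_pos by (intro mult_left_mono) auto
      then show "r / 2 * ?d e \<le> 1" using R[OF eE] by linarith
    qed
    also have "\<dots> = ?p * r * ?d e" by simp
    finally have "lower_potential R (z(e := Fireproof)) - ?p \<le> ?p * r * ?d e" .
    moreover have "lower_potential R (set_on_fire E z e) - ?p = - ?p * of_bool (e \<in> connected z)"
      using e False by (simp add: lower_potential_def spine_burnt_fire connected_fire)
    ultimately show ?thesis by simp
  qed
  then have "(\<Sum>e\<in>?I. (lower_potential R (z(e := Fireproof)) - ?p) + r * (lower_potential R (set_on_fire E z e) - ?p))
    \<le> (\<Sum>e\<in>?I. ?p * r * ?d e - ?p * r * of_bool (e \<in> connected z))"
    by (rule sum_mono)
  also have "\<dots> = ?p * r * (\<Sum>e\<in>?I. ?d e) - ?p * r * card {e \<in> ?I. e \<in> connected z}"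
    using finite_edges by (simp add: sum_subtractf sum_distrib_left[symmetric] Int_def)
  also have "{e \<in> ?I. e \<in> connected z} = connected z" using connected_inflammable by auto
  also have "(\<Sum>e\<in>?I. ?d e) = card (connected z \<inter> R)" using sum_path_weights[OF assms(2)] .
  also have "?p * r * card (connected z \<inter> R) \<le> ?p * r * card (connected z)"
    using r_pos p by (intro mult_left_mono) (auto intro!: card_mono)
  finally show ?thesis unfolding fire_generator[OF finite_edges assms(1)] by (simp only: diff_self)
qed

context
  fixes N :: "'a measure" and X
  assumes process: "markov_jump_process N (configs E) (fire_rate E r) (initial_config E) X"
begin

lemma prob_not_fireproof_le:
  assumes "A \<in> sets N" "AE \<omega> in N. \<omega> \<in> A \<longrightarrow> \<not> (\<forall>e\<in>touching. terminal_state X \<omega> e = Fireproof)"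
  shows "measure N A \<le> r * (\<Sum>f\<in>E. weight f)"
proof -
  have "measure N A \<le> burn_bound (initial_config E)"
  proof (rule terminal_state_supermartingale[OF process, where rk = "\<lambda>z. card (inflammable_edges E z)"
        and \<psi> = "\<lambda>z. real (card (inflammable_edges E z))" and B = "{z. \<not> (\<forall>e\<in>touching. z e = Fireproof)}"])
    \<comment> \<open>A touching edge that is not fireproof is either burnt, so that
      \<open>burn_bound z = 1\<close>, or still inflammable and counted by
      \<open>\<psi>\<close>.\<close>
    fix z assume z: "z \<in> configs E" "z \<in> {z. \<not> (\<forall>e\<in>touching. z e = Fireproof)}"
    then obtain e where e: "e \<in> touching" "z e \<noteq> Fireproof" by auto
    show "1 \<le> burn_bound z + real (card (inflammable_edges E z))"
    proof (cases "z e")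
      case Burnt
      then show ?thesis using e(1) by (auto simp: burn_bound_def spine_burnt_def)
    next
      case Inflammable
      then have "e \<in> inflammable_edges E z" using e by (auto simp: inflammable_edges_def touching_def)
      then have "card (inflammable_edges E z) > 0" using finite_edges by (auto simp: card_gt_0_iff)
      then show ?thesis using burn_bound_nonneg[of z] by simp
    qed (use e in simp)
  qed (use assms r_pos finite_edges burn_bound_nonneg burn_bound_generator
      in \<open>auto intro: fire_rate_nonneg fire_rate_decreases inflammable_count_generator\<close>)
  then show ?thesis
    by (simp add: burn_bound_def spine_burnt_initial connected_initial)
qed

lemma prob_fireproof_le:
  assumes "R \<subseteq> E"
    and R: "\<And>e. e \<in> E \<Longrightarrow> r / 2 * (\<Sum>f\<in>{f \<in> R. e \<in> path f}. weight f) \<le> 1"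
    and A: "A \<in> sets N" "AE \<omega> in N. \<omega> \<in> A \<longrightarrow> (\<forall>e\<in>touching. terminal_state X \<omega> e = Fireproof)"
  shows "measure N A \<le> exp (- r / 2 * (\<Sum>f\<in>R. weight f))"
proof -
  have "measure N A \<le> lower_potential R (initial_config E)"
  proof (rule terminal_state_supermartingale[OF process, where rk = "\<lambda>z. card (inflammable_edges E z)"
        and \<psi> = "\<lambda>z. 0" and B = "{z. \<forall>e\<in>touching. z e = Fireproof}"])
    fix z assume z: "z \<in> configs E" "z \<in> {z. \<forall>e\<in>touching. z e = Fireproof}"
    \<comment> \<open>A connected edge would have an inflammable touching edge in its cluster. So
      the sum in the exponent is empty and the potential alone equals 1, whence
      \<open>\<psi> = 0\<close>.\<close>
    have "connected z = {}"
    proof (rule ccontr)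
      assume "connected z \<noteq> {}"
      then obtain e where e: "e \<in> connected z" by blast
      then obtain f where "f \<in> inflammable_edges E z" "f \<in> touching"
        using cluster_meets_touching[OF e] inflammable_cluster_subset[OF connected_inflammable[OF e]] by blast
      then show False using z(2) by (auto simp: inflammable_edges_def)
    qed
    moreover have "\<not> spine_burnt z" using z(2) by (auto simp: spine_burnt_def)
    ultimately show "1 \<le> lower_potential R z + 0" by (simp add: lower_potential_def)
  next
    show "0 \<le> lower_potential R z" for z by (simp add: lower_potential_def)
  next
    show "(\<Sum>y\<in>configs E. fire_rate E r z y * (lower_potential R y - lower_potential R z)) \<le> 0" if "z \<in> configs E" for z
      by (rule lower_potential_generator[OF that assms(1) R])
  qed (use assms r_pos finite_edges in \<open>auto intro: fire_rate_nonneg fire_rate_decreases\<close>)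
  then show ?thesis
    using assms(1) by (simp add: lower_potential_def spine_burnt_initial connected_initial Int_absorb1)
qed

end

end

section \<open>Trees as parent functions\<close>

definition parent_edges :: "'v set \<Rightarrow> ('v \<Rightarrow> 'v) \<Rightarrow> 'v set set" where
  "parent_edges W g = (\<lambda>x. {x, g x}) ` W"

lemma forests_rank:
  assumes "g \<in> forests W C"
  obtains h :: "'v \<Rightarrow> nat" where "\<And>x. x \<in> W \<Longrightarrow> h (g x) < h x"
proof -
  obtain h where h: "\<And>x. x \<in> W \<Longrightarrow> g x \<in> W \<longrightarrow> h (g x) < (h x :: nat)"
    using assms by (auto simp: forests_def)
  show ?thesis
    by (rule that[of "\<lambda>x. if x \<in> W then Suc (h x) else 0"]) (use h in auto)
qed

lemma parent_edges_connected:
  assumes "g \<in> forests (V - {a}) {a}" "x \<in> V"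
  shows "(x, a) \<in> {(u, v). {u, v} \<in> parent_edges (V - {a}) g}\<^sup>*"
proof (cases "x = a")
  case False
  then have "x \<in> V - {a}" using assms(2) by simp
  with assms(1) show ?thesis
  proof (induction rule: forests_rank_induct)
    case (step x)
    have e: "(x, g x) \<in> {(u, v). {u, v} \<in> parent_edges (V - {a}) g}"
      using step(1) by (auto simp: parent_edges_def)
    show ?case
    proof (cases "g x = a")
      case True
      then show ?thesis using e by auto
    next
      case False
      then have "g x \<in> V - {a}" using forests_in[OF assms(1) step(1)] by auto
      with step e show ?thesis by (blast intro: converse_rtrancl_into_rtrancl)
    qed
  qed
qed simp

lemma sym_edge_rel: "sym {(u, v). {u, v} \<in> E}"
  by (auto simp: sym_def insert_commute)

text \<open>At a vertex of maximal rank on a cycle both neighbours would have to be its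
  parent.\<close>

lemma parent_edges_acyclic:
  assumes "g \<in> forests W C"
  shows "\<not> is_cycle (V, parent_edges W g) vs"
proof
  assume cyc: "is_cycle (V, parent_edges W g) vs"
  obtain h :: "_ \<Rightarrow> nat" where h: "\<And>x. x \<in> W \<Longrightarrow> h (g x) < h x"
    using forests_rank[OF assms] by blast
  let ?L = "length vs"
  have L: "3 \<le> ?L" "distinct vs" and e: "\<And>i. i < ?L \<Longrightarrow> {vs ! i, vs ! (Suc i mod ?L)} \<in> parent_edges W g"
    using cyc by (auto simp: is_cycle_def)
  have "finite ((\<lambda>i. h (vs ! i)) ` {..<?L})" "(\<lambda>i. h (vs ! i)) ` {..<?L} \<noteq> {}"
    using L(1) by (auto simp: lessThan_empty_iff)
  then obtain i where i: "i < ?L" and max: "\<And>j. j < ?L \<Longrightarrow> h (vs ! j) \<le> h (vs ! i)"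
    using Max_in[of "(\<lambda>i. h (vs ! i)) ` {..<?L}"] Max_ge[of "(\<lambda>i. h (vs ! i)) ` {..<?L}"]
    by (smt (verit) imageE imageI lessThan_iff)
  have parent: "vs ! j = g (vs ! i)" if j: "j < ?L" "{vs ! i, vs ! j} \<in> parent_edges W g" for j
  proof -
    obtain x where x: "x \<in> W" "{vs ! i, vs ! j} = {x, g x}"
      using j(2) by (auto simp: parent_edges_def)
    with h[OF x(1)] max[OF j(1)] show ?thesis by (auto simp: doubleton_eq_iff)
  qed
  \<comment> \<open>The cyclic predecessor of \<open>i\<close>, which differs from the successor
    because the length is at least 3.\<close>
  define k where "k = (if i = 0 then ?L - 1 else i - 1)"
  have k: "k < ?L" "Suc k mod ?L = i" using i L(1) by (auto simp: k_def)
  have j: "Suc i mod ?L < ?L" using L(1) by (intro mod_less_divisor) auto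
  have "vs ! (Suc i mod ?L) = vs ! k"
    using parent[OF j e[OF i]] parent[OF k(1)] e[OF k(1)] k(2) by (simp add: insert_commute)
  then have "Suc i mod ?L = k"
    using j k(1) L(2) by (simp add: nth_eq_iff_index_eq)
  then show False
    using i L(1) by (cases "Suc i = ?L") (auto simp: k_def split: if_splits)
qed

lemma is_tree_parent_edges:
  assumes g: "g \<in> forests (V - {a}) {a}" and a: "a \<in> V"
  shows "is_tree (V, parent_edges (V - {a}) g)"
  unfolding is_tree_def fst_conv snd_conv
proof (intro conjI ballI)
  obtain h :: "_ \<Rightarrow> nat" where h: "\<And>x. x \<in> V - {a} \<Longrightarrow> h (g x) < h x"
    using forests_rank[OF g] by blast
  fix e assume "e \<in> parent_edges (V - {a}) g"
  then obtain x where x: "x \<in> V - {a}" "e = {x, g x}" by (auto simp: parent_edges_def)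
  moreover have "g x \<in> V" using forests_in[OF g x(1)] a by auto
  moreover have "x \<noteq> g x" using h[OF x(1)] by auto
  ultimately show "\<exists>u\<in>V. \<exists>v\<in>V. u \<noteq> v \<and> e = {u, v}" by blast
next
  fix u v assume uv: "u \<in> V" "v \<in> V"
  have "(a, v) \<in> {(u, v). {u, v} \<in> parent_edges (V - {a}) g}\<^sup>*"
    using parent_edges_connected[OF g uv(2)] by (rule symD[OF sym_rtrancl[OF sym_edge_rel]])
  with parent_edges_connected[OF g uv(1)] uv
  show "same_component (V, parent_edges (V - {a}) g) u v"
    by (auto simp: same_component_def)
next
  show "\<nexists>vs. is_cycle (V, parent_edges (V - {a}) g) vs"
    using parent_edges_acyclic[OF g] by blast
qed (use a in auto)

text \<open>Induction from the roots. If \<open>g\<close> used the edge from \<open>x\<close> to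
  \<open>g' x\<close> in the opposite direction, the induction hypothesis at \<open>g' x\<close>
  would make the two vertices each other's parents under \<open>g'\<close>.\<close>

lemma parent_edges_inj:
  assumes g: "g \<in> forests W C" and g': "g' \<in> forests W C"
    and eq: "parent_edges W g = parent_edges W g'"
  shows "g = g'"
proof
  fix x
  show "g x = g' x"
  proof (cases "x \<in> W")
    case True
    obtain h :: "_ \<Rightarrow> nat" where h: "\<And>x. x \<in> W \<Longrightarrow> h (g' x) < h x"
      using forests_rank[OF g'] by blast
    from g' True show ?thesis
    proof (induction rule: forests_rank_induct)
      case (step x)
      have "{x, g' x} \<in> parent_edges W g" unfolding eq using step(1) by (auto simp: parent_edges_def)
      then obtain z where z: "z \<in> W" "{x, g' x} = {z, g z}" by (auto simp: parent_edges_def)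
      then consider "z = x" "g' x = g x" | "z = g' x" "g z = x" by (auto simp: doubleton_eq_iff)
      then show ?case
      proof cases
        case 2
        then have "g' (g' x) = x" using step(2) z(1) by auto
        then show ?thesis using h[OF step(1)] h[of "g' x"] z(1) 2 by auto
      qed simp
    qed
  qed (simp add: forests_undefined[OF g] forests_undefined[OF g'])
qed

text \<open>Loop erasure: if the next vertex was already visited, the path is cut back to
  it.\<close>

lemma rtrancl_distinct_path:
  assumes "(x, y) \<in> R\<^sup>*"
  obtains vs where "vs \<noteq> []" "vs ! 0 = x" "vs ! (length vs - 1) = y" "distinct vs"
    "\<And>i. Suc i < length vs \<Longrightarrow> (vs ! i, vs ! Suc i) \<in> R"
proof -
  have "\<exists>vs. vs \<noteq> [] \<and> vs ! 0 = x \<and> vs ! (length vs - 1) = y \<and> distinct vs \<and>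
    (\<forall>i. Suc i < length vs \<longrightarrow> (vs ! i, vs ! Suc i) \<in> R)"
    using assms
  proof (induction rule: rtrancl_induct)
    case base
    show ?case by (rule exI[of _ "[x]"]) auto
  next
    case (step y z)
    then obtain vs where vs: "vs \<noteq> []" "vs ! 0 = x" "vs ! (length vs - 1) = y" "distinct vs"
      "\<And>i. Suc i < length vs \<Longrightarrow> (vs ! i, vs ! Suc i) \<in> R" by blast
    show ?case
    proof (cases "z \<in> set vs")
      case True
      then obtain i where i: "i < length vs" "vs ! i = z" by (auto simp: in_set_conv_nth)
      have "length vs - Suc 0 = i" if "length vs \<le> Suc i" using i that by simp
      then show ?thesis
        by (intro exI[of _ "take (Suc i) vs"]) (use vs i in \<open>auto simp: min_def\<close>)
    next
      case False
      have "((vs @ [z]) ! i, (vs @ [z]) ! Suc i) \<in> R" if "Suc i < length (vs @ [z])" for i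
      proof (cases "Suc i < length vs")
        case True
        then show ?thesis using vs(5) by (simp add: nth_append)
      next
        case False
        then have "i = length vs - 1" "Suc i = length vs" using that vs(1) by auto
        then show ?thesis using vs(3) step(2) by (auto simp: nth_append)
      qed
      then show ?thesis
        using vs False by (intro exI[of _ "vs @ [z]"]) (auto simp: nth_append)
    qed
  qed
  then show ?thesis using that by blast
qed

text \<open>Each vertex takes as parent a neighbour closer to \<open>a\<close>. An edge that is not
  a parent edge would close a cycle with the path between its ends in the tree of parent
  edges.\<close>

lemma tree_eq_parent_edges:
  assumes tree: "is_tree (V, E)" and a: "a \<in> V"
  obtains g where "g \<in> forests (V - {a}) {a}" "E = parent_edges (V - {a}) g"
proof -
  let ?R = "{(u, v). {u, v} \<in> E}"
  have edges: "\<And>e. e \<in> E \<Longrightarrow> \<exists>u\<in>V. \<exists>v\<in>V. u \<noteq> v \<and> e = {u, v}"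
    and conn: "\<And>x. x \<in> V \<Longrightarrow> (a, x) \<in> ?R\<^sup>*"
    and acyc: "\<And>vs. \<not> is_cycle (V, E) vs"
    using tree a by (auto simp: is_tree_def same_component_def)
  define d where "d x = (LEAST k. (a, x) \<in> ?R ^^ k)" for x
  have "\<exists>y. y \<in> V \<and> {x, y} \<in> E \<and> d y < d x" if x: "x \<in> V - {a}" for x
  proof -
    obtain k where "(a, x) \<in> ?R ^^ k" using conn[of x] x by (auto simp: rtrancl_power)
    then have dx: "(a, x) \<in> ?R ^^ d x" unfolding d_def by (rule LeastI)
    obtain m where m: "d x = Suc m" using dx x by (cases "d x") auto
    with dx obtain y where y: "(a, y) \<in> ?R ^^ m" "{y, x} \<in> E" by auto
    have "d y \<le> m" unfolding d_def by (rule Least_le) (rule y(1))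
    moreover have "y \<in> V" using edges[OF y(2)] by (auto simp: doubleton_eq_iff)
    ultimately show ?thesis using y(2) m by (auto simp: insert_commute)
  qed
  then obtain f where f: "\<And>x. x \<in> V - {a} \<Longrightarrow> f x \<in> V \<and> {x, f x} \<in> E \<and> d (f x) < d x"
    by metis
  define g where "g = restrict f (V - {a})"
  have g: "g \<in> forests (V - {a}) {a}"
    by (rule forestsI[where h = d]) (use f in \<open>auto simp: g_def\<close>)
  have sub: "parent_edges (V - {a}) g \<subseteq> E"
    using f by (auto simp: parent_edges_def g_def)
  have "e \<in> parent_edges (V - {a}) g" if e: "e \<in> E" for e
  proof (rule ccontr)
    assume ne: "e \<notin> parent_edges (V - {a}) g"
    obtain x y where xy: "x \<in> V" "y \<in> V" "x \<noteq> y" "e = {x, y}" using edges[OF e] by blast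
    have "(x, y) \<in> {(u, v). {u, v} \<in> parent_edges (V - {a}) g}\<^sup>*"
      using is_tree_parent_edges[OF g a] xy by (auto simp: is_tree_def same_component_def)
    then obtain vs where vs: "vs \<noteq> []" "vs ! 0 = x" "vs ! (length vs - 1) = y" "distinct vs"
      "\<And>i. Suc i < length vs \<Longrightarrow> {vs ! i, vs ! Suc i} \<in> parent_edges (V - {a}) g"
      by (auto elim!: rtrancl_distinct_path)
    have "length vs \<noteq> 1" using vs(2,3) xy(3) by auto
    moreover have "length vs \<noteq> 2" using vs(2,3) vs(5)[of 0] ne xy(4) by auto
    ultimately have L: "3 \<le> length vs" using vs(1) by (cases vs) (auto simp: Suc_le_eq neq_Nil_conv)
    have "{vs ! i, vs ! (Suc i mod length vs)} \<in> E" if i: "i < length vs" for i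
    proof (cases "Suc i < length vs")
      case True
      then show ?thesis using vs(5) sub by auto
    next
      case False
      then have "Suc i = length vs" "i = length vs - 1" using i by auto
      then show ?thesis using vs(2,3) xy(4) e by (auto simp: insert_commute)
    qed
    then have "is_cycle (V, E) vs" using L vs(4) by (simp add: is_cycle_def)
    then show False using acyc by blast
  qed
  with sub have "E = parent_edges (V - {a}) g" by blast
  with g show ?thesis by (rule that)
qed

lemma bij_betw_cayley_trees:
  assumes "a \<in> {1..n}"
  shows "bij_betw (parent_edges ({1..n} - {a})) (forests ({1..n} - {a}) {a}) (cayley_trees n)"
  unfolding bij_betw_def
proof
  show "inj_on (parent_edges ({1..n} - {a})) (forests ({1..n} - {a}) {a})"
    by (rule inj_onI) (rule parent_edges_inj)
  show "parent_edges ({1..n} - {a}) ` forests ({1..n} - {a}) {a} = cayley_trees n"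
    using is_tree_parent_edges[OF _ assms] tree_eq_parent_edges[OF _ assms]
    by (fastforce simp: cayley_trees_def)
qed

lemma branch_trans: "y \<in> branch W g x \<Longrightarrow> branch W g y \<subseteq> branch W g x"
  unfolding branch_def by (auto intro: rtrancl_trans)

section \<open>The spine of a tree with two marked vertices\<close>

locale rooted_tree =
  fixes V :: "'v set" and a b :: 'v and g :: "'v \<Rightarrow> 'v" and r :: real
  assumes finite_V: "finite V" and root: "a \<in> V" and b: "b \<in> V"
    and g: "g \<in> forests (V - {a}) {a}" and r_gt_0: "r > 0"
begin

definition E :: "'v set set" where "E = parent_edges (V - {a}) g"
definition edge :: "'v \<Rightarrow> 'v set" where "edge x = {x, g x}"
definition spine :: "'v set" where "spine = insert a (branch (V - {a}) g b)"
definition off :: "'v \<Rightarrow> 'v" where "off = restrict g (V - spine)"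
text \<open>Edges are named after their lower end. The lineage of \<open>x\<close> thus stands for
  the edges from \<open>edge x\<close> to the spine; an edge on the spine gets \<open>{x}\<close>,
  since it touches the spine itself.\<close>

definition lineage :: "'v \<Rightarrow> 'v set" where
  "lineage x = (if x \<in> spine then {x} else branch (V - spine) off x)"
definition path :: "'v set \<Rightarrow> 'v set set" where
  "path e = edge ` lineage (inv_into (V - {a}) edge e)"

lemma spine_subset: "spine \<subseteq> V"
  using branch_subset[of "V - {a}" g b] root by (auto simp: spine_def)

lemma g_in: "x \<in> V - {a} \<Longrightarrow> g x \<in> V"
  using forests_in[OF g] root by auto

lemma spine_closed: "x \<in> spine \<Longrightarrow> x \<noteq> a \<Longrightarrow> g x \<in> spine"
  using g_in by (auto simp: spine_def branch_def intro: rtrancl_into_rtrancl)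

lemma off_forest: "off \<in> forests (V - spine) spine"
proof -
  obtain h :: "_ \<Rightarrow> nat" where h: "\<And>x. x \<in> V - {a} \<Longrightarrow> h (g x) < h x"
    using forests_rank[OF g] by blast
  have "x \<in> V - {a}" if "x \<in> V - spine" for x using that by (auto simp: spine_def)
  then show ?thesis
    using h g_in by (intro forestsI[where h = h]) (auto simp: off_def)
qed

lemma edge_inj: "inj_on edge (V - {a})"
proof (rule inj_onI)
  fix x y assume xy: "x \<in> V - {a}" "y \<in> V - {a}" "edge x = edge y"
  obtain h :: "_ \<Rightarrow> nat" where h: "\<And>x. x \<in> V - {a} \<Longrightarrow> h (g x) < h x"
    using forests_rank[OF g] by blast
  show "x = y"
    using h[OF xy(1)] h[OF xy(2)] xy(3) by (auto simp: edge_def doubleton_eq_iff)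
qed

lemma E_eq: "E = edge ` (V - {a})"
  by (auto simp: E_def parent_edges_def edge_def)

lemma path_edge: "x \<in> V - {a} \<Longrightarrow> path (edge x) = edge ` lineage x"
  using edge_inj by (simp add: path_def)

lemma lineage_self: "x \<in> V \<Longrightarrow> x \<in> lineage x"
  by (auto simp: lineage_def branch_def)

lemma lineage_subset: "x \<in> V - {a} \<Longrightarrow> lineage x \<subseteq> V - {a}"
  using branch_subset[of "V - spine" off x] by (auto simp: lineage_def spine_def)

lemma lineage_trans: "y \<in> lineage x \<Longrightarrow> lineage y \<subseteq> lineage x"
  using branch_trans[of y "V - spine" off x] branch_subset[of "V - spine" off x]
  by (auto simp: lineage_def split: if_splits)

lemma lineage_step:
  assumes "x \<in> V - spine"
  shows "lineage x = insert x (if g x \<in> spine then {} else lineage (g x))" "x \<notin> lineage (g x)"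
proof -
  have "branch (V - spine) off x = insert x (branch (V - spine) off (off x))"
    by (rule branch_step[OF assms])
  then show "lineage x = insert x (if g x \<in> spine then {} else lineage (g x))"
    using assms by (auto simp: lineage_def off_def branch_root)
  show "x \<notin> lineage (g x)"
    using branch_acyclic[OF off_forest assms] assms by (auto simp: lineage_def off_def)
qed

text \<open>Adjacent edges have the same lower end, or the same upper end, or one directly above the
  other. The spine is closed under parents, so a vertex whose parent is off the spine is itself off
  it and inherits the lineage of its parent.\<close>

lemma lineage_adjacent:
  assumes xy: "x \<in> V - {a}" "y \<in> V - {a}" and int: "edge x \<inter> edge y \<noteq> {}"
  shows "lineage y \<subseteq> insert y (lineage x)"
proof (cases "y \<in> spine")
  case True
  then show ?thesis by (simp add: lineage_def)
next
  case False
  then have y: "y \<in> V - spine" using xy by auto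
  note ly = lineage_step(1)[OF y]
  consider "x = y" | "g x = y" | "g y = x" | "g x = g y" using int by (auto simp: edge_def)
  then show ?thesis
  proof cases
    case 2
    then have "x \<notin> spine" using spine_closed[of x] xy False by auto
    then show ?thesis using lineage_step(1)[of x] 2 xy False by auto
  next
    case 3
    then show ?thesis using ly by (auto split: if_splits)
  next
    case 4
    show ?thesis
    proof (cases "g y \<in> spine")
      case False
      then have "x \<notin> spine" using 4 spine_closed[of x] xy by auto
      then show ?thesis using lineage_step(1)[of x] ly 4 xy False by auto
    qed (use ly in auto)
  qed auto
qed

sublocale spine_paths E path r
proof
  show "finite E" using finite_V by (simp add: E_eq)
  show "r > 0" by (rule r_gt_0)
  fix e assume "e \<in> E"
  then obtain x where x: "x \<in> V - {a}" "e = edge x" by (auto simp: E_eq)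
  show "e \<in> path e" using x lineage_self[of x] by (auto simp: path_edge)
  show "path e \<subseteq> E" using x lineage_subset[of x] by (auto simp: path_edge E_eq)
  show "path f \<subseteq> path e" if "f \<in> path e" for f
  proof -
    from that obtain y where y: "y \<in> lineage x" "f = edge y" using x by (auto simp: path_edge)
    then have "y \<in> V - {a}" using lineage_subset[OF x(1)] by auto
    then show ?thesis using x y lineage_trans[OF y(1)] by (auto simp: path_edge)
  qed
  show "path f \<subseteq> insert f (path e)" if f: "f \<in> E" "e \<inter> f \<noteq> {}" for f
  proof -
    obtain y where y: "y \<in> V - {a}" "f = edge y" using f(1) by (auto simp: E_eq)
    then show ?thesis using x lineage_adjacent[OF x(1) y(1)] f(2) by (auto simp: path_edge)
  qed
  show "path e = {e} \<or> (\<exists>f\<in>E. f \<inter> e \<noteq> {} \<and> path e = insert e (path f) \<and> e \<notin> path f)"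
  proof (cases "x \<in> spine")
    case True
    then show ?thesis using x by (simp add: path_edge lineage_def)
  next
    case False
    then have x': "x \<in> V - spine" using x by simp
    show ?thesis
    proof (cases "g x \<in> spine")
      case True
      then show ?thesis using x lineage_step[OF x'] by (simp add: path_edge)
    next
      case gx: False
      then have gxV: "g x \<in> V - {a}" using g_in[OF x(1)] by (auto simp: spine_def)
      have "edge x \<notin> edge ` lineage (g x)"
        using edge_inj lineage_step(2)[OF x'] lineage_subset[OF gxV] x(1) by (auto dest: inj_onD)
      moreover have "edge (g x) \<inter> edge x \<noteq> {}" by (auto simp: edge_def)
      ultimately show ?thesis
        using x lineage_step(1)[OF x'] gx gxV by (auto simp: path_edge E_eq)
    qed
  qed
qed

lemma touching_eq: "touching = {e \<in> E. e \<inter> spine \<noteq> {}}"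
proof -
  have "path (edge x) = {edge x} \<longleftrightarrow> edge x \<inter> spine \<noteq> {}" if x: "x \<in> V - {a}" for x
  proof (cases "x \<in> spine")
    case True
    then have "path (edge x) = {edge x}" using x by (simp add: path_edge lineage_def)
    moreover have "edge x \<inter> spine \<noteq> {}" using True by (auto simp: edge_def)
    ultimately show ?thesis by simp
  next
    case False
    then have x': "x \<in> V - spine" using x by simp
    show ?thesis
    proof (cases "g x \<in> spine")
      case True
      then have "path (edge x) = {edge x}" using x lineage_step(1)[OF x'] by (simp add: path_edge)
      moreover have "edge x \<inter> spine \<noteq> {}" using True by (auto simp: edge_def)
      ultimately show ?thesis by simp
    next
      case gx: False
      then have gxV: "g x \<in> V - {a}" using g_in[OF x] by (auto simp: spine_def)
      then have "g x \<in> lineage x" using lineage_step(1)[OF x'] gx lineage_self[of "g x"] by auto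
      then have "edge (g x) \<in> path (edge x)" using x by (auto simp: path_edge)
      moreover have "edge (g x) \<noteq> edge x"
      proof
        assume "edge (g x) = edge x"
        then have "g x = x" using inj_onD[OF edge_inj] gxV x by blast
        then show False using lineage_step(2)[OF x'] lineage_self[of x] x by simp
      qed
      ultimately have "path (edge x) \<noteq> {edge x}" by auto
      moreover have "edge x \<inter> spine = {}" using gx False by (auto simp: edge_def)
      ultimately show ?thesis by simp
    qed
  qed
  then have "path e = {e} \<longleftrightarrow> e \<inter> spine \<noteq> {}" if "e \<in> E" for e
    using that by (auto simp: E_eq)
  then show ?thesis unfolding touching_def by blast
qed

lemma same_component_iff:
  "same_component (fireproof_forest (V, E) z) a b \<longleftrightarrow> (\<forall>e\<in>touching. z e = Fireproof)"
proof
  let ?F = "fireproof_vertices (V, E) z"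
  let ?R = "{(u, v). {u, v} \<in> E \<and> z {u, v} = Fireproof \<and> {u, v} \<subseteq> ?F}"
  {
    assume "same_component (fireproof_forest (V, E) z) a b"
    then have ab: "a \<in> ?F" "(a, b) \<in> ?R\<^sup>*" by (auto simp: same_component_def fireproof_forest_def)
    \<comment> \<open>A walk from \<open>a\<close> in the forest need not follow the spine. The
      invariant is that all vertices between \<open>a\<close> and its current position are
      fireproof; at \<open>b\<close> this is the spine.\<close>
    have "insert a (branch (V - {a}) g y) \<subseteq> ?F \<and> y \<in> ?F" if "(a, y) \<in> ?R\<^sup>*" for y
      using that
    proof (induction rule: rtrancl_induct)
      case base
      then show ?case using ab(1) by (auto simp: branch_root)
    next
      case (step y y')
      then have e: "{y, y'} \<in> E" "y' \<in> ?F" by auto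
      then obtain x where x: "x \<in> V - {a}" "{y, y'} = {x, g x}" by (auto simp: E_eq edge_def)
      then have "(y = x \<and> y' = g x) \<or> (y' = x \<and> y = g x)" by (auto simp: doubleton_eq_iff)
      then show ?case
        using branch_step[OF x(1), of g] step.IH e(2) by auto
    qed
    from this[OF ab(2)] have sp: "spine \<subseteq> ?F" by (auto simp: spine_def)
    show "\<forall>e\<in>touching. z e = Fireproof"
    proof
      fix e assume "e \<in> touching"
      then obtain v where "e \<in> E" "v \<in> e" "v \<in> ?F" using sp by (auto simp: touching_eq)
      then show "z e = Fireproof" by (auto simp: fireproof_vertices_def)
    qed
  next
    assume fp: "\<forall>e\<in>touching. z e = Fireproof"
    then have sp: "spine \<subseteq> ?F"
      using spine_subset by (auto simp: fireproof_vertices_def touching_eq)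
    have bs: "b \<in> spine" using b by (auto simp: spine_def branch_def)
    have sym: "sym ?R" by (auto simp: sym_def insert_commute)
    have "x \<in> spine \<longrightarrow> (x, a) \<in> ?R\<^sup>*" if "x \<in> V - {a}" for x
      using g that
    proof (induction rule: forests_rank_induct)
      case (step x)
      show ?case
      proof
        assume x: "x \<in> spine"
        then have gx: "g x \<in> spine" using spine_closed step(1) by auto
        have "edge x \<in> E" "edge x \<inter> spine \<noteq> {}" using x step(1) by (auto simp: E_eq edge_def)
        then have "edge x \<in> touching" by (simp add: touching_eq)
        then have "(x, g x) \<in> ?R" using fp sp x gx by (auto simp: edge_def touching_def)
        moreover have "(g x, a) \<in> ?R\<^sup>*"
          using step(2) gx spine_subset by (cases "g x = a") auto
        ultimately show "(x, a) \<in> ?R\<^sup>*" by (rule converse_rtrancl_into_rtrancl)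
      qed
    qed
    with b bs have "(b, a) \<in> ?R\<^sup>*" by (cases "b = a") auto
    then have "(a, b) \<in> ?R\<^sup>*" by (rule symD[OF sym_rtrancl[OF sym]])
    moreover have "a \<in> ?F" using sp by (auto simp: spine_def)
    ultimately show "same_component (fireproof_forest (V, E) z) a b"
      using sp bs by (auto simp: same_component_def fireproof_forest_def)
  }
qed

lemma weight_edge: "x \<in> V - {a} \<Longrightarrow> weight (edge x) = 1 / card (lineage x)"
  using edge_inj lineage_subset[of x]
  by (simp add: weight_def path_edge card_image inj_on_subset)

abbreviation height :: "'v \<Rightarrow> nat" where
  "height x \<equiv> level (V - spine) off x"

text \<open>The \<open>card spine - 1\<close> edges of the spine have weight 1 each, and the others
  are indexed by the vertices off the spine.\<close>

lemma sum_weight: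
  "(\<Sum>f\<in>E. weight f) = real (card spine) - 1 + (\<Sum>x\<in>V - spine. 1 / height x)"
proof -
  have "(\<Sum>f\<in>E. weight f) = (\<Sum>x\<in>V - {a}. 1 / card (lineage x))"
    unfolding E_eq using edge_inj by (simp add: sum.reindex weight_edge)
  also have "V - {a} = (spine - {a}) \<union> (V - spine)" using spine_subset by (auto simp: spine_def)
  also have "(\<Sum>x\<in>(spine - {a}) \<union> (V - spine). 1 / card (lineage x)) =
    (\<Sum>x\<in>spine - {a}. 1 / card (lineage x)) + (\<Sum>x\<in>V - spine. 1 / card (lineage x))"
    using finite_V finite_subset[OF spine_subset] by (intro sum.union_disjoint) auto
  also have "(\<Sum>x\<in>spine - {a}. 1 / card (lineage x)) = card (spine - {a})"
    by (simp add: lineage_def)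
  also have "real (card (spine - {a})) = real (card spine) - 1"
  proof -
    have "a \<in> spine" by (simp add: spine_def)
    then have "card spine > 0" using finite_subset[OF spine_subset finite_V] by (auto simp: card_gt_0_iff)
    then show ?thesis using \<open>a \<in> spine\<close> by (simp add: of_nat_diff)
  qed
  also have "(\<Sum>x\<in>V - spine. 1 / card (lineage x)) = (\<Sum>x\<in>V - spine. 1 / height x)"
    by (intro sum.cong refl) (simp add: lineage_def)
  finally show ?thesis .
qed

lemma prob_separated_le:
  assumes "markov_jump_process N (configs E) (fire_rate E r) (initial_config E) X" "A \<in> sets N"
    and "AE \<omega> in N. \<omega> \<in> A \<longrightarrow> \<not> same_component (fireproof_forest (V, E) (terminal_state X \<omega>)) a b"
  shows "measure N A \<le> r * (real (card spine) - 1 + (\<Sum>x\<in>V - spine. 1 / height x))"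
  using prob_not_fireproof_le[OF assms(1,2)] assms(3) by (simp add: same_component_iff sum_weight)

lemma prob_same_component_le:
  assumes process: "markov_jump_process N (configs E) (fire_rate E r) (initial_config E) X" "A \<in> sets N"
    and AE: "AE \<omega> in N. \<omega> \<in> A \<longrightarrow> same_component (fireproof_forest (V, E) (terminal_state X \<omega>)) a b"
    and small: "\<And>z. z \<in> V - spine \<Longrightarrow>
      r / 2 * card {x \<in> V - spine. height x \<le> K \<and> z \<in> branch (V - spine) off x} \<le> 1"
  shows "measure N A \<le> exp (- r / 2 *
    (\<Sum>x\<in>{x \<in> V - spine. height x \<le> K}. 1 / height x))"
proof -
  let ?S = "{x \<in> V - spine. height x \<le> K}"
  have sub: "?S \<subseteq> V - {a}" by (auto simp: spine_def)
  then have inj: "inj_on edge ?S" using edge_inj inj_on_subset by blast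
  have "measure N A \<le> exp (- r / 2 * (\<Sum>f\<in>edge ` ?S. weight f))"
  proof (rule prob_fireproof_le[OF process(1) _ _ process(2)])
    show "edge ` ?S \<subseteq> E" using sub by (auto simp: E_eq)
    show "AE \<omega> in N. \<omega> \<in> A \<longrightarrow> (\<forall>e\<in>touching. terminal_state X \<omega> e = Fireproof)"
      using AE by (simp add: same_component_iff)
    fix e assume "e \<in> E"
    then obtain z where z: "z \<in> V - {a}" "e = edge z" by (auto simp: E_eq)
    have eq: "{f \<in> edge ` ?S. e \<in> path f} = edge ` {x \<in> ?S. z \<in> branch (V - spine) off x}"
    proof -
      have "e \<in> path (edge x) \<longleftrightarrow> z \<in> branch (V - spine) off x" if x: "x \<in> ?S" for x
      proof -
        have xV: "x \<in> V - {a}" "x \<notin> spine" using x sub by auto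
        have "edge z \<in> edge ` lineage x \<longleftrightarrow> z \<in> lineage x"
          using inj_on_image_mem_iff[OF edge_inj z(1) lineage_subset[OF xV(1)]] .
        then show ?thesis using xV z by (simp add: path_edge lineage_def)
      qed
      then show ?thesis by auto
    qed
    \<comment> \<open>The crude bound 1 for each weight turns the condition on weights into one on
      cardinalities.\<close>
    have "(\<Sum>f\<in>{f \<in> edge ` ?S. e \<in> path f}. weight f) \<le> (\<Sum>f\<in>{f \<in> edge ` ?S. e \<in> path f}. 1)"
      by (intro sum_mono) (simp add: weight_def divide_simps)
    also have "\<dots> = card {x \<in> ?S. z \<in> branch (V - spine) off x}"
    proof -
      have "card (edge ` {x \<in> ?S. z \<in> branch (V - spine) off x}) = card {x \<in> ?S. z \<in> branch (V - spine) off x}"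
        by (rule card_image, rule inj_on_subset[OF inj]) blast
      then show ?thesis unfolding eq by simp
    qed
    finally have le: "(\<Sum>f\<in>{f \<in> edge ` ?S. e \<in> path f}. weight f) \<le> card {x \<in> ?S. z \<in> branch (V - spine) off x}" .
    have "r / 2 * card {x \<in> ?S. z \<in> branch (V - spine) off x} \<le> 1"
    proof (cases "z \<in> spine")
      case True
      then have empty: "{x \<in> ?S. z \<in> branch (V - spine) off x} = {}"
        using branch_subset[of "V - spine" off] by fastforce
      show ?thesis unfolding empty by simp
    next
      case False
      then show ?thesis using small[of z] z by (simp add: conj_ac)
    qed
    moreover have "r / 2 * (\<Sum>f\<in>{f \<in> edge ` ?S. e \<in> path f}. weight f) \<le> r / 2 * card {x \<in> ?S. z \<in> branch (V - spine) off x}"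
      using le r_gt_0 by (intro mult_left_mono) auto
    ultimately show "r / 2 * (\<Sum>f\<in>{f \<in> edge ` ?S. e \<in> path f}. weight f) \<le> 1" by linarith
  qed
  also have "(\<Sum>f\<in>edge ` ?S. weight f) = (\<Sum>x\<in>?S. 1 / height x)"
  proof -
    have "weight (edge x) = 1 / height x" if "x \<in> ?S" for x
      using weight_edge[of x] that sub by (auto simp: lineage_def)
    then show ?thesis using inj by (simp add: sum.reindex)
  qed
  finally show ?thesis .
qed

end

section \<open>Second moment estimates\<close>

lemma level_roots_free:
  assumes "g \<in> forests W C" "finite W" "W \<inter> C = {}" "j \<ge> 1"
  shows "{x \<in> W. level W g x = j} = {x \<in> W \<union> C. level W g x = j}"
proof -
  have "x \<in> W" if "x \<in> C" "level W g x = j" for x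
  proof (rule ccontr)
    assume "x \<notin> W"
    then show False using that assms(4) by (simp add: branch_root)
  qed
  then show ?thesis by auto
qed

lemma card_branch_pos:
  assumes "finite W" "x \<in> W"
  shows "level W g x > 0"
  using assms by (auto simp: card_gt_0_iff branch_def)

lemma sum_inverse_level:
  assumes "g \<in> forests W C" "finite W" "finite C" "W \<inter> C = {}"
  shows "(\<Sum>x\<in>{x \<in> W. level W g x \<le> K}. 1 / level W g x) =
    (\<Sum>j=1..K. real (generation W C g j) / j)"
proof -
  have "(\<Sum>x\<in>{x \<in> W. level W g x \<le> K}. 1 / level W g x) =
    (\<Sum>j=1..K. \<Sum>x\<in>{x \<in> {x \<in> W. level W g x \<le> K}. level W g x = j}. 1 / level W g x)"
    using assms(2) card_branch_pos[OF assms(2), of _ g]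
    by (intro sum.group[symmetric]) (auto simp: Suc_le_eq)
  also have "\<dots> = (\<Sum>j=1..K. real (generation W C g j) / j)"
  proof (intro sum.cong refl)
    fix j assume j: "j \<in> {1..K}"
    then have "{x \<in> {x \<in> W. level W g x \<le> K}. level W g x = j} = {x \<in> W \<union> C. level W g x = j}"
      using level_roots_free[OF assms(1,2,4), of j] by auto
    then have "(\<Sum>x\<in>{x \<in> {x \<in> W. level W g x \<le> K}. level W g x = j}. 1 / level W g x)
      = (\<Sum>x\<in>{x \<in> W \<union> C. level W g x = j}. 1 / real j)"
      by (intro sum.cong) auto
    then show "(\<Sum>x\<in>{x \<in> {x \<in> W. level W g x \<le> K}. level W g x = j}. 1 / level W g x)
      = real (generation W C g j) / j"
      by (simp add: generation_def)
  qed
  finally show ?thesis .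
qed

lemma branch_ancestor_near_root:
  assumes "g \<in> forests W C" "z \<in> W"
  shows "\<exists>t\<in>branch W g z. g t \<in> C"
  using assms
proof (induction rule: forests_rank_induct)
  case (step z)
  show ?case
  proof (cases "g z \<in> W")
    case True
    then show ?thesis using step branch_step[OF step(1), of g] by auto
  next
    case False
    then show ?thesis using step(1) forests_in[OF assms(1) step(1)] branch_step[OF step(1), of g] by auto
  qed
qed

lemma branch_descendants:
  assumes "g \<in> forests W C" "finite W" "W \<inter> C = {}" "t \<in> branch W g x" "g t \<in> C"
  shows "x \<in> descendants W g (level W g x - 1) t"
proof -
  have t: "t \<in> W" "(x, t) \<in> (parent_rel W g)\<^sup>*" using assms(4) by (auto simp: branch_def)
  then obtain k where k: "x \<in> descendants W g k t" by (auto simp: rtrancl_power descendants_def)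
  then have "x \<in> descendants W g (Suc k) (g t)" using t by (auto simp: descendants_Suc)
  then have "level W g x = Suc k"
    by (rule descendants_card_branch[OF assms(1-3,5)])
  with k show ?thesis by simp
qed

text \<open>What the exponential supermartingale demands of the tree, with all weights replaced by
  1.\<close>

definition spread_out   :: "'v set \<Rightarrow> real \<Rightarrow> nat \<Rightarrow> ('v \<Rightarrow> 'v) \<Rightarrow> bool" where
  "spread_out W r K g \<longleftrightarrow> (\<forall>z\<in>W. r / 2 * card {x \<in> W. level W g x \<le> K \<and> z \<in> branch W g x} \<le> 1)"

context
  fixes W C :: "'v set"
  assumes fin: "finite W" "finite C" and disj: "W \<inter> C = {}" and C: "C \<noteq> {}"
begin

text \<open>Up to level \<open>K\<close>, generation \<open>j\<close> has mean size at most
  \<open>card C + j\<close> and is divided by \<open>j\<close>. Each vertex beyond level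
  \<open>K\<close> contributes at most \<open>1 / K\<close>.\<close>

lemma sum_all_inverse_levels:
  assumes K: "K \<ge> 1"
  shows "(\<Sum>g\<in>forests W C. \<Sum>x\<in>W. 1 / level W g x) \<le>
    (card C * harm K + K + card W / K) * card (forests W C)"
proof -
  have "(\<Sum>x\<in>W. 1 / level W g x) \<le> (\<Sum>j=1..K. real (generation W C g j) / j) + card W / K"
    if g: "g \<in> forests W C" for g
  proof -
    have "(\<Sum>x\<in>W. 1 / level W g x) =
       (\<Sum>x\<in>{x \<in> W. level W g x \<le> K} \<union> {x \<in> W. \<not> level W g x \<le> K}. 1 / level W g x)"
      by (intro sum.cong) auto
    also have "\<dots> = (\<Sum>j=1..K. real (generation W C g j) / j) +
       (\<Sum>x\<in>{x \<in> W. \<not> level W g x \<le> K}. 1 / level W g x)"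
      using fin sum_inverse_level[OF g fin disj, of K] by (subst sum.union_disjoint) auto
    also have "(\<Sum>x\<in>{x \<in> W. \<not> level W g x \<le> K}. 1 / level W g x)
       \<le> (\<Sum>x\<in>{x \<in> W. \<not> level W g x \<le> K}. 1 / K)"
      using K by (intro sum_mono divide_left_mono) auto
    also have "\<dots> \<le> (\<Sum>x\<in>W. 1 / K)"
      using fin by (intro sum_mono2) auto
    finally show ?thesis by simp
  qed
  then have "(\<Sum>g\<in>forests W C. \<Sum>x\<in>W. 1 / level W g x) \<le>
    (\<Sum>g\<in>forests W C. (\<Sum>j=1..K. real (generation W C g j) / j) + card W / K)"
    by (rule sum_mono)
  also have "\<dots> = (\<Sum>j=1..K. (\<Sum>g\<in>forests W C. real (generation W C g j)) / j) + card W / K * card (forests W C)"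
    by (simp add: sum.distrib sum.swap[of _ "forests W C"] sum_divide_distrib)
  also have "(\<Sum>j=1..K. (\<Sum>g\<in>forests W C. real (generation W C g j)) / j)
     \<le> (\<Sum>j=1..K. (card C + j) * card (forests W C) / j)"
    using sum_generation_le[OF fin disj C] by (intro sum_mono divide_right_mono) auto
  also have "\<dots> = (card C * harm K + K) * card (forests W C)"
  proof -
    have "(card C + j) * card (forests W C) / j = card (forests W C) * (card C * inverse (real j) + 1)" if "j \<in> {1..K}" for j :: nat
      using that by (simp add: field_simps)
    then have "(\<Sum>j=1..K. (card C + j) * card (forests W C) / j) =
      (\<Sum>j=1..K. card (forests W C) * (card C * inverse (real j) + 1))"
      by (intro sum.cong) auto
    also have "\<dots> = (card C * harm K + K) * card (forests W C)"
      by (simp add: harm_def sum.distrib sum_distrib_left[symmetric])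
    finally show ?thesis .
  qed
  finally show ?thesis by (simp add: distrib_right)
qed

abbreviation branch_square :: "nat \<Rightarrow> ('v \<Rightarrow> 'v) \<Rightarrow> real" where
  "branch_square k g \<equiv> \<Sum>x\<in>{x \<in> W. g x \<in> C}. real (card (descendants W g k x)) ^ 2"

text \<open>If \<open>z\<close> carries more than \<open>2 / r\<close> vertices, then by pigeonhole
  more than \<open>2 / (r * K)\<close> of them share a level \<open>j\<close>. All of these are
  descendants, \<open>j - 1\<close> generations down, of the ancestor \<open>t\<close> of
  \<open>z\<close> next to a root, so the term of \<open>t\<close> alone makes
  \<open>branch_square (j - 1)\<close> large.\<close>

lemma not_spread_out:
  assumes g: "g \<in> forests W C" and "\<not> spread_out W r K g" and r: "r > 0" and K: "K \<ge> 1"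
  shows "\<exists>j\<in>{1..K}. 1 \<le> (r * K) ^ 2 / 4 * branch_square (j - 1) g"
proof -
    obtain z where z: "z \<in> W" "r / 2 * card {x \<in> W. level W g x \<le> K \<and> z \<in> branch W g x} > 1"
    using assms(2) by (auto simp: spread_out_def not_le)
  let ?A = "\<lambda>j. {x \<in> W. level W g x = j \<and> z \<in> branch W g x}"
  have "{x \<in> W. level W g x \<le> K \<and> z \<in> branch W g x} = (\<Union>j\<in>{1..K}. ?A j)"
    using card_branch_pos[OF fin(1), of _ g] by (auto simp: Suc_le_eq)
  then have "card {x \<in> W. level W g x \<le> K \<and> z \<in> branch W g x} \<le> (\<Sum>j=1..K. card (?A j))"
    using card_UN_le[of "{1..K}" ?A] by simp
  then have "r / 2 * card {x \<in> W. level W g x \<le> K \<and> z \<in> branch W g x} \<le> r / 2 * real (\<Sum>j=1..K. card (?A j))"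
    using r by (intro mult_left_mono of_nat_mono) auto
  then have *: "1 < (\<Sum>j=1..K. r / 2 * card (?A j))"
    using z(2) by (simp add: sum_distrib_left)
  have "\<exists>j\<in>{1..K}. 1 / K < r / 2 * card (?A j)"
  proof (rule ccontr)
    assume "\<not> ?thesis"
    then have "(\<Sum>j=1..K. r / 2 * card (?A j)) \<le> (\<Sum>j=1..K. 1 / K)"
      by (intro sum_mono) (auto simp: not_less)
    then show False using * K by simp
  qed
  then obtain j where j: "j \<in> {1..K}" "1 / K < r / 2 * card (?A j)" by blast
  obtain t where t: "t \<in> branch W g z" "g t \<in> C" using branch_ancestor_near_root[OF g z(1)] by blast
  then have tW: "t \<in> W" by (simp add: branch_def)
  have "?A j \<subseteq> descendants W g (j - 1) t"
  proof
    fix x assume x: "x \<in> ?A j"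
    then have "t \<in> branch W g x" using branch_trans[of z W g x] t(1) by auto
    then show "x \<in> descendants W g (j - 1) t"
      using branch_descendants[OF g fin(1) disj _ t(2)] x by auto
  qed
  then have "card (?A j) \<le> card (descendants W g (j - 1) t)"
    using fin by (intro card_mono) auto
  then have "r / 2 * card (?A j) \<le> r / 2 * card (descendants W g (j - 1) t)"
    using r by (intro mult_left_mono) auto
  with j(2) have "1 / K \<le> r / 2 * card (descendants W g (j - 1) t)" by simp
  then have "1 \<le> r * K / 2 * card (descendants W g (j - 1) t)" using K by (simp add: field_simps)
  then have "1 \<le> (r * K / 2 * card (descendants W g (j - 1) t)) ^ 2" by simp
  also have "\<dots> = (r * K) ^ 2 / 4 * real (card (descendants W g (j - 1) t)) ^ 2"
    by (simp add: power_mult_distrib power_divide)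
  also have "\<dots> \<le> (r * K) ^ 2 / 4 * branch_square (j - 1) g"
    using fin t(2) tW by (intro mult_left_mono member_le_sum) auto
  finally show ?thesis using j(1) by blast
qed

text \<open>A forest is bad if it is not spread out or if some generation up to \<open>K\<close> is
  smaller than \<open>card C / 2\<close>. Good forests have a sum of inverse levels of at least
  \<open>card C / 2 * harm K\<close>. On bad ones the left side is at most 1 and one of the
  Chebyshev terms collected in \<open>?S\<close> is at least 1.\<close>

lemma sum_same_component_bound:
  fixes r :: real
  assumes r: "r > 0" and K: "K \<ge> 1" "K \<le> card C"
  shows "(\<Sum>g\<in>forests W C. if spread_out W r K g
      then exp (- r / 2 * (\<Sum>x\<in>{x \<in> W. level W g x \<le> K}. 1 / level W g x)) else 1)
    \<le> (exp (- r * card C * harm K / 4) +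
        K * (12 * real K / card C + 32 * real K * card C / (card W + card C) + 3 / 4 * r ^ 2 * real K ^ 3 * card C)) * card (forests W C)"
proof -
  let ?c = "card C" and ?n = "card W + card C" and ?f = "card (forests W C)"
  let ?G = "\<lambda>g j. (real (generation W C g j) - ?c) ^ 2"
  have c: "real ?c > 0" using K by auto
  have n: "real ?n > 0" using c by auto
  have const: "a * f + (\<Sum>j=1..K. z * f) = (a + K * z) * f" for a z f :: real
    by (simp add: distrib_right)
  have alg: "4 / c ^ 2 * ((3 * k * c + 8 * c ^ 3 * k / N) * f) = (12 * k / c + 32 * k * c / N) * f"
    if "c > 0" "N > 0" for c k N f :: real
    using that by (simp add: field_simps power2_eq_square power3_eq_cube)
  let ?S = "\<lambda>g. \<Sum>j=1..K. 4 / ?c ^ 2 * ?G g j + (r * K) ^ 2 / 4 * branch_square (j - 1) g"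
  have term_nonneg: "0 \<le> 4 / ?c ^ 2 * ?G g j + (r * K) ^ 2 / 4 * branch_square (j - 1) g" for g j
    by (intro add_nonneg_nonneg mult_nonneg_nonneg sum_nonneg) auto
  have S_nonneg: "0 \<le> ?S g" for g by (intro sum_nonneg term_nonneg)
  have S_ge: "4 / ?c ^ 2 * ?G g j + (r * K) ^ 2 / 4 * branch_square (j - 1) g \<le> ?S g" if "j \<in> {1..K}" for g j
    using that by (intro member_le_sum[of j "{1..K}"] term_nonneg) auto
  have "(if spread_out W r K g
      then exp (- r / 2 * (\<Sum>x\<in>{x \<in> W. level W g x \<le> K}. 1 / level W g x)) else 1)
    \<le> exp (- r * ?c * harm K / 4) + ?S g" if g: "g \<in> forests W C" for g
  proof (cases "spread_out W r K g \<and> (\<forall>j\<in>{1..K}. ?c / 2 \<le> generation W C g j)")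
    case True
    have harm: "(\<Sum>j=1..K. (real ?c / 2) / j) = real ?c / 2 * harm K"
      unfolding harm_def sum_distrib_left by (intro sum.cong refl) (rule divide_inverse)
    have "(\<Sum>j=1..K. (real ?c / 2) / j) \<le> (\<Sum>j=1..K. real (generation W C g j) / j)"
      using True by (intro sum_mono divide_right_mono) auto
    then have "?c / 2 * harm K \<le> (\<Sum>x\<in>{x \<in> W. level W g x \<le> K}. 1 / level W g x)"
      unfolding sum_inverse_level[OF g fin disj] harm .
    then have "r / 2 * (?c / 2 * harm K) \<le> r / 2 * (\<Sum>x\<in>{x \<in> W. level W g x \<le> K}. 1 / level W g x)"
      using r by (intro mult_left_mono) auto
    then have "exp (- r / 2 * (\<Sum>x\<in>{x \<in> W. level W g x \<le> K}. 1 / level W g x))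
        \<le> exp (- r * ?c * harm K / 4)"
      by simp
    then show ?thesis
      using True S_nonneg[of g] by (simp only: if_True)
  next
    case False
    have "1 \<le> ?S g"
    proof (cases "spread_out W r K g")
      case True
      with False obtain j where j: "j \<in> {1..K}" "real (generation W C g j) < ?c / 2" by (auto simp: not_le)
      then have "(?c / 2) ^ 2 \<le> (?c - real (generation W C g j)) ^ 2" by (intro power_mono) auto
      then have "4 / ?c ^ 2 * (?c / 2) ^ 2 \<le> 4 / ?c ^ 2 * ?G g j"
        by (intro mult_left_mono) (auto simp: power2_commute)
      then have "1 \<le> 4 / ?c ^ 2 * ?G g j" using c by (simp add: power_divide)
      moreover have "0 \<le> (r * K) ^ 2 / 4 * branch_square (j - 1) g"
        by (intro mult_nonneg_nonneg sum_nonneg) auto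
      ultimately show ?thesis using S_ge[OF j(1), of g] by linarith
    next
      case False
      obtain j where j: "j \<in> {1..K}" "1 \<le> (r * K) ^ 2 / 4 * branch_square (j - 1) g"
        using not_spread_out[OF g False r K(1)] by blast
      moreover have "0 \<le> 4 / ?c ^ 2 * ?G g j" by simp
      ultimately show ?thesis using S_ge[OF j(1), of g] by linarith
    qed
    moreover have "(if spread_out W r K g
      then exp (- r / 2 * (\<Sum>x\<in>{x \<in> W. level W g x \<le> K}. 1 / level W g x)) else 1) \<le> 1"
      using r by (auto intro!: mult_nonneg_nonneg sum_nonneg)
    ultimately show ?thesis using exp_gt_zero[of "- r * ?c * harm K / 4"] by linarith
  qed
  then have "(\<Sum>g\<in>forests W C. if spread_out W r K g
      then exp (- r / 2 * (\<Sum>x\<in>{x \<in> W. level W g x \<le> K}. 1 / level W g x)) else 1)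
    \<le> (\<Sum>g\<in>forests W C. exp (- r * ?c * harm K / 4) + ?S g)"
    by (rule sum_mono)
  also have "\<dots> = exp (- r * ?c * harm K / 4) * ?f +
    (\<Sum>j=1..K. 4 / ?c ^ 2 * (\<Sum>g\<in>forests W C. ?G g j) + (r * K) ^ 2 / 4 * (\<Sum>g\<in>forests W C. branch_square (j - 1) g))"
    by (simp add: sum.distrib sum.swap[of _ "forests W C"] sum_distrib_left del: power_mult_distrib)
  also have "(\<Sum>j=1..K. 4 / ?c ^ 2 * (\<Sum>g\<in>forests W C. ?G g j) + (r * K) ^ 2 / 4 * (\<Sum>g\<in>forests W C. branch_square (j - 1) g))
    \<le> (\<Sum>j=1..K. (12 * K / ?c + 32 * K * ?c / ?n + 3 / 4 * r ^ 2 * K ^ 3 * ?c) * ?f)"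
  proof (rule sum_mono)
    fix j assume j: "j \<in> {1..K}"
    then have jc: "real j \<le> K" "real j \<le> ?c" "real K \<le> ?c" "real j \<ge> 1" using K by auto
    have "(\<Sum>g\<in>forests W C. ?G g j) \<le> (j * ?c + 2 * j ^ 2 + 2 * ?c * j * real (?c + j) ^ 2 / ?n) * ?f"
      by (rule sum_generation_variance[OF fin disj C])
    \<comment> \<open>As \<open>j \<le> K \<le> card C\<close>, both
      \<open>j ^ 2 \<le> K * card C\<close> and \<open>(card C + j) ^ 2 \<le> 4 * card C ^ 2\<close>
      hold.\<close>
    also have "\<dots> \<le> (3 * K * ?c + 8 * ?c ^ 3 * K / ?n) * ?f"
    proof (intro mult_right_mono)
      have "j * real ?c + 2 * real j ^ 2 \<le> real K * ?c + 2 * (real K * ?c)"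
        using jc by (intro add_mono mult_mono mult_left_mono) (auto simp: power2_eq_square intro!: mult_mono)
      moreover have "2 * ?c * j * real (?c + j) ^ 2 \<le> 2 * ?c * K * (2 * real ?c) ^ 2"
        using jc by (intro mult_mono power_mono) auto
      then have "2 * ?c * j * real (?c + j) ^ 2 / ?n \<le> 8 * ?c ^ 3 * K / ?n"
        using n by (intro divide_right_mono) (auto simp: power2_eq_square power3_eq_cube)
      ultimately show "j * ?c + 2 * j ^ 2 + 2 * ?c * j * real (?c + j) ^ 2 / ?n \<le> 3 * K * ?c + 8 * ?c ^ 3 * K / ?n"
        by simp
    qed simp
    finally have "4 / ?c ^ 2 * (\<Sum>g\<in>forests W C. ?G g j) \<le> 4 / ?c ^ 2 * ((3 * K * ?c + 8 * ?c ^ 3 * K / ?n) * ?f)"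
      by (intro mult_left_mono) auto
    also have "\<dots> = (12 * K / ?c + 32 * K * ?c / ?n) * ?f"
      using alg[OF c n, of K "real ?f"] by simp
    finally have 1: "4 / ?c ^ 2 * (\<Sum>g\<in>forests W C. ?G g j) \<le> (12 * K / ?c + 32 * K * ?c / ?n) * ?f" .
    have "(\<Sum>g\<in>forests W C. branch_square (j - 1) g) \<le> real ((j - 1 + 1) * (?c + 2 * (j - 1) + 1)) * ?f"
      by (rule sum_branch_population_square[OF fin disj C])
    also have "\<dots> \<le> (real K * (3 * ?c)) * ?f"
    proof (intro mult_right_mono)
      have "j * (?c + 2 * (j - 1) + 1) \<le> K * (3 * ?c)" using j K by (intro mult_mono) auto
      then have "real (j * (?c + 2 * (j - 1) + 1)) \<le> real (K * (3 * ?c))" by (rule of_nat_mono)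
      then show "real ((j - 1 + 1) * (?c + 2 * (j - 1) + 1)) \<le> real K * (3 * ?c)" using j by simp
    qed simp
    finally have "(r * K) ^ 2 / 4 * (\<Sum>g\<in>forests W C. branch_square (j - 1) g) \<le> (r * K) ^ 2 / 4 * (real K * (3 * ?c) * ?f)"
      by (intro mult_left_mono) auto
    also have "\<dots> = (3 / 4 * r ^ 2 * K ^ 3 * ?c) * ?f"
      by (simp add: power2_eq_square power3_eq_cube)
    finally show "4 / ?c ^ 2 * (\<Sum>g\<in>forests W C. ?G g j) + (r * K) ^ 2 / 4 * (\<Sum>g\<in>forests W C. branch_square (j - 1) g)
      \<le> (12 * K / ?c + 32 * K * ?c / ?n + 3 / 4 * r ^ 2 * K ^ 3 * ?c) * ?f"
      using 1 by (simp add: distrib_right)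
  qed
  finally show ?thesis by (simp only: const of_nat_mult of_nat_power of_nat_numeral)
qed

end

section \<open>Averaging over the tree and the vertices\<close>

text \<open>At most \<open>eps * sqrt n\<close> values of \<open>k\<close> qualify, and each has
  weight at most \<open>eps / sqrt n\<close>.\<close>

lemma spine_small: "eps \<ge> 0 \<Longrightarrow> n > 0 \<Longrightarrow>
  (\<Sum>k<n. spine_weight n k * of_bool (real (Suc k) \<le> eps * sqrt n)) \<le> eps ^ 2"
proof -
  assume eps: "eps \<ge> 0" and n: "n > 0"
  have "(\<Sum>k<n. spine_weight n k * of_bool (real (Suc k) \<le> eps * sqrt n))
    \<le> (\<Sum>k<n. eps / sqrt n * of_bool (real (Suc k) \<le> eps * sqrt n))"
  proof (rule sum_mono)
    fix k assume "k \<in> {..<n}"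
    then have k: "k \<le> n" by simp
    show "spine_weight n k * of_bool (real (Suc k) \<le> eps * sqrt n)
      \<le> eps / sqrt n * of_bool (real (Suc k) \<le> eps * sqrt n)"
    proof (cases "real (Suc k) \<le> eps * sqrt n")
      case True
      have "spine_weight n k \<le> real (Suc k) / n" by (rule spine_weight_le[OF k])
      also have "\<dots> \<le> eps * sqrt n / n" using True by (intro divide_right_mono) auto
      also have "\<dots> = eps / sqrt n" using n by (simp add: field_simps)
      finally show ?thesis using True by simp
    qed simp
  qed
  also have "\<dots> = eps / sqrt n * card {k. k < n \<and> real (Suc k) \<le> eps * sqrt n}"
  proof -
    have "(\<Sum>k<n. of_bool (real (Suc k) \<le> eps * sqrt n)) = real (card {k. k < n \<and> real (Suc k) \<le> eps * sqrt n})"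
      by (simp add: sum_of_bool_eq lessThan_def Collect_conj_eq del: of_nat_Suc)
    then show ?thesis by (simp only: sum_distrib_left[symmetric])
  qed
  also have "\<dots> \<le> eps / sqrt n * (eps * sqrt n)"
    using eps by (intro mult_left_mono card_Suc_le_real) auto
  also have "\<dots> = eps ^ 2" using n by (simp add: power2_eq_square)
  finally show ?thesis .
qed

text \<open>Markov's inequality for the spine size, whose mean is at most
  \<open>2 * sqrt n\<close>.\<close>

lemma spine_large:
  assumes "B > 0" "n > 0"
  shows "(\<Sum>k<n. spine_weight n k * of_bool (B * sqrt n \<le> real (Suc k))) \<le> 2 / B"
proof -
  have "(\<Sum>k<n. spine_weight n k * of_bool (B * sqrt n \<le> real (Suc k)))
    \<le> (\<Sum>k<n. real (Suc k) * spine_weight n k / (B * sqrt n))"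
  proof (rule sum_mono)
    fix k assume "k \<in> {..<n}"
    then have w: "spine_weight n k \<ge> 0" by (intro spine_weight_nonneg) auto
    show "spine_weight n k * of_bool (B * sqrt n \<le> real (Suc k)) \<le> real (Suc k) * spine_weight n k / (B * sqrt n)"
    proof (cases "B * sqrt n \<le> real (Suc k)")
      case True
      then have "1 \<le> real (Suc k) / (B * sqrt n)" using assms by simp
      then show ?thesis using True w mult_left_mono[of 1 "real (Suc k) / (B * sqrt n)" "spine_weight n k"]
        by (simp add: mult_ac)
    qed (use w assms in simp)
  qed
  also have "\<dots> = (\<Sum>k<n. real (Suc k) * spine_weight n k) / (B * sqrt n)"
    by (simp only: sum_divide_distrib)
  also have "\<dots> \<le> 2 * sqrt n / (B * sqrt n)"
    using assms by (intro divide_right_mono mean_spine_size) auto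
  finally show ?thesis using assms by simp
qed

lemma measure_eq_sum_partition:
  assumes "finite_measure M" "finite I" "\<And>i. i \<in> I \<Longrightarrow> A i \<in> sets M" "disjoint_family_on A I"
    "A0 = (\<Union>i\<in>I. A i)"
  shows "measure M A0 = (\<Sum>i\<in>I. measure M (A i))"
  using finite_measure.finite_measure_finite_Union[OF assms(1,2) _ assms(4)] assms(3,5) by auto

context fire_on_cayley_tree
begin

abbreviation forest_of :: "'a \<Rightarrow> nat graph" where
  "forest_of \<omega> \<equiv> fireproof_forest ({1..n}, T \<omega>) (terminal_state X \<omega>)"

abbreviation tree_event :: "nat set set \<Rightarrow> 'a set" where
  "tree_event E \<equiv> {\<omega> \<in> space M. T \<omega> = E}"

abbreviation joined :: "nat \<Rightarrow> nat \<Rightarrow> 'a set" where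
  "joined a b \<equiv> {\<omega> \<in> space M. same_component (forest_of \<omega>) a b}"

abbreviation joined_sample :: "'a set" where
  "joined_sample \<equiv> {\<omega> \<in> space M. same_component (forest_of \<omega>) (U \<omega>) (U' \<omega>)}"

abbreviation cond_measure :: "nat set set \<Rightarrow> 'a measure" where
  "cond_measure E \<equiv> uniform_measure M (tree_event E)"

abbreviation cond_joined :: "nat set set \<Rightarrow> nat \<Rightarrow> nat \<Rightarrow> real" where
  "cond_joined E a b \<equiv> measure (cond_measure E) (joined a b)"

text \<open>Measurability comes from the independence hypothesis: \<open>indep_set\<close> includes
  that both families consist of events.\<close>

lemma forest_events: "{\<omega> \<in> space M. P (forest_of \<omega>)} \<in> sets M"
proof -
  have "{(\<lambda>\<omega>. forest_of \<omega>) -` A \<inter> space M | A. True} \<subseteq> sets M"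
    using forest_indep by (rule indep_setD_ev1)
  then have "(\<lambda>\<omega>. forest_of \<omega>) -` {G. P G} \<inter> space M \<in> sets M" by blast
  then show ?thesis by (simp add: vimage_def Int_def conj_commute)
qed

lemma finite_cayley_trees:
  assumes "n \<ge> 1"
  shows "finite (cayley_trees n)" "cayley_trees n \<noteq> {}"
proof -
  have "finite (forests ({1..n} - {1}) {1})" by simp
  then show "finite (cayley_trees n)"
    using bij_betw_finite[OF bij_betw_cayley_trees[of 1 n]] assms by auto
  obtain \<omega> where "\<omega> \<in> space M" using not_empty by blast
  then show "cayley_trees n \<noteq> {}"
    using measurable_space[OF tree_measurable] by auto
qed

lemma prob_tree:
  assumes "n \<ge> 1" "E \<in> cayley_trees n"
  shows "prob (tree_event E) = 1 / card (cayley_trees n)" "tree_event E \<in> sets M"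
proof -
  have eq: "T -` {E} \<inter> space M = tree_event E" by auto
  have "{E} \<in> sets (count_space (cayley_trees n))" using assms by auto
  from measurable_sets[OF tree_measurable this] show "tree_event E \<in> sets M"
    by (simp add: eq)
  have "prob (tree_event E) = measure (distr M (count_space (cayley_trees n)) T) {E}"
    using assms by (subst measure_distr[OF tree_measurable]) (auto simp: eq)
  also have "\<dots> = 1 / card (cayley_trees n)"
    unfolding tree_uniform using assms finite_cayley_trees[OF assms(1)]
    by (simp add: measure_uniform_count_measure)
  finally show "prob (tree_event E) = 1 / card (cayley_trees n)" .
qed

lemma prob_vertex_pair:
  assumes "n \<ge> 1" "a \<in> {1..n}" "b \<in> {1..n}"
  shows "prob {\<omega> \<in> space M. U \<omega> = a \<and> U' \<omega> = b} = 1 / n ^ 2"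
proof -
  have one: "prob (Y -` {c} \<inter> space M) = 1 / n"
    if "Y \<in> measurable M (count_space {1..n})" "distr M (count_space {1..n}) Y = uniform_count_measure {1..n}" "c \<in> {1..n}"
    for Y c
  proof -
    have "prob (Y -` {c} \<inter> space M) = measure (distr M (count_space {1..n}) Y) {c}"
      using that by (subst measure_distr) auto
    also have "\<dots> = 1 / n" unfolding that(2) using that(3) by (simp add: measure_uniform_count_measure)
    finally show ?thesis .
  qed
  have "prob ((\<lambda>\<omega>. (U \<omega>, U' \<omega>)) -` ({a} \<times> {b}) \<inter> space M) = prob (U -` {a} \<inter> space M) * prob (U' -` {b} \<inter> space M)"
    by (rule indep_varD[OF U_U'_indep]) (use assms in auto)
  also have "(\<lambda>\<omega>. (U \<omega>, U' \<omega>)) -` ({a} \<times> {b}) \<inter> space M = {\<omega> \<in> space M. U \<omega> = a \<and> U' \<omega> = b}" by auto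
  finally show ?thesis
    using one[OF U_measurable U_uniform assms(2)] one[OF U'_measurable U'_uniform assms(3)]
    by (simp add: power2_eq_square)
qed

text \<open>Total probability, first over the pair of vertices, which is independent of the forest,
  and then over the tree. The sum over \<open>a\<close> is outermost so that each tree can
  afterwards be rooted at \<open>a\<close>.\<close>

lemma prob_same_component:
  assumes n: "n \<ge> 1"
  shows "prob joined_sample =
    (\<Sum>a\<in>{1..n}. \<Sum>E\<in>cayley_trees n. \<Sum>b\<in>{1..n}.
      cond_joined E a b) / (n ^ 2 * card (cayley_trees n))"
proof -
  let ?U = "\<lambda>a b. {\<omega> \<in> space M. U \<omega> = a \<and> U' \<omega> = b}"
  have ind: "prob (joined a b \<inter> ?U c d) = prob (joined a b) * prob (?U c d)" for a b c d
  proof (rule indep_setD[OF forest_indep])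
    show "joined a b \<in> {(\<lambda>\<omega>. forest_of \<omega>) -` A \<inter> space M | A. True}"
      by (rule CollectI, rule exI[of _ "{G. same_component G a b}"]) auto
    show "?U c d \<in> {(\<lambda>\<omega>. (U \<omega>, U' \<omega>)) -` B \<inter> space M | B. True}"
      by (rule CollectI, rule exI[of _ "{(c, d)}"]) auto
  qed
  have meas: "?U a b \<in> sets M" for a b
  proof -
    have "{(\<lambda>\<omega>. (U \<omega>, U' \<omega>)) -` B \<inter> space M | B. True} \<subseteq> sets M"
      using forest_indep by (rule indep_setD_ev2)
    then have "(\<lambda>\<omega>. (U \<omega>, U' \<omega>)) -` {(a, b)} \<inter> space M \<in> sets M" by blast
    moreover have "(\<lambda>\<omega>. (U \<omega>, U' \<omega>)) -` {(a, b)} \<inter> space M = ?U a b" by auto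
    ultimately show ?thesis by simp
  qed
  have in_n: "U \<omega> \<in> {1..n}" "U' \<omega> \<in> {1..n}" if "\<omega> \<in> space M" for \<omega>
    using measurable_space[OF U_measurable that] measurable_space[OF U'_measurable that] by auto
  have cond: "prob (joined a b) = (\<Sum>E\<in>cayley_trees n. cond_joined E a b) / card (cayley_trees n)" for a b
  proof -
    have "prob (joined a b) = (\<Sum>E\<in>cayley_trees n. prob (tree_event E \<inter> joined a b))"
    proof (rule measure_eq_sum_partition)
      show "finite_measure M" by (rule finite_measure_axioms)
      show "joined a b = (\<Union>E\<in>cayley_trees n. tree_event E \<inter> joined a b)"
        using measurable_space[OF tree_measurable] by auto
      show "tree_event E \<inter> joined a b \<in> sets M" if "E \<in> cayley_trees n" for E
        using prob_tree(2)[OF n that] forest_events by (rule sets.Int)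
    qed (use finite_cayley_trees[OF n] in \<open>auto simp: disjoint_family_on_def\<close>)
    also have "\<dots> = (\<Sum>E\<in>cayley_trees n. cond_joined E a b / card (cayley_trees n))"
    proof (rule sum.cong[OF refl])
      fix E assume E: "E \<in> cayley_trees n"
      have pos: "prob (tree_event E) = 1 / card (cayley_trees n)" by (rule prob_tree(1)[OF n E])
      have c: "card (cayley_trees n) > 0" using finite_cayley_trees[OF n] by (simp add: card_gt_0_iff)
      have "cond_joined E a b = prob (tree_event E \<inter> joined a b) / prob (tree_event E)"
        using pos c by (intro measure_uniform_measure forest_events) (auto simp: emeasure_eq_measure)
      then show "prob (tree_event E \<inter> joined a b) = cond_joined E a b / card (cayley_trees n)"
        unfolding pos using c by simp
    qed
    finally show ?thesis by (simp only: sum_divide_distrib)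
  qed
  have "prob joined_sample =
    (\<Sum>ab\<in>{1..n} \<times> {1..n}. prob (joined (fst ab) (snd ab) \<inter> ?U (fst ab) (snd ab)))"
  proof (rule measure_eq_sum_partition)
    show "finite_measure M" by (rule finite_measure_axioms)
    show "joined (fst ab) (snd ab) \<inter> ?U (fst ab) (snd ab) \<in> sets M" for ab
      using forest_events meas by (rule sets.Int)
    show "joined_sample =
      (\<Union>ab\<in>{1..n} \<times> {1..n}. joined (fst ab) (snd ab) \<inter> ?U (fst ab) (snd ab))"
      using in_n by fastforce
  qed (auto simp: disjoint_family_on_def)
  also have "\<dots> = (\<Sum>ab\<in>{1..n} \<times> {1..n}. prob (joined (fst ab) (snd ab)) / n ^ 2)"
    unfolding ind using n by (intro sum.cong refl) (auto simp: prob_vertex_pair)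
  also have "\<dots> = (\<Sum>a\<in>{1..n}. \<Sum>b\<in>{1..n}. prob (joined a b) / n ^ 2)"
    by (simp add: sum.cartesian_product case_prod_beta)
  also have "\<dots> = (\<Sum>a\<in>{1..n}. \<Sum>b\<in>{1..n}. \<Sum>E\<in>cayley_trees n. cond_joined E a b) / (n ^ 2 * card (cayley_trees n))"
    unfolding cond by (simp add: sum_divide_distrib mult.commute)
  finally show ?thesis by (subst (asm) sum.swap[of _ "cayley_trees n"]) simp
qed

abbreviation rooted_trees :: "nat \<Rightarrow> (nat \<Rightarrow> nat) set" where
  "rooted_trees a \<equiv> forests ({1..n} - {a}) {a}"

abbreviation joined_prob :: "nat \<Rightarrow> (nat \<Rightarrow> nat) \<Rightarrow> nat \<Rightarrow> real" where
  "joined_prob a g b \<equiv> cond_joined (parent_edges ({1..n} - {a}) g) a b"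

text \<open>The spine decomposition starts from a tree rooted at one end of the spine, so for each
  \<open>a\<close> trees are exchanged for parent functions with root \<open>a\<close>. Their number
  is the number of trees, whatever \<open>a\<close> is.\<close>

lemma prob_same_component_average:
  assumes n: "n \<ge> 1"
  shows "prob joined_sample =
    (\<Sum>a\<in>{1..n}. (\<Sum>g\<in>rooted_trees a. \<Sum>b\<in>{1..n}. joined_prob a g b) / (n * card (rooted_trees a))) / n"
proof -
  have "(\<Sum>g\<in>rooted_trees a. \<Sum>b\<in>{1..n}. joined_prob a g b) / (n * card (rooted_trees a)) =
      (\<Sum>E\<in>cayley_trees n. \<Sum>b\<in>{1..n}. cond_joined E a b) / (n * card (cayley_trees n))"
    if a: "a \<in> {1..n}" for a
    by (simp only: sum.reindex_bij_betw[OF bij_betw_cayley_trees[OF a], symmetric]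
        bij_betw_same_card[OF bij_betw_cayley_trees[OF a]])
  then show ?thesis
    unfolding prob_same_component[OF n] by (simp add: sum_divide_distrib power2_eq_square mult_ac)
qed

lemma card_rooted_trees_pos:
  assumes "n \<ge> 1" "a \<in> {1..n}"
  shows "card (rooted_trees a) > 0"
  using bij_betw_same_card[OF bij_betw_cayley_trees[OF assms(2)]] finite_cayley_trees[OF assms(1)]
  by (simp add: card_gt_0_iff)

lemma prob_same_component_le_average:
  fixes s :: real
  assumes n: "n \<ge> 1"
    and le: "\<And>a. a \<in> {1..n} \<Longrightarrow>
      (\<Sum>g\<in>rooted_trees a. \<Sum>b\<in>{1..n}. joined_prob a g b) \<le> s * (n * card (rooted_trees a))"
  shows "prob joined_sample \<le> s"
proof -
  have "prob joined_sample \<le> (\<Sum>a\<in>{1..n}. s) / n"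
    unfolding prob_same_component_average[OF n]
  proof (intro divide_right_mono sum_mono)
    fix a assume a: "a \<in> {1..n}"
    have "real (n * card (rooted_trees a)) > 0" using card_rooted_trees_pos[OF n a] n by simp
    then show "(\<Sum>g\<in>rooted_trees a. \<Sum>b\<in>{1..n}. joined_prob a g b) / (n * card (rooted_trees a)) \<le> s"
      using le[OF a] by (simp only: pos_divide_le_eq)
  qed simp
  then show ?thesis using n by simp
qed

lemma prob_same_component_ge_average:
  fixes s :: real
  assumes n: "n \<ge> 1"
    and le: "\<And>a. a \<in> {1..n} \<Longrightarrow>
      (\<Sum>g\<in>rooted_trees a. \<Sum>b\<in>{1..n}. 1 - joined_prob a g b) \<le> s * (n * card (rooted_trees a))"
  shows "1 - s \<le> prob joined_sample"
proof -
  have "(\<Sum>a\<in>{1..n}. 1 - s) / n \<le> prob joined_sample"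
    unfolding prob_same_component_average[OF n]
  proof (intro divide_right_mono sum_mono)
    fix a assume a: "a \<in> {1..n}"
    let ?N = "real (n * card (rooted_trees a))"
    have "?N > 0" using card_rooted_trees_pos[OF n a] n by simp
    moreover have "?N - (\<Sum>g\<in>rooted_trees a. \<Sum>b\<in>{1..n}. joined_prob a g b) \<le> s * ?N"
      using le[OF a] by (simp add: sum_subtractf mult.commute)
    then have "(1 - s) * ?N \<le> (\<Sum>g\<in>rooted_trees a. \<Sum>b\<in>{1..n}. joined_prob a g b)"
      by (simp only: left_diff_distrib mult_1_left)
    ultimately show "1 - s \<le> (\<Sum>g\<in>rooted_trees a. \<Sum>b\<in>{1..n}. joined_prob a g b) / ?N"
      by (simp only: pos_le_divide_eq)
  qed simp
  then show ?thesis using n by simp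
qed

end

section \<open>Bounds for a fixed number of vertices\<close>

context fire_on_cayley_tree
begin

context
  fixes a b :: nat and g :: "nat \<Rightarrow> nat" and E C g'
  assumes n: "n \<ge> 1" and r: "r > 0" and a: "a \<in> {1..n}" and b: "b \<in> {1..n}"
    and g: "g \<in> rooted_trees a"
  defines "E \<equiv> parent_edges ({1..n} - {a}) g"
    and "C \<equiv> insert a (branch ({1..n} - {a}) g b)"
    and "g' \<equiv> restrict g ({1..n} - {a} - branch ({1..n} - {a}) g b)"
begin

interpretation rt: rooted_tree "{1..n}" a b g r
  using a b g r by unfold_locales auto

lemma spine_eq: "rt.spine = C"
  unfolding rt.spine_def C_def ..

lemma off_eq: "rt.off = g'"
proof -
  have "{1..n} - C = {1..n} - {a} - branch ({1..n} - {a}) g b" by (auto simp: C_def)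
  then show ?thesis unfolding rt.off_def spine_eq g'_def by (simp only:)
qed

lemma edges_eq: "rt.E = E"
  unfolding rt.E_def E_def ..

lemma E_tree: "E \<in> cayley_trees n"
  unfolding E_def using bij_betw_apply[OF bij_betw_cayley_trees[OF a] g] .

lemma tree_process:
  "markov_jump_process (cond_measure E) (configs rt.E) (fire_rate rt.E r) (initial_config rt.E) X"
  unfolding edges_eq by (rule fire_dynamics[OF E_tree])

lemma tree_forest:
  "AE \<omega> in cond_measure E. forest_of \<omega> = fireproof_forest ({1..n}, rt.E) (terminal_state X \<omega>)"
  unfolding edges_eq by (rule AE_uniform_measureI[OF prob_tree(2)[OF n E_tree]]) auto

text \<open>The right-hand side sees the tree only through the spine \<open>C\<close> and the forest
  \<open>g'\<close> around it, as the spine decomposition requires.\<close>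

lemma joined_prob_le:
  "cond_joined E a b \<le> (if spread_out ({1..n} - C) r K g'
    then exp (- r / 2 * (\<Sum>x\<in>{x \<in> {1..n} - C. level ({1..n} - C) g' x \<le> K}.
      1 / level ({1..n} - C) g' x)) else 1)"
proof -
  interpret N: prob_space "cond_measure E"
    using tree_process by (simp add: markov_jump_process_def)
  show ?thesis
  proof (cases "spread_out ({1..n} - C) r K g'")
    case True
    have "joined a b \<in> sets (cond_measure E)" using forest_events by simp
    moreover have "AE \<omega> in cond_measure E. \<omega> \<in> joined a b \<longrightarrow>
        same_component (fireproof_forest ({1..n}, rt.E) (terminal_state X \<omega>)) a b"
      using tree_forest by eventually_elim auto
    moreover have "r / 2 * card {x \<in> {1..n} - rt.spine. level ({1..n} - rt.spine) rt.off x \<le> K \<and>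
        z \<in> branch ({1..n} - rt.spine) rt.off x} \<le> 1" if "z \<in> {1..n} - rt.spine" for z
      using True that unfolding spread_out_def spine_eq off_eq by blast
    ultimately have "cond_joined E a b
      \<le> exp (- r / 2 * (\<Sum>x\<in>{x \<in> {1..n} - rt.spine. level ({1..n} - rt.spine) rt.off x \<le> K}.
        1 / level ({1..n} - rt.spine) rt.off x))"
      by (rule rt.prob_same_component_le[OF tree_process])
    then show ?thesis using True unfolding spine_eq off_eq by simp
  next
    case False
    then show ?thesis using N.prob_le_1 by (simp only: if_False)
  qed
qed

lemma separated_prob_le:
  "1 - cond_joined E a b \<le>
    r * (real (card C) - 1 + (\<Sum>x\<in>{1..n} - C. 1 / level ({1..n} - C) g' x))"
proof -
  let ?N = "cond_measure E" and ?A = "{\<omega> \<in> space M. \<not> same_component (forest_of \<omega>) a b}"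
  interpret N: prob_space ?N
    using tree_process by (simp add: markov_jump_process_def)
  have "joined a b \<in> sets ?N" using forest_events by simp
  from N.prob_compl[OF this] have "1 - cond_joined E a b = measure ?N (space ?N - joined a b)"
    by simp
  also have "space ?N - joined a b = ?A" by auto
  also have "measure ?N ?A \<le> r * (real (card rt.spine) - 1 +
      (\<Sum>x\<in>{1..n} - rt.spine. 1 / level ({1..n} - rt.spine) rt.off x))"
  proof (rule rt.prob_separated_le[OF tree_process])
    show "?A \<in> sets ?N" using forest_events by simp
    show "AE \<omega> in ?N. \<omega> \<in> ?A \<longrightarrow>
        \<not> same_component (fireproof_forest ({1..n}, rt.E) (terminal_state X \<omega>)) a b"
      using tree_forest by eventually_elim auto
  qed
  finally show ?thesis unfolding spine_eq off_eq .
qed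

end

text \<open>In \<open>1 + harm K\<close> the 1 stands for the edges of the spine and
  \<open>harm K\<close> for the generations up to the cut-off \<open>K\<close>; both are multiplied
  by the mean spine size. The part \<open>K + n / K\<close> does not depend on the spine.\<close>

theorem prob_separated_bound:
  assumes n: "n \<ge> 1" and r: "r > 0" and K: "K \<ge> 1"
  shows "prob joined_sample \<ge>
    1 - r * (2 * sqrt n * (1 + harm K) + K + n / K)"
proof (rule prob_same_component_ge_average[OF n])
  fix a assume a: "a \<in> {1..n}"
  let ?W = "{1..n} - {a}"
  define \<Phi> :: "nat set \<Rightarrow> (nat \<Rightarrow> nat) \<Rightarrow> real"
    where "\<Phi> C g = r * (real (card C) - 1 + (\<Sum>x\<in>{1..n} - C. 1 / level ({1..n} - C) g x))" for C g
  define bd where "bd c = r * (real c * (1 + harm K) + (K + n / K))" for c :: nat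
  have nW: "n = Suc (card ?W)" "insert a ?W = {1..n}" using a n by auto
  have "(\<Sum>g\<in>rooted_trees a. \<Sum>b\<in>{1..n}.
      1 - joined_prob a g b)
    \<le> (\<Sum>g\<in>rooted_trees a. \<Sum>b\<in>insert a ?W. \<Phi> (insert a (branch ?W g b)) (restrict g (?W - branch ?W g b)))"
    unfolding nW(2) \<Phi>_def by (intro sum_mono separated_prob_le n r a)
  also have "\<dots> \<le> (\<Sum>k<n. spine_weight n k * bd (Suc k)) * (n * card (rooted_trees a))"
  proof (rule sum_spine_le)
    fix W' C' assume fin: "finite W'" "finite C'" and C': "C' \<noteq> {}" and disj: "W' \<inter> C' = {}" and un: "W' \<union> C' = insert a ?W"
    have W': "{1..n} - C' = W'" using disj un nW(2) by auto
    have "card W' \<le> n" using card_mono[of "{1..n}" W'] un nW(2) by auto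
    then have wK: "real (card W') / K \<le> n / K" by (intro divide_right_mono) auto
    have "(\<Sum>g\<in>forests W' C'. \<Phi> C' g) = r * ((real (card C') - 1) * card (forests W' C') +
       (\<Sum>g\<in>forests W' C'. \<Sum>x\<in>W'. 1 / card (branch W' g x)))"
      unfolding \<Phi>_def W' by (simp add: sum_distrib_left[symmetric] sum.distrib)
    also have "\<dots> \<le> r * ((real (card C') - 1) * card (forests W' C') +
       (card C' * harm K + K + card W' / K) * card (forests W' C'))"
      using r by (intro mult_left_mono add_left_mono sum_all_inverse_levels fin disj C' K) auto
    also have "\<dots> = r * (real (card C') - 1 + (card C' * harm K + K + card W' / K)) * card (forests W' C')"
      by (simp add: distrib_right distrib_left)
    also have "\<dots> \<le> bd (card C') * card (forests W' C')"
      unfolding bd_def using r wK by (intro mult_right_mono mult_left_mono) (auto simp: distrib_left)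
    finally show "(\<Sum>g\<in>forests W' C'. \<Phi> C' g) \<le> bd (card C') * card (forests W' C')" .
  qed (use nW in auto)
  also have "\<dots> \<le> r * (2 * sqrt n * (1 + harm K) + K + n / K) * (n * card (rooted_trees a))"
  proof (intro mult_right_mono)
    have "(\<Sum>k<n. spine_weight n k * bd (Suc k)) =
      r * ((\<Sum>k<n. real (Suc k) * spine_weight n k) * (1 + harm K) + (\<Sum>k<n. spine_weight n k) * (K + n / K))"
      unfolding bd_def sum_distrib_left sum_distrib_right sum.distrib[symmetric]
      by (intro sum.cong refl) (simp add: algebra_simps)
    also have "\<dots> = r * ((\<Sum>k<n. real (Suc k) * spine_weight n k) * (1 + harm K) + (K + n / K))"
      using n by (simp add: sum_spine_weight)
    also have "\<dots> \<le> r * (2 * sqrt n * (1 + harm K) + (K + n / K))"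
      using n r by (intro mult_left_mono add_right_mono mult_right_mono mean_spine_size) (auto simp: harm_nonneg)
    finally show "(\<Sum>k<n. spine_weight n k * bd (Suc k)) \<le> r * (2 * sqrt n * (1 + harm K) + K + n / K)"
      by (simp only: add.assoc)
  qed simp
  finally show "(\<Sum>g\<in>rooted_trees a. \<Sum>b\<in>{1..n}.
      1 - joined_prob a g b)
    \<le> r * (2 * sqrt n * (1 + harm K) + K + n / K) * (n * card (rooted_trees a))" .
qed

text \<open>Spines with at most \<open>eps * sqrt n\<close> or at least \<open>B * sqrt n\<close>
  vertices are given up, at the price of \<open>eps ^ 2\<close> and \<open>2 / B\<close>. The others
  are long enough for a small exponential and short enough for small second-moment errors.\<close>

theorem prob_same_component_bound:
  assumes n: "n \<ge> 1" and r: "r = 1 / sqrt n" and K: "K \<ge> 1"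
    and eps: "eps > 0" "K \<le> eps * sqrt n" and B: "B > 0"
  shows "prob joined_sample \<le>
    exp (- eps * harm K / 4) + K * (12 * real K / (eps * sqrt n) + 32 * real K * (B / sqrt n) + 3 / 4 * real K ^ 3 * (B / sqrt n)) +
      eps ^ 2 + 2 / B"
    (is "_ \<le> ?\<delta> + eps ^ 2 + 2 / B")
proof (rule prob_same_component_le_average[OF n])
  fix a assume a: "a \<in> {1..n}"
  let ?W = "{1..n} - {a}"
  have r0: "r > 0" and sn: "sqrt n > 0" using n r by auto
  define \<Phi> :: "nat set \<Rightarrow> (nat \<Rightarrow> nat) \<Rightarrow> real"
    where "\<Phi> C g = (if spread_out ({1..n} - C) r K g
      then exp (- r / 2 * (\<Sum>x\<in>{x \<in> {1..n} - C. level ({1..n} - C) g x \<le> K}.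
        1 / level ({1..n} - C) g x)) else 1)" for C g
  define bd where "bd c = (if eps * sqrt n < real c \<and> real c < B * sqrt n then ?\<delta> else 1)" for c :: nat
  have \<delta>0: "?\<delta> \<ge> 0" using eps(1) B by (intro add_nonneg_nonneg mult_nonneg_nonneg) auto
  have nW: "n = Suc (card ?W)" "insert a ?W = {1..n}" using a n by auto
  have "(\<Sum>g\<in>rooted_trees a. \<Sum>b\<in>{1..n}.
      joined_prob a g b)
    \<le> (\<Sum>g\<in>rooted_trees a. \<Sum>b\<in>insert a ?W. \<Phi> (insert a (branch ?W g b)) (restrict g (?W - branch ?W g b)))"
    unfolding nW(2) \<Phi>_def by (intro sum_mono joined_prob_le n r0 a)
  also have "\<dots> \<le> (\<Sum>k<n. spine_weight n k * bd (Suc k)) * (n * card (rooted_trees a))"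
  proof (rule sum_spine_le)
    fix W' C' assume fin: "finite W'" "finite C'" and C': "C' \<noteq> {}" and disj: "W' \<inter> C' = {}" and un: "W' \<union> C' = insert a ?W"
    have W': "{1..n} - C' = W'" using disj un nW(2) by auto
    have cn: "card W' + card C' = n"
      using card_Un_disjoint[OF fin disj] un nW(2) by simp
    show "(\<Sum>g\<in>forests W' C'. \<Phi> C' g) \<le> bd (card C') * card (forests W' C')"
    proof (cases "eps * sqrt n < real (card C') \<and> real (card C') < B * sqrt n")
      case True
      then have KC: "K \<le> card C'" using eps(2) by linarith
      then have c0: "real (card C') > 0" using K by auto
      have "(\<Sum>g\<in>forests W' C'. \<Phi> C' g) \<le> (exp (- r * card C' * harm K / 4) +
        K * (12 * real K / card C' + 32 * real K * card C' / (card W' + card C') + 3 / 4 * r ^ 2 * real K ^ 3 * card C')) * card (forests W' C')"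
        unfolding \<Phi>_def W' using sum_same_component_bound[OF fin disj C' r0 K KC]
        by (simp only: of_nat_mult of_nat_power of_nat_numeral)
      also have "\<dots> \<le> ?\<delta> * card (forests W' C')"
      proof (rule mult_right_mono, rule add_mono[OF _ mult_left_mono[OF add_mono[OF add_mono]]])
        have rc: "eps \<le> r * card C'" using True sn unfolding r by (simp add: field_simps)
        have "eps * harm K \<le> r * card C' * harm K" by (rule mult_right_mono[OF rc]) (simp add: harm_nonneg)
        then show "exp (- r * card C' * harm K / 4) \<le> exp (- eps * harm K / 4)" by simp
        show "12 * real K / card C' \<le> 12 * real K / (eps * sqrt n)"
          using True sn eps(1) c0 by (intro divide_left_mono) auto
        have cB: "real (card C') / n \<le> B / sqrt n"
        proof -
          have "real (card C') / n \<le> B * sqrt n / n" using True by (intro divide_right_mono) auto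
          also have "\<dots> = B / sqrt n" using n by (simp add: field_simps)
          finally show ?thesis .
        qed
        have "32 * real K * (real (card C') / n) \<le> 32 * real K * (B / sqrt n)"
          by (intro mult_left_mono cB) auto
        then show "32 * real K * card C' / real (card W' + card C') \<le> 32 * real K * (B / sqrt n)"
          unfolding cn by simp
        have "3 / 4 * r ^ 2 * real K ^ 3 * card C' = 3 / 4 * real K ^ 3 * (real (card C') / n)"
          using n by (simp add: r power_divide)
        also have "\<dots> \<le> 3 / 4 * real K ^ 3 * (B / sqrt n)"
          by (intro mult_left_mono cB) auto
        finally show "3 / 4 * r ^ 2 * real K ^ 3 * card C' \<le> 3 / 4 * real K ^ 3 * (B / sqrt n)" .
      qed auto
      also have "?\<delta> = bd (card C')" using True by (simp add: bd_def)
      finally show ?thesis .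
    next
      case False
      have "(\<Sum>g\<in>forests W' C'. \<Phi> C' g) \<le> (\<Sum>g\<in>forests W' C'. 1)"
        unfolding \<Phi>_def using r0 by (intro sum_mono) (auto intro!: mult_nonneg_nonneg sum_nonneg)
      moreover have "bd (card C') = 1" unfolding bd_def using False by (rule if_not_P)
      ultimately show ?thesis by simp
    qed
  qed (use nW in auto)
  also have "\<dots> \<le> (?\<delta> + eps ^ 2 + 2 / B) * (n * card (rooted_trees a))"
  proof (intro mult_right_mono)
    have "(\<Sum>k<n. spine_weight n k * bd (Suc k)) \<le>
      (\<Sum>k<n. spine_weight n k * ?\<delta> + spine_weight n k * of_bool (real (Suc k) \<le> eps * sqrt n) +
        spine_weight n k * of_bool (B * sqrt n \<le> real (Suc k)))"
    proof (rule sum_mono)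
      fix k assume "k \<in> {..<n}"
      then have w: "spine_weight n k \<ge> 0" by (intro spine_weight_nonneg) auto
      have "bd (Suc k) \<le> ?\<delta> + of_bool (real (Suc k) \<le> eps * sqrt n) + of_bool (B * sqrt n \<le> real (Suc k))"
        using \<delta>0 by (auto simp: bd_def not_less simp del: of_nat_Suc)
      from mult_left_mono[OF this w]
      show "spine_weight n k * bd (Suc k) \<le> spine_weight n k * ?\<delta> + spine_weight n k * of_bool (real (Suc k) \<le> eps * sqrt n) +
        spine_weight n k * of_bool (B * sqrt n \<le> real (Suc k))"
        by (simp only: distrib_left)
    qed
    also have "\<dots> = ?\<delta> + (\<Sum>k<n. spine_weight n k * of_bool (real (Suc k) \<le> eps * sqrt n)) +
        (\<Sum>k<n. spine_weight n k * of_bool (B * sqrt n \<le> real (Suc k)))"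
      using n by (simp only: sum.distrib sum_distrib_right[symmetric] sum_spine_weight mult_1_left)
    also have "\<dots> \<le> ?\<delta> + eps ^ 2 + 2 / B"
      using n B eps by (intro add_mono spine_small spine_large) auto
    finally show "(\<Sum>k<n. spine_weight n k * bd (Suc k)) \<le> ?\<delta> + eps ^ 2 + 2 / B" .
  qed simp
  finally show "(\<Sum>g\<in>rooted_trees a. \<Sum>b\<in>{1..n}.
      joined_prob a g b)
    \<le> (?\<delta> + eps ^ 2 + 2 / B) * (n * card (rooted_trees a))" .
qed

end

section \<open>Choice of the parameters and passage to the limit\<close>

lemma supercritical_limit:
  assumes "\<alpha> > 1 / 2"
  shows "(\<lambda>n. real n powr - \<alpha> * (2 * sqrt n * (2 + ln n) + (sqrt n + 1) + sqrt n)) \<longlonglongrightarrow> 0"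
proof -
  define d where "d = \<alpha> - 1 / 2"
  have d: "d > 0" and \<alpha>: "\<alpha> = d + 1 / 2" using assms by (auto simp: d_def)
  show ?thesis unfolding \<alpha> using d by real_asymp
qed

text \<open>The exponent is of order \<open>sqrt (ln n)\<close>. Among the polynomial errors the
  largest is of order \<open>K ^ 4 * ln n / sqrt n\<close>, which is
  \<open>n powr (- 1 / 4) * ln n\<close> for \<open>K = n powr (1 / 16)\<close>.\<close>

lemma critical_limit:
  "(\<lambda>n. exp (- (1 / sqrt (ln (real n))) * (ln n / 16) / 4) +
    n powr (1 / 16) * (12 * n powr (1 / 16) / (1 / sqrt (ln n) * sqrt n) + 32 * n powr (1 / 16) * (ln n / sqrt n)
      + 3 / 4 * (n powr (1 / 16)) ^ 3 * (ln n / sqrt n)) + (1 / sqrt (ln n)) ^ 2 + 2 / ln n) \<longlonglongrightarrow> 0"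
  by real_asymp

text \<open>The difference \<open>harm n - ln n\<close> decreases and equals 1 at
  \<open>n = 1\<close>.\<close>

lemma harm_le_ln:
  assumes "n \<ge> 1"
  shows "harm n \<le> 1 + ln (real n)"
proof -
  have "harm (Suc (n - 1)) - ln (real (Suc (n - 1))) \<le> harm (Suc 0) - ln (real (Suc 0))"
    using decseqD[OF decseq_harm_diff_ln, of 0 "n - 1"] by simp
  then show ?thesis using assms by (simp add: harm_expand)
qed

theorem theorem2:
  fixes \<alpha> :: real
    and M :: "nat \<Rightarrow> 'a measure"
    and T :: "nat \<Rightarrow> 'a \<Rightarrow> nat set set"
    and X :: "nat \<Rightarrow> real \<Rightarrow> 'a \<Rightarrow> nat config"
    and U U' :: "nat \<Rightarrow> 'a \<Rightarrow> nat"
    and F :: "nat \<Rightarrow> 'a \<Rightarrow> nat graph"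
  assumes alpha: "\<alpha> \<ge> 1 / 2"
    and fire: "\<And>n. n \<ge> 1 \<Longrightarrow>
      fire_on_cayley_tree (M n) n (real n powr - \<alpha>) (T n) (X n) (U n) (U' n)"
    and forest: "\<And>n \<omega>. n \<ge> 1 \<Longrightarrow>
      F n \<omega> = fireproof_forest ({1..n}, T n \<omega>) (terminal_state (X n) \<omega>)"
  shows "(\<alpha> > 1 / 2 \<longrightarrow>
      (\<lambda>n. measure (M n) {\<omega> \<in> space (M n). same_component (F n \<omega>) (U n \<omega>) (U' n \<omega>)}) \<longlonglongrightarrow> 1) \<and>
    (\<alpha> = 1 / 2 \<longrightarrow>
      (\<lambda>n. measure (M n) {\<omega> \<in> space (M n). same_component (F n \<omega>) (U n \<omega>) (U' n \<omega>)}) \<longlonglongrightarrow> 0)"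
proof (intro conjI impI)
  let ?p = "\<lambda>n. measure (M n) {\<omega> \<in> space (M n). same_component (F n \<omega>) (U n \<omega>) (U' n \<omega>)}"
  {
    assume \<alpha>: "\<alpha> > 1 / 2"
    let ?b = "\<lambda>n. real n powr - \<alpha> * (2 * sqrt n * (2 + ln n) + (sqrt n + 1) + sqrt n)"
    have lower: "1 - ?b n \<le> ?p n" if n: "n \<ge> 1" for n
    proof -
      interpret fire_on_cayley_tree "M n" n "real n powr - \<alpha>" "T n" "X n" "U n" "U' n"
        by (rule fire[OF n])
      \<comment> \<open>This balances \<open>K\<close> against \<open>n / K\<close>: both are of
        order \<open>sqrt n\<close>, below the leading term \<open>sqrt n * ln n\<close>.\<close>
      define K where "K = nat \<lceil>sqrt n\<rceil>"
      have sn: "sqrt n \<ge> 1" using n by simp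
      have K: "K \<ge> 1" "real K \<ge> sqrt n" "real K \<le> sqrt n + 1"
        using sn unfolding K_def by linarith+
      have "sqrt n \<le> n" using n real_le_lsqrt[of "real n" "real n"] by (simp add: power2_eq_square mult_le_cancel_left1)
      then have "K \<le> n" unfolding K_def by linarith
      then have "harm K \<le> 1 + ln (real n)"
        using harm_mono[of K n, where ?'a = real] harm_le_ln[OF n] by linarith
      then have "2 * sqrt n * (1 + harm K) \<le> 2 * sqrt n * (2 + ln n)" by (intro mult_left_mono) auto
      moreover have "real n / K \<le> sqrt n"
      proof -
        have "real K * sqrt n > 0" using K(1) sn by (intro mult_pos_pos) auto
        then have "real n / K \<le> real n / sqrt n" using K(2) by (intro divide_left_mono) auto
        then show ?thesis by (simp add: real_div_sqrt)
      qed
      ultimately have "real n powr - \<alpha> * (2 * sqrt n * (1 + harm K) + K + n / K) \<le> ?b n"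
        using K(3) by (intro mult_left_mono) auto
      moreover have "1 - real n powr - \<alpha> * (2 * sqrt n * (1 + harm K) + K + n / K) \<le> ?p n"
        unfolding forest[OF n] by (rule prob_separated_bound[OF n _ K(1)]) (use n in simp)
      ultimately show ?thesis
        by linarith
    qed
    have upper: "?p n \<le> 1" if n: "n \<ge> 1" for n
    proof -
      interpret fire_on_cayley_tree "M n" n "real n powr - \<alpha>" "T n" "X n" "U n" "U' n"
        by (rule fire[OF n])
      show ?thesis by (rule prob_le_1)
    qed
    have "(\<lambda>n. 1 - ?b n) \<longlonglongrightarrow> 1 - 0"
      by (intro tendsto_diff tendsto_const supercritical_limit \<alpha>)
    then have lim: "(\<lambda>n. 1 - ?b n) \<longlonglongrightarrow> 1" by (simp only: diff_zero)
    have "\<forall>\<^sub>F n in sequentially. 1 - ?b n \<le> ?p n"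
      using eventually_ge_at_top[of 1] by eventually_elim (rule lower)
    moreover have "\<forall>\<^sub>F n in sequentially. ?p n \<le> 1"
      using eventually_ge_at_top[of 1] by eventually_elim (rule upper)
    ultimately show "?p \<longlonglongrightarrow> 1"
      by (rule tendsto_sandwich[OF _ _ lim tendsto_const])
  next
    assume \<alpha>: "\<alpha> = 1 / 2"
    let ?b = "\<lambda>n. exp (- (1 / sqrt (ln (real n))) * (ln n / 16) / 4) +
      n powr (1 / 16) * (12 * n powr (1 / 16) / (1 / sqrt (ln n) * sqrt n) + 32 * n powr (1 / 16) * (ln n / sqrt n)
        + 3 / 4 * (n powr (1 / 16)) ^ 3 * (ln n / sqrt n)) + (1 / sqrt (ln n)) ^ 2 + 2 / ln n"
    have upper: "?p n \<le> ?b n" if n: "n \<ge> 3" "real n powr (1 / 16) \<le> 1 / sqrt (ln n) * sqrt n" for n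
    proof -
      have n1: "n \<ge> 1" and ln: "ln (real n) > 0" using n by auto
      interpret fire_on_cayley_tree "M n" n "real n powr - \<alpha>" "T n" "X n" "U n" "U' n"
        by (rule fire[OF n1])
      \<comment> \<open>A power of \<open>n\<close>, so that \<open>harm K\<close> has the order of
        \<open>ln n\<close>, with an exponent below 1/8, so that
        \<open>K ^ 4 * ln n / sqrt n\<close> tends to 0.\<close>
      define K where "K = nat \<lfloor>real n powr (1 / 16)\<rfloor>"
      \<comment> \<open>It tends to 0 so slowly that \<open>eps * harm K\<close>, of order
        \<open>sqrt (ln n)\<close>, still tends to infinity.\<close>
      define eps where "eps = 1 / sqrt (ln (real n))"
      have eps: "eps > 0" using ln by (simp add: eps_def)
      have "real n powr (1 / 16) \<ge> 1" using n by (intro ge_one_powr_ge_zero) auto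
      then have K: "K \<ge> 1" "real K \<le> real n powr (1 / 16)" "real n powr (1 / 16) \<le> real K + 1"
        unfolding K_def by linarith+
      have "ln n / 16 = ln (real n powr (1 / 16))" using n by (simp add: ln_powr)
      also have "\<dots> \<le> ln (real K + 1)" using K(3) n by (subst ln_le_cancel_iff) auto
      also have "\<dots> \<le> harm K" by (rule ln_le_harm)
      finally have harm: "ln n / 16 \<le> harm K" .
      have r: "real n powr - \<alpha> = 1 / sqrt n"
        unfolding \<alpha> by (simp only: powr_minus_divide powr_half_sqrt[OF of_nat_0_le_iff])
      have Keps: "real K \<le> eps * sqrt n" using K(2) n(2) by (simp add: eps_def)
      \<comment> \<open>The upper cut-off \<open>B\<close> for the spine is \<open>ln n\<close>: it
        tends to infinity and is harmless next to powers of \<open>n\<close>.\<close>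
      have "?p n \<le> exp (- eps * harm K / 4) + K * (12 * real K / (eps * sqrt n) + 32 * real K * (ln n / sqrt n)
          + 3 / 4 * real K ^ 3 * (ln n / sqrt n)) + eps ^ 2 + 2 / ln n"
        unfolding forest[OF n1] by (rule prob_same_component_bound[OF n1 r K(1) eps Keps ln])
      also have "\<dots> \<le> exp (- eps * (ln n / 16) / 4) + n powr (1 / 16) * (12 * n powr (1 / 16) / (eps * sqrt n)
          + 32 * n powr (1 / 16) * (ln n / sqrt n) + 3 / 4 * (n powr (1 / 16)) ^ 3 * (ln n / sqrt n)) + eps ^ 2 + 2 / ln n"
      proof (intro add_mono order_refl)
        have "eps * (ln n / 16) \<le> eps * harm K" using harm eps by (intro mult_left_mono) auto
        then show "exp (- eps * harm K / 4) \<le> exp (- eps * (ln n / 16) / 4)" by simp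
        show "K * (12 * real K / (eps * sqrt n) + 32 * real K * (ln n / sqrt n) + 3 / 4 * real K ^ 3 * (ln n / sqrt n))
          \<le> n powr (1 / 16) * (12 * n powr (1 / 16) / (eps * sqrt n)
          + 32 * n powr (1 / 16) * (ln n / sqrt n) + 3 / 4 * (n powr (1 / 16)) ^ 3 * (ln n / sqrt n))"
        proof (intro mult_mono add_mono divide_right_mono)
          show "real K ^ 3 \<le> (n powr (1 / 16)) ^ 3" using K(2) by (intro power_mono) auto
        qed (use K(2) eps ln in \<open>auto intro!: add_nonneg_nonneg mult_nonneg_nonneg divide_nonneg_nonneg\<close>)
      qed
      finally show ?thesis unfolding eps_def .
    qed
    have "\<forall>\<^sub>F n in sequentially. real n powr (1 / 16) \<le> 1 / sqrt (ln n) * sqrt n"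
      by real_asymp
    with eventually_ge_at_top[of 3] have "\<forall>\<^sub>F n in sequentially. ?p n \<le> ?b n"
      by eventually_elim (rule upper)
    then show "?p \<longlonglongrightarrow> 0"
      by (intro tendsto_sandwich[OF _ _ tendsto_const critical_limit]) auto
  }
qed

end
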